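(* To a harmonic map from a simply connected surface into the 3-sphere $S^3$ one can associate an almost complex surface in the nearly Kähler manifold $S^3\times S^3$, and vice versa. Moreover, the harmonic map is non-conformal if and only if the associated almost complex surface has a non-vanishing holomorphic differential.
   Context: $S^3$ is the set of unit quaternions in $\mathbb{H}=\mathbb{R}^4$, and $\mathbb{R}^3$ is identified with the imaginary quaternions. $\langle\,,\rangle$ denotes the Euclidean inner product and also the usual product metric on $S^3\times S^3$ (extended complex-bilinearly), and $\times$ is the vector product on $\mathbb{R}^3$. $S$ denotes a simply connected Riemann surface and $z=x+iy$ a local complex coordinate on it. A map $f\colon S\to S^3\subset\mathbb{R}^4$ is harmonic if $f_{z\bar z}=-|f_z|^2f$, where $|f_z|^2=\langle f_z,f_{\bar z}\rangle$. It is conformal if $\langle f_z,f_z\rangle=0$, and non-conformal means $\langle f_z,f_z\rangle\neq0$; for harmonic $f$ the function $\langle f_z,f_z\rangle$ is holomorphic. Nearly Kähler structure on $S^3\times S^3$: for $(X,Y)\in T_{(p,q)}(S^3\times S^3)$, $$J(X,Y)=\tfrac{1}{\sqrt3}\bigl(2pq^{-1}Y-X,\,-2qp^{-1}X+Y\bigr),\qquad g(Z,W)=\tfrac12\bigl(\langle Z,W\rangle+\langle JZ,JW\rangle\bigr),$$ and there is an almost product structure $P(X,Y)=(pq^{-1}Y,\,qp^{-1}X)$. An almost complex surface (pseudo-holomorphic curve) $\psi\colon S\to S^3\times S^3$ is a surface for which $J$ maps tangent vectors to tangent vectors. Its holomorphic differential is the holomorphic quadratic differential $g(P\psi_z,\psi_z)\,dz^2$.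 The association goes through surfaces $X$ in $\mathbb{R}^3$ with $X_{xx}+X_{yy}=2H\,X_x\times X_y$, $H$ constant ($H$-surfaces, not necessarily conformal). A harmonic map $f$, with $f_x=f\alpha$, $f_y=f\beta$ for imaginary quaternion valued $\alpha,\beta$, corresponds to the $H$-surface with $H=-1$ obtained, up to translation and overall sign, by integrating $X_x=-\beta$, $X_y=\alpha$. A dilation turns this into an $H$-surface with $H=-\tfrac{2}{\sqrt3}$. By a theorem of Bolton, Dillen, Dioos and Vrancken, $H$-surfaces with $H=-\tfrac{2}{\sqrt3}$ correspond to simply connected almost complex surfaces in $S^3\times S^3$, with $g(P\psi_z,\psi_z)=e^{i\pi/3}\langle X_z,X_z\rangle$. *)

theory Defs
  imports "HOL-Analysis.Analysis"
begin

section \<open>Riemann surfaces\<close>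

text \<open>
  A surface is a subset \<open>S\<close> of a Hausdorff space, with the subspace topology, and a holomorphic atlas
  \<open>A\<close> of charts \<open>(U, \<phi>)\<close>. A map \<open>f\<close> on \<open>S\<close> is studied in the local complex
  coordinate \<open>z = \<phi>\<close> through \<open>f \<circ> inv_into U \<phi>\<close>, on the open set \<open>\<phi> ` U\<close> of the plane.
\<close>

type_synonym 'a charts = "('a set * ('a \<Rightarrow> complex)) set"

definition riemann_surface :: "'a::t2_space set \<Rightarrow> 'a charts \<Rightarrow> bool" where
  "riemann_surface S A \<longleftrightarrow>
     S \<noteq> {} \<and> connected S \<and> (\<Union>(U, \<phi>)\<in>A. U) = S \<and>
     (\<forall>(U, \<phi>)\<in>A. openin (top_of_set S) U \<and> open (\<phi> ` U) \<and>
        homeomorphism U (\<phi> ` U) \<phi> (inv_into U \<phi>)) \<and>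
     (\<forall>(U, \<phi>)\<in>A. \<forall>(W, \<eta>)\<in>A. (\<eta> \<circ> inv_into U \<phi>) holomorphic_on \<phi> ` (U \<inter> W))"


section \<open>Calculus in a complex coordinate\<close>

definition dx :: "(complex \<Rightarrow> 'v::real_normed_vector) \<Rightarrow> complex \<Rightarrow> 'v" where
  "dx F w = frechet_derivative F (at w) 1"

definition dy :: "(complex \<Rightarrow> 'v::real_normed_vector) \<Rightarrow> complex \<Rightarrow> 'v" where
  "dy F w = frechet_derivative F (at w) \<i>"

primrec C_k_on :: "nat \<Rightarrow> complex set \<Rightarrow> (complex \<Rightarrow> 'v::real_normed_vector) \<Rightarrow> bool" where
  "C_k_on 0 V F \<longleftrightarrow> continuous_on V F"
| "C_k_on (Suc k) V F \<longleftrightarrow> F differentiable_on V \<and> C_k_on k V (dx F) \<and> C_k_on k V (dy F)"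

definition smooth_map :: "'a charts \<Rightarrow> ('a \<Rightarrow> 'v::real_normed_vector) \<Rightarrow> bool" where
  "smooth_map A f \<longleftrightarrow> (\<forall>(U, \<phi>)\<in>A. \<forall>k. C_k_on k (\<phi> ` U) (f \<circ> inv_into U \<phi>))"

text \<open>
  The complexification of a real vector space \<open>'v\<close> is \<open>'v * 'v\<close>, the pair \<open>(u, v)\<close> standing for
  \<open>u + \<i> v\<close>.
\<close>

type_synonym 'v cpx = "'v * 'v"

definition cpx_of :: "'v::real_vector \<Rightarrow> 'v cpx" where
  "cpx_of u = (u, 0)"

definition cpx_scale :: "complex \<Rightarrow> 'v::real_vector cpx \<Rightarrow> 'v cpx" where
  "cpx_scale c Z = (Re c *\<^sub>R fst Z - Im c *\<^sub>R snd Z, Re c *\<^sub>R snd Z + Im c *\<^sub>R fst Z)"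

definition cpx_linear :: "('v \<Rightarrow> 'u) \<Rightarrow> 'v cpx \<Rightarrow> 'u cpx" where
  "cpx_linear T Z = (T (fst Z), T (snd Z))"

definition cpx_bilinear :: "('v \<Rightarrow> 'v \<Rightarrow> real) \<Rightarrow> 'v cpx \<Rightarrow> 'v cpx \<Rightarrow> complex" where
  "cpx_bilinear B Z W =
     Complex (B (fst Z) (fst W) - B (snd Z) (snd W)) (B (fst Z) (snd W) + B (snd Z) (fst W))"

definition dz :: "(complex \<Rightarrow> 'v::real_normed_vector cpx) \<Rightarrow> complex \<Rightarrow> 'v cpx" where
  "dz F w = cpx_scale (1/2) (dx F w - cpx_scale \<i> (dy F w))"

definition dzbar :: "(complex \<Rightarrow> 'v::real_normed_vector cpx) \<Rightarrow> complex \<Rightarrow> 'v cpx" where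
  "dzbar F w = cpx_scale (1/2) (dx F w + cpx_scale \<i> (dy F w))"


section \<open>Quaternions\<close>

text \<open>A quaternion is a pair of its real part and its imaginary part in \<open>\<real>\<^sup>3\<close>.\<close>

type_synonym quat = "real * (real^3)"

definition im_quat :: "real^3 \<Rightarrow> quat" where
  "im_quat v = (0, v)"

definition quat_mult :: "quat \<Rightarrow> quat \<Rightarrow> quat" (infixl "\<odot>" 70) where
  "p \<odot> q = (fst p * fst q - snd p \<bullet> snd q,
            fst p *\<^sub>R snd q + fst q *\<^sub>R snd p + cross3 (snd p) (snd q))"

definition quat_inv :: "quat \<Rightarrow> quat" where
  "quat_inv p = (1 / (norm p)\<^sup>2) *\<^sub>R (fst p, - snd p)"

abbreviation S3 :: "quat set" where
  "S3 \<equiv> sphere 0 1"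


section \<open>Harmonic maps into the 3-sphere\<close>

definition harmonic_map :: "'a set \<Rightarrow> 'a charts \<Rightarrow> ('a \<Rightarrow> quat) \<Rightarrow> bool" where
  "harmonic_map S A f \<longleftrightarrow>
     smooth_map A f \<and> f ` S \<subseteq> S3 \<and>
     (\<forall>(U, \<phi>)\<in>A. \<forall>w\<in>\<phi> ` U.
        let F = cpx_of \<circ> (f \<circ> inv_into U \<phi>) in
        dzbar (dz F) w = cpx_scale (- cpx_bilinear inner (dz F w) (dzbar F w)) (F w))"

text \<open>The coefficient of the quadratic differential \<open>\<langle>f\<^sub>z, f\<^sub>z\<rangle> dz\<^sup>2\<close> in a coordinate.\<close>

definition hopf_coeff :: "(complex \<Rightarrow> quat) \<Rightarrow> complex \<Rightarrow> complex" where
  "hopf_coeff F w = cpx_bilinear inner (dz (cpx_of \<circ> F) w) (dz (cpx_of \<circ> F) w)"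

definition conformal_map :: "'a charts \<Rightarrow> ('a \<Rightarrow> quat) \<Rightarrow> bool" where
  "conformal_map A f \<longleftrightarrow>
     (\<forall>(U, \<phi>)\<in>A. \<forall>w\<in>\<phi> ` U. hopf_coeff (f \<circ> inv_into U \<phi>) w = 0)"


section \<open>Almost complex surfaces in the nearly Kaehler manifold of pairs of unit quaternions\<close>

text \<open>
  The tangent space at \<open>(p, q)\<close> is a subspace of \<open>quat * quat\<close>. The formulas below define the
  structure at \<open>(p, q)\<close> on all of \<open>quat * quat\<close>, and are only meaningful on tangent vectors.
\<close>

definition nk_J :: "quat * quat \<Rightarrow> quat * quat \<Rightarrow> quat * quat" where
  "nk_J = (\<lambda>(p, q) (X, Y).
     (1 / sqrt 3) *\<^sub>R (2 *\<^sub>R (p \<odot> quat_inv q \<odot> Y) - X, (-2) *\<^sub>R (q \<odot> quat_inv p \<odot> X) + Y))"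

definition nk_g :: "quat * quat \<Rightarrow> quat * quat \<Rightarrow> quat * quat \<Rightarrow> real" where
  "nk_g b Z W = (1/2) * (Z \<bullet> W + nk_J b Z \<bullet> nk_J b W)"

definition nk_P :: "quat * quat \<Rightarrow> quat * quat \<Rightarrow> quat * quat" where
  "nk_P = (\<lambda>(p, q) (X, Y). (p \<odot> quat_inv q \<odot> Y, q \<odot> quat_inv p \<odot> X))"

text \<open>
  The differential of an almost complex surface intertwines multiplication by \<open>\<i>\<close> on the Riemann
  surface with \<open>J\<close>. As for harmonic maps, branch points and constant maps are not excluded.
\<close>

definition almost_complex_surface :: "'a set \<Rightarrow> 'a charts \<Rightarrow> ('a \<Rightarrow> quat * quat) \<Rightarrow> bool" where
  "almost_complex_surface S A \<psi> \<longleftrightarrow>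
     smooth_map A \<psi> \<and> (\<forall>s\<in>S. fst (\<psi> s) \<in> S3 \<and> snd (\<psi> s) \<in> S3) \<and>
     (\<forall>(U, \<phi>)\<in>A. \<forall>w\<in>\<phi> ` U.
        let \<Psi> = \<psi> \<circ> inv_into U \<phi>; D = frechet_derivative \<Psi> (at w) in
        \<forall>v. nk_J (\<Psi> w) (D v) = D (\<i> * v))"

text \<open>The coefficient of \<open>g (P \<psi>\<^sub>z, \<psi>\<^sub>z) dz\<^sup>2\<close> in a coordinate.\<close>

definition acs_differential_coeff :: "(complex \<Rightarrow> quat * quat) \<Rightarrow> complex \<Rightarrow> complex" where
  "acs_differential_coeff \<Psi> w =
     (let Z = dz (cpx_of \<circ> \<Psi>) w in
      cpx_bilinear (nk_g (\<Psi> w)) (cpx_linear (nk_P (\<Psi> w)) Z) Z)"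

definition vanishing_differential :: "'a charts \<Rightarrow> ('a \<Rightarrow> quat * quat) \<Rightarrow> bool" where
  "vanishing_differential A \<psi> \<longleftrightarrow>
     (\<forall>(U, \<phi>)\<in>A. \<forall>w\<in>\<phi> ` U. acs_differential_coeff (\<psi> \<circ> inv_into U \<phi>) w = 0)"


section \<open>H-surfaces and the association\<close>

definition H_surface :: "real \<Rightarrow> 'a charts \<Rightarrow> ('a \<Rightarrow> real^3) \<Rightarrow> bool" where
  "H_surface H A X \<longleftrightarrow>
     smooth_map A X \<and>
     (\<forall>(U, \<phi>)\<in>A. \<forall>w\<in>\<phi> ` U.
        let Y = X \<circ> inv_into U \<phi> in
        dx (dx Y) w + dy (dy Y) w = (2 * H) *\<^sub>R cross3 (dx Y w) (dy Y w))"

text \<open>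
  The integrability condition of \<open>f\<^sub>x = f \<alpha>\<close>, \<open>f\<^sub>y = f \<beta>\<close> is \<open>\<alpha>\<^sub>y - \<beta>\<^sub>x = 2 \<alpha> \<times> \<beta>\<close>, so among the two
  choices \<open>(X\<^sub>x, X\<^sub>y) = \<plusminus>(\<beta>, - \<alpha>)\<close> it is the one with the plus sign that gives \<open>H = -1\<close>.
\<close>

definition harmonic_H_surface :: "'a charts \<Rightarrow> ('a \<Rightarrow> quat) \<Rightarrow> ('a \<Rightarrow> real^3) \<Rightarrow> bool" where
  "harmonic_H_surface A f X \<longleftrightarrow>
     H_surface (-1) A X \<and>
     (\<forall>(U, \<phi>)\<in>A. \<forall>w\<in>\<phi> ` U.
        let F = f \<circ> inv_into U \<phi>; Y = X \<circ> inv_into U \<phi> in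
        \<exists>\<alpha> \<beta>. dx F w = F w \<odot> im_quat \<alpha> \<and> dy F w = F w \<odot> im_quat \<beta> \<and>
              dx Y w = \<beta> \<and> dy Y w = - \<alpha>)"

text \<open>
  The correspondence of Bolton, Dillen, Dioos and Vrancken. For an almost complex surface \<open>(p, q)\<close>
  with \<open>p\<^sub>x = p \<alpha>\<close>, \<open>p\<^sub>y = p \<beta>\<close>, the factor \<open>q\<close> is governed by \<open>J\<close>, and the integrability conditions
  of the two factors together are
    \<open>\<alpha>\<^sub>y - \<beta>\<^sub>x = 2 \<alpha> \<times> \<beta>\<close>  and  \<open>\<alpha>\<^sub>x + \<beta>\<^sub>y = (2 / \<surd>3) \<alpha> \<times> \<beta>\<close>.
  Rotating \<open>(\<alpha>, \<beta>)\<close> by an angle \<open>\<theta>\<close> gives a closed form iff \<open>tan \<theta> = - \<surd>3\<close>; the angle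
  \<open>2 \<pi> / 3\<close> gives \<open>H = - 2 / \<surd>3\<close> (the other choice gives the opposite sign of \<open>H\<close>).
\<close>

definition acs_H_surface :: "'a charts \<Rightarrow> ('a \<Rightarrow> quat * quat) \<Rightarrow> ('a \<Rightarrow> real^3) \<Rightarrow> bool" where
  "acs_H_surface A \<psi> X \<longleftrightarrow>
     H_surface (- 2 / sqrt 3) A X \<and>
     (\<forall>(U, \<phi>)\<in>A. \<forall>w\<in>\<phi> ` U.
        let p = fst \<circ> \<psi> \<circ> inv_into U \<phi>; Y = X \<circ> inv_into U \<phi>; \<theta> = 2 * pi / 3 in
        \<exists>\<alpha> \<beta>. dx p w = p w \<odot> im_quat \<alpha> \<and> dy p w = p w \<odot> im_quat \<beta> \<and>
              dx Y w = cos \<theta> *\<^sub>R \<alpha> + sin \<theta> *\<^sub>R \<beta> \<and>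
              dy Y w = - sin \<theta> *\<^sub>R \<alpha> + cos \<theta> *\<^sub>R \<beta>)"

text \<open>The dilation by \<open>\<surd>3 / 2\<close> turns \<open>H = -1\<close> into \<open>H = - 2 / \<surd>3\<close>.\<close>

definition associated :: "'a charts \<Rightarrow> ('a \<Rightarrow> quat) \<Rightarrow> ('a \<Rightarrow> quat * quat) \<Rightarrow> bool" where
  "associated A f \<psi> \<longleftrightarrow>
     (\<exists>X. harmonic_H_surface A f X \<and> acs_H_surface A \<psi> (\<lambda>s. (sqrt 3 / 2) *\<^sub>R X s))"

end

(*
  Write omega_F(h) = F^-1 dF(h) for the imaginary quaternion valued form of a map F into the 3-sphere,
  and a = omega_F(1), b = omega_F(i) in a coordinate, so that a_y - b_x = 2 a x b always holds, and F is
  harmonic iff a_x + b_y = 0. An almost complex surface (p, q) is a pair with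
  omega_q(h) = omega_p(e^(i pi/3) h), and the association with f amounts to omega_p(h) = omega_f(c h)
  with c = (sqrt 3 / 2) e^(-i pi/6). Rotations of this kind are compatible with holomorphic coordinate
  changes, and all existence claims say that a rotated form omega(c h) integrates globally.

  Both F^-1 dF = omega and dX = omega are of the form dF = B(F, omega) with B bilinear. A flat equation
  of this form is solved on small balls by integrating along rays, its local solutions form a
  locally constant sheaf, and on a simply connected surface a local solution extends by continuation along paths.
  The two quadratic differentials differ by a non-zero constant factor.
*)
theory Submission
  imports Defs
begin

section \<open>Calculus in a complex coordinate\<close>

text \<open>Where the constants come from: for harmonic f the form h |-> omega_f(c h) has curl 2 (Re
  c) a x b, while a form F^-1 dF that equals it must have curl 2 |c|^2 a x b. Hence it integrates to
  a map into the 3-sphere when |c|^2 = Re c, the circle with diameter from 0 to 1. Both factors of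
  an almost complex surface arise in this way, so c and e^(i pi/3) c must both lie on that circle;
  the only non-zero such c is (sqrt 3 / 2) e^(-i pi/6). The H-surface needs a closed form instead,
  that is Re c = 0, and c = i is taken; that the resulting H is -1 is the structure equation of f.
  In the other direction, the structure equations of p and q together fix the divergence of omega_p
  as (2 / sqrt 3) a x b. This is exactly what lets omega_p(h / c) integrate, and to a harmonic map.
  The freedom of left translations in the correspondence is the invariance of F^-1 dF under F |-> a
  F.\<close>

lemma has_derivative_dx_dy:
  assumes "F differentiable (at w)"
  shows "(F has_derivative (\<lambda>h. Re h *\<^sub>R dx F w + Im h *\<^sub>R dy F w)) (at w)"
proof -
  have D: "(F has_derivative frechet_derivative F (at w)) (at w)"
    using assms by (simp add: frechet_derivative_works)
  then interpret linear "frechet_derivative F (at w)"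
    by (rule has_derivative_linear)
  have "frechet_derivative F (at w) h = Re h *\<^sub>R dx F w + Im h *\<^sub>R dy F w" for h
  proof -
    have "h = Re h *\<^sub>R 1 + Im h *\<^sub>R \<i>"
      by (simp add: complex_eq_iff)
    then have "frechet_derivative F (at w) h = frechet_derivative F (at w) (Re h *\<^sub>R 1 + Im h *\<^sub>R \<i>)"
      by simp
    then show ?thesis
      by (simp only: add scale dx_def dy_def)
  qed
  then have "frechet_derivative F (at w) = (\<lambda>h. Re h *\<^sub>R dx F w + Im h *\<^sub>R dy F w)" ..
  with D show ?thesis by simp
qed

lemma dx_eq: "(F has_derivative F') (at w) \<Longrightarrow> dx F w = F' 1"
  and dy_eq: "(F has_derivative F') (at w) \<Longrightarrow> dy F w = F' \<i>"
  by (metis dx_def frechet_derivative_at, metis dy_def frechet_derivative_at)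

lemma has_derivative_dx_dy_iff:
  "F differentiable (at w) \<and> dx F w = a \<and> dy F w = b \<longleftrightarrow>
   (F has_derivative (\<lambda>h. Re h *\<^sub>R a + Im h *\<^sub>R b)) (at w)"
  using has_derivative_dx_dy[of F w] by (auto simp: differentiable_def dx_eq dy_eq)

lemma frechet_derivative_cong_open:
  assumes "open V" "w \<in> V" "\<And>v. v \<in> V \<Longrightarrow> F v = G v"
  shows "frechet_derivative F (at w) = frechet_derivative G (at w)"
proof -
  \<comment> \<open>\<open>frechet_derivative\<close> is a choice among all derivatives; two maps
    with the same set of derivatives get the same choice, also where that set is empty.\<close>
  have "(F has_derivative D) (at w) \<longleftrightarrow> (G has_derivative D) (at w)" for D
    using assms has_derivative_transform_within_open[of F D w UNIV V G]
      has_derivative_transform_within_open[of G D w UNIV V F] by auto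
  then show ?thesis by (simp add: frechet_derivative_def)
qed

lemma dx_cong_open: "open V \<Longrightarrow> w \<in> V \<Longrightarrow> (\<And>v. v \<in> V \<Longrightarrow> F v = G v) \<Longrightarrow> dx F w = dx G w"
  and dy_cong_open: "open V \<Longrightarrow> w \<in> V \<Longrightarrow> (\<And>v. v \<in> V \<Longrightarrow> F v = G v) \<Longrightarrow> dy F w = dy G w"
  unfolding dx_def dy_def by (metis frechet_derivative_cong_open)+

lemma differentiable_on_cong_open:
  assumes "open V" "\<And>v. v \<in> V \<Longrightarrow> F v = G v"
  shows "F differentiable_on V \<longleftrightarrow> G differentiable_on V"
  unfolding differentiable_on_def
  by (metis assms(2) differentiable_transform_within zero_less_one)

section \<open>Closure properties of the classes C^k\<close>

lemma C_k_on_cong: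
  assumes "open V" "\<And>w. w \<in> V \<Longrightarrow> F w = G w"
  shows "C_k_on k V F \<longleftrightarrow> C_k_on k V G"
  using assms(2)
proof (induction k arbitrary: F G)
  case (Suc k)
  have "dx F w = dx G w" "dy F w = dy G w" if "w \<in> V" for w
    using that Suc.prems by (auto intro: dx_cong_open[OF assms(1)] dy_cong_open[OF assms(1)])
  then have "C_k_on k V (dx F) \<longleftrightarrow> C_k_on k V (dx G)" "C_k_on k V (dy F) \<longleftrightarrow> C_k_on k V (dy G)"
    by (auto intro!: Suc.IH)
  moreover have "F differentiable_on V \<longleftrightarrow> G differentiable_on V"
    by (rule differentiable_on_cong_open) (use assms(1) Suc.prems in auto)
  ultimately show ?case by simp
qed (simp cong: continuous_on_cong)

lemma C_k_on_lower: "C_k_on (Suc k) V F \<Longrightarrow> C_k_on k V F"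
proof (induction k arbitrary: F)
  case 0
  then show ?case by (simp add: differentiable_imp_continuous_on)
next
  case (Suc k)
  from Suc.prems have "F differentiable_on V \<and> C_k_on (Suc k) V (dx F) \<and> C_k_on (Suc k) V (dy F)"
    unfolding C_k_on.simps(2)[of "Suc k"] .
  then have "F differentiable_on V \<and> C_k_on k V (dx F) \<and> C_k_on k V (dy F)"
    by (blast intro: Suc.IH)
  then show ?case unfolding C_k_on.simps(2) .
qed

lemma C_k_on_differentiable:
  "C_k_on (Suc k) V F \<Longrightarrow> open V \<Longrightarrow> w \<in> V \<Longrightarrow> F differentiable (at w)"
  by (auto simp: differentiable_on_eq_differentiable_at)

text \<open>The coefficients \<open>a\<close> and \<open>b\<close> only have to give the derivative
  on \<open>V\<close>; this reduces each closure property below to its differentiation rule.\<close>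

lemma C_k_on_SucI:
  assumes "open V" "\<And>w. w \<in> V \<Longrightarrow> (F has_derivative (\<lambda>h. Re h *\<^sub>R a w + Im h *\<^sub>R b w)) (at w)"
    "C_k_on k V a" "C_k_on k V b"
  shows "C_k_on (Suc k) V F"
proof -
  have "\<And>w. w \<in> V \<Longrightarrow> F differentiable (at w) \<and> dx F w = a w \<and> dy F w = b w"
    using assms(2) has_derivative_dx_dy_iff by blast
  then show ?thesis
    using assms C_k_on_cong[OF assms(1), of "dx F" a] C_k_on_cong[OF assms(1), of "dy F" b]
    by (auto simp: differentiable_on_eq_differentiable_at)
qed

lemma C_k_on_has_derivative:
  "C_k_on (Suc k) V F \<Longrightarrow> open V \<Longrightarrow> w \<in> V \<Longrightarrow>
   (F has_derivative (\<lambda>h. Re h *\<^sub>R dx F w + Im h *\<^sub>R dy F w)) (at w)"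
  by (intro has_derivative_dx_dy C_k_on_differentiable)

lemma C_k_on_add:
  "open V \<Longrightarrow> C_k_on k V F \<Longrightarrow> C_k_on k V G \<Longrightarrow> C_k_on k V (\<lambda>w. F w + G w)"
proof (induction k arbitrary: F G)
  case (Suc k)
  have "C_k_on k V (\<lambda>w. dx F w + dx G w)" "C_k_on k V (\<lambda>w. dy F w + dy G w)"
    using Suc by auto
  moreover have "((\<lambda>w. F w + G w) has_derivative
      (\<lambda>h. Re h *\<^sub>R (dx F w + dx G w) + Im h *\<^sub>R (dy F w + dy G w))) (at w)" if "w \<in> V" for w
    using has_derivative_add[OF C_k_on_has_derivative[OF Suc.prems(2,1) that]
        C_k_on_has_derivative[OF Suc.prems(3,1) that]]
    by (simp add: algebra_simps)
  ultimately show ?case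
    using Suc.prems by (intro C_k_on_SucI[where a="\<lambda>w. dx F w + dx G w" and b="\<lambda>w. dy F w + dy G w"]) auto
qed (auto intro: continuous_intros)

lemma C_k_on_linear:
  assumes "bounded_linear L"
  shows "open V \<Longrightarrow> C_k_on k V F \<Longrightarrow> C_k_on k V (\<lambda>w. L (F w))"
proof (induction k arbitrary: F)
  case 0
  then show ?case
    using bounded_linear.continuous_on[OF assms] by auto
next
  case (Suc k)
  interpret bounded_linear L by fact
  have "C_k_on k V (\<lambda>w. L (dx F w))" "C_k_on k V (\<lambda>w. L (dy F w))"
    using Suc by auto
  moreover have "((\<lambda>w. L (F w)) has_derivative
      (\<lambda>h. Re h *\<^sub>R L (dx F w) + Im h *\<^sub>R L (dy F w))) (at w)" if "w \<in> V" for w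
    using has_derivative[OF C_k_on_has_derivative[OF Suc.prems(2,1) that]]
    by (simp add: add scaleR)
  ultimately show ?case
    using Suc.prems by (intro C_k_on_SucI[where a="\<lambda>w. L (dx F w)" and b="\<lambda>w. L (dy F w)"]) auto
qed

text \<open>By the product rule the partial derivatives contain the undifferentiated factors as
  well, so the induction step also uses both factors at the lower level, supplied by
  \<open>C_k_on_lower\<close>.\<close>

lemma C_k_on_bilinear:
  assumes "bounded_bilinear B"
  shows "open V \<Longrightarrow> C_k_on k V F \<Longrightarrow> C_k_on k V G \<Longrightarrow> C_k_on k V (\<lambda>w. B (F w) (G w))"
proof (induction k arbitrary: F G)
  case 0
  then show ?case
    using bounded_bilinear.continuous_on[OF assms] by auto
next
  case (Suc k)
  interpret bounded_bilinear B by fact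
  have "C_k_on k V (\<lambda>w. B (F w) (dx G w) + B (dx F w) (G w))"
       "C_k_on k V (\<lambda>w. B (F w) (dy G w) + B (dy F w) (G w))"
    using Suc C_k_on_lower[OF Suc.prems(2)] C_k_on_lower[OF Suc.prems(3)]
    by (auto intro!: C_k_on_add)
  moreover have "((\<lambda>w. B (F w) (G w)) has_derivative
      (\<lambda>h. Re h *\<^sub>R (B (F w) (dx G w) + B (dx F w) (G w)) + Im h *\<^sub>R (B (F w) (dy G w) + B (dy F w) (G w)))) (at w)"
    if "w \<in> V" for w
    using FDERIV[OF C_k_on_has_derivative[OF Suc.prems(2,1) that]
        C_k_on_has_derivative[OF Suc.prems(3,1) that]]
    by (simp add: add_left add_right scaleR_left scaleR_right algebra_simps)
  ultimately show ?case
    using Suc.prems by (intro C_k_on_SucI[where a="\<lambda>w. B (F w) (dx G w) + B (dx F w) (G w)" and b="\<lambda>w. B (F w) (dy G w) + B (dy F w) (G w)"]) auto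
qed

lemma C_k_on_scaleR: "open V \<Longrightarrow> C_k_on k V F \<Longrightarrow> C_k_on k V (\<lambda>w. c *\<^sub>R F w)"
  by (rule C_k_on_linear[OF bounded_linear_scaleR_right])

section \<open>Symmetry of second derivatives\<close>

lemma norm_diff_bound: "norm a \<le> x \<Longrightarrow> norm b \<le> y \<Longrightarrow> norm (a - b) \<le> x + y"
  by (rule norm_triangle_le_diff) (rule add_mono)

text \<open>Mean value inequality for \<open>g\<close> minus the linear function of slope
  \<open>m\<close>.\<close>

lemma mean_value_bound:
  assumes D: "\<And>s. s \<in> {0..t} \<Longrightarrow> (g has_vector_derivative g' s) (at s within {0..t})"
    and B: "\<And>s. s \<in> {0..t} \<Longrightarrow> norm (g' s - m) \<le> e" and "0 \<le> t"
  shows "norm (g t - g 0 - t *\<^sub>R m) \<le> t * e"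
proof -
  have "norm ((g t - t *\<^sub>R m) - (g 0 - 0 *\<^sub>R m)) \<le> e * norm (t - 0)"
  proof (rule differentiable_bound[of "{0..t}" _ "\<lambda>s h. h *\<^sub>R (g' s - m)"])
    fix s assume s: "s \<in> {0..t}"
    show "((\<lambda>s. g s - s *\<^sub>R m) has_derivative (\<lambda>h. h *\<^sub>R (g' s - m))) (at s within {0..t})"
      using D[OF s] unfolding has_vector_derivative_def
      by (auto intro!: derivative_eq_intros simp: algebra_simps)
    show "onorm (\<lambda>h. h *\<^sub>R (g' s - m)) \<le> e"
      using B[OF s] by (simp add: onorm_scaleR_left onorm_id)
  qed (use \<open>0 \<le> t\<close> in auto)
  then show ?thesis using \<open>0 \<le> t\<close> by (simp add: algebra_simps)
qed

text \<open>Both mixed derivatives are the limit of the same second difference quotient.\<close>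

lemma mixed_difference_bound:
  fixes F :: "complex \<Rightarrow> 'v::real_normed_vector"
  assumes "open V" "w \<in> V" "norm u = 1" "norm v = 1"
    and D: "\<And>z. z \<in> V \<Longrightarrow> (F has_derivative (\<lambda>h. F' z h)) (at z)"
    and D2: "((\<lambda>z. F' z u) has_derivative F'') (at w)" and "e > 0"
  shows "\<exists>d>0. \<forall>t. 0 < t \<and> t < d \<longrightarrow>
    norm (F (w + t *\<^sub>R u + t *\<^sub>R v) - F (w + t *\<^sub>R v) - F (w + t *\<^sub>R u) + F w - t\<^sup>2 *\<^sub>R F'' v) \<le> e * t\<^sup>2"
proof -
  interpret bounded_linear F'' using D2 by (rule has_derivative_bounded_linear)
  obtain r where r: "r > 0" "ball w r \<subseteq> V"
    using assms(1,2) openE by blast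
  have "\<forall>e>0. \<exists>d>0. \<forall>y. norm (y - w) < d \<longrightarrow> norm (F' y u - F' w u - F'' (y - w)) \<le> e * norm (y - w)"
    using D2 by (simp add: has_derivative_at_alt)
  \<comment> \<open>One third of \<open>e\<close>: the remainders at the two ends of the first
    difference are at most e/3 (s + t) and e/3 s, and s \<le> t.\<close>
  then obtain d0 where d0: "d0 > 0"
    "\<And>y. norm (y - w) < d0 \<Longrightarrow> norm (F' y u - F' w u - F'' (y - w)) \<le> e/3 * norm (y - w)"
    using \<open>e > 0\<close> by (meson divide_pos_pos zero_less_numeral)
  \<comment> \<open>Halving leaves room for the two-step displacement, whose norm is at most s + t
    \<le> 2 t.\<close>
  define d where "d = min r d0 / 2"
  have small: "norm (s *\<^sub>R u + t *\<^sub>R v) \<le> s + t" if "0 \<le> s" "0 \<le> t" for s t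
    using that norm_triangle_ineq[of "s *\<^sub>R u" "t *\<^sub>R v"] assms(3,4) by simp
  show ?thesis
  proof (intro exI[of _ d] conjI allI impI)
    show "d > 0" using r d0 by (simp add: d_def)
    fix t assume t: "0 < t \<and> t < d"
    \<comment> \<open>The second difference is the increment of \<open>g\<close> over [0, t]. The
      derivative of \<open>g\<close> is a first difference of the derivative of \<open>F\<close> in
      direction \<open>u\<close>, hence close to t times \<open>F'' v\<close>.\<close>
    define g where "g s = F (w + s *\<^sub>R u + t *\<^sub>R v) - F (w + s *\<^sub>R u)" for s
    have bnd: "norm (s *\<^sub>R u + t *\<^sub>R v) \<le> s + t" "norm (s *\<^sub>R u) \<le> s"
      "norm (s *\<^sub>R u + t *\<^sub>R v) < d0" "norm (s *\<^sub>R u + t *\<^sub>R v) < r"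
      "norm (s *\<^sub>R u) < d0" "norm (s *\<^sub>R u) < r" if "s \<in> {0..t}" for s
      using small[of s t] small[of s 0] that t by (auto simp: d_def)
    have "norm (g t - g 0 - t *\<^sub>R (t *\<^sub>R F'' v)) \<le> t * (e * t)"
    proof (rule mean_value_bound)
      fix s assume s: "s \<in> {0..t}"
      note b = bnd[OF s]
      have in_V: "w + (s *\<^sub>R u + t *\<^sub>R v) \<in> V" "w + s *\<^sub>R u \<in> V"
        using b r(2) by (auto simp: subset_iff dist_norm norm_minus_commute)
      have 1: "((\<lambda>s. F (w + s *\<^sub>R u + t *\<^sub>R v)) has_derivative
           (\<lambda>h. F' (w + s *\<^sub>R u + t *\<^sub>R v) (h *\<^sub>R u))) (at s within {0..t})"
        using in_V by (intro has_derivative_compose[OF _ D, of _ "\<lambda>h. h *\<^sub>R u"])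
          (auto intro!: derivative_eq_intros simp: add_ac)
      have 2: "((\<lambda>s. F (w + s *\<^sub>R u)) has_derivative
           (\<lambda>h. F' (w + s *\<^sub>R u) (h *\<^sub>R u))) (at s within {0..t})"
        using in_V by (intro has_derivative_compose[OF _ D, of _ "\<lambda>h. h *\<^sub>R u"])
          (auto intro!: derivative_eq_intros simp: add_ac)
      have lin: "linear (F' (w + s *\<^sub>R u + t *\<^sub>R v))" "linear (F' (w + s *\<^sub>R u))"
        using D in_V by (auto simp: add_ac intro!: has_derivative_linear)
      show "(g has_vector_derivative (F' (w + s *\<^sub>R u + t *\<^sub>R v) u - F' (w + s *\<^sub>R u) u)) (at s within {0..t})"
        unfolding has_vector_derivative_def g_def
        using has_derivative_diff[OF 1 2] lin by (simp add: linear_scale scaleR_diff_right)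
      have "norm (F' (w + s *\<^sub>R u + t *\<^sub>R v) u - F' w u - F'' (s *\<^sub>R u + t *\<^sub>R v)) \<le> e/3 * (s + t)"
      proof (rule order_trans)
        show "norm (F' (w + s *\<^sub>R u + t *\<^sub>R v) u - F' w u - F'' (s *\<^sub>R u + t *\<^sub>R v))
            \<le> e/3 * norm (s *\<^sub>R u + t *\<^sub>R v)"
          using d0(2)[of "w + s *\<^sub>R u + t *\<^sub>R v"] b(3) by (simp add: add.assoc)
      qed (use b(1) \<open>e > 0\<close> in \<open>intro mult_left_mono, auto\<close>)
      moreover have "norm (F' (w + s *\<^sub>R u) u - F' w u - F'' (s *\<^sub>R u)) \<le> e/3 * s"
      proof (rule order_trans)
        show "norm (F' (w + s *\<^sub>R u) u - F' w u - F'' (s *\<^sub>R u)) \<le> e/3 * norm (s *\<^sub>R u)"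
          using d0(2)[of "w + s *\<^sub>R u"] b(5) by simp
        show "e/3 * norm (s *\<^sub>R u) \<le> e/3 * s"
          by (rule mult_left_mono) (use b(2) \<open>e > 0\<close> in auto)
      qed
      ultimately have "norm ((F' (w + s *\<^sub>R u + t *\<^sub>R v) u - F' w u - F'' (s *\<^sub>R u + t *\<^sub>R v))
          - (F' (w + s *\<^sub>R u) u - F' w u - F'' (s *\<^sub>R u))) \<le> e/3 * (s + t) + e/3 * s"
        by (rule norm_diff_bound)
      then have "norm (F' (w + s *\<^sub>R u + t *\<^sub>R v) u - F' (w + s *\<^sub>R u) u - t *\<^sub>R F'' v)
          \<le> e/3 * (s + t) + e/3 * s"
        by (simp add: add scaleR algebra_simps)
      also have "\<dots> \<le> e * t"
      proof -
        have "e * s \<le> e * t" using s \<open>e > 0\<close> by simp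
        then show ?thesis by (simp add: field_simps)
      qed
      finally show "norm (F' (w + s *\<^sub>R u + t *\<^sub>R v) u - F' (w + s *\<^sub>R u) u - t *\<^sub>R F'' v) \<le> e * t" .
    qed (use t in auto)
    then show "norm (F (w + t *\<^sub>R u + t *\<^sub>R v) - F (w + t *\<^sub>R v) - F (w + t *\<^sub>R u) + F w - t\<^sup>2 *\<^sub>R F'' v) \<le> e * t\<^sup>2"
      by (simp add: g_def power2_eq_square algebra_simps)
  qed
qed

lemma dx_dy_commute:
  assumes "C_k_on 2 V F" "open V" "w \<in> V"
  shows "dx (dy F) w = dy (dx F) w"
proof -
  let ?F' = "\<lambda>z h. Re h *\<^sub>R dx F z + Im h *\<^sub>R dy F z"
  have C: "C_k_on (Suc (Suc 0)) V F" using assms(1) by (simp add: numeral_2_eq_2)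
  then have C': "C_k_on (Suc 0) V (dx F)" "C_k_on (Suc 0) V (dy F)" by auto
  have D: "(F has_derivative ?F' z) (at z)" if "z \<in> V" for z
    using C_k_on_has_derivative[OF C assms(2) that] .
  note Dx = C_k_on_has_derivative[OF C'(1) assms(2,3)]
  note Dy = C_k_on_has_derivative[OF C'(2) assms(2,3)]
  have "norm (dx (dy F) w - dy (dx F) w) \<le> e" if "e > 0" for e
  proof -
    have e2: "e/2 > 0" using that by simp
    have "\<exists>d>0. \<forall>t. 0 < t \<and> t < d \<longrightarrow>
      norm (F (w + t *\<^sub>R 1 + t *\<^sub>R \<i>) - F (w + t *\<^sub>R \<i>) - F (w + t *\<^sub>R 1) + F w
        - t\<^sup>2 *\<^sub>R (Re \<i> *\<^sub>R dx (dx F) w + Im \<i> *\<^sub>R dy (dx F) w)) \<le> e/2 * t\<^sup>2"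
      by (rule mixed_difference_bound[OF assms(2,3) _ _ D _ e2, where u="1" and v="\<i>"
            and F''="\<lambda>h. Re h *\<^sub>R dx (dx F) w + Im h *\<^sub>R dy (dx F) w"]) (use Dx in simp_all)
    then obtain d1 where d1: "d1 > 0" "\<And>t. 0 < t \<Longrightarrow> t < d1 \<Longrightarrow>
      norm (F (w + t *\<^sub>R 1 + t *\<^sub>R \<i>) - F (w + t *\<^sub>R \<i>) - F (w + t *\<^sub>R 1) + F w
        - t\<^sup>2 *\<^sub>R (Re \<i> *\<^sub>R dx (dx F) w + Im \<i> *\<^sub>R dy (dx F) w)) \<le> e/2 * t\<^sup>2"
      by blast
    have "\<exists>d>0. \<forall>t. 0 < t \<and> t < d \<longrightarrow>
      norm (F (w + t *\<^sub>R \<i> + t *\<^sub>R 1) - F (w + t *\<^sub>R 1) - F (w + t *\<^sub>R \<i>) + F w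
        - t\<^sup>2 *\<^sub>R (Re 1 *\<^sub>R dx (dy F) w + Im 1 *\<^sub>R dy (dy F) w)) \<le> e/2 * t\<^sup>2"
      by (rule mixed_difference_bound[OF assms(2,3) _ _ D _ e2, where u="\<i>" and v="1"
            and F''="\<lambda>h. Re h *\<^sub>R dx (dy F) w + Im h *\<^sub>R dy (dy F) w"]) (use Dy in simp_all)
    then obtain d2 where d2: "d2 > 0" "\<And>t. 0 < t \<Longrightarrow> t < d2 \<Longrightarrow>
      norm (F (w + t *\<^sub>R \<i> + t *\<^sub>R 1) - F (w + t *\<^sub>R 1) - F (w + t *\<^sub>R \<i>) + F w
        - t\<^sup>2 *\<^sub>R (Re 1 *\<^sub>R dx (dy F) w + Im 1 *\<^sub>R dy (dy F) w)) \<le> e/2 * t\<^sup>2"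
      by blast
    define t where "t = min d1 d2 / 2"
    have t: "0 < t" "t < d1" "t < d2" using d1(1) d2(1) by (auto simp: t_def min_def)
    \<comment> \<open>The second difference is symmetric in the two directions, so at a common small
      \<open>t\<close> both mixed derivatives lie within e/2 of m / t^2.\<close>
    define m where "m = F (w + t *\<^sub>R 1 + t *\<^sub>R \<i>) - F (w + t *\<^sub>R \<i>) - F (w + t *\<^sub>R 1) + F w"
    have "norm (m - t\<^sup>2 *\<^sub>R dy (dx F) w) \<le> e/2 * t\<^sup>2" "norm (m - t\<^sup>2 *\<^sub>R dx (dy F) w) \<le> e/2 * t\<^sup>2"
      using d1(2)[of t] d2(2)[of t] t by (simp_all add: m_def algebra_simps)
    then have "norm ((m - t\<^sup>2 *\<^sub>R dy (dx F) w) - (m - t\<^sup>2 *\<^sub>R dx (dy F) w)) \<le> e/2 * t\<^sup>2 + e/2 * t\<^sup>2"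
      by (rule norm_diff_bound)
    then have "norm (t\<^sup>2 *\<^sub>R (dx (dy F) w - dy (dx F) w)) \<le> t\<^sup>2 * e"
      by (simp add: algebra_simps)
    then show ?thesis using t by simp
  qed
  then have "norm (dx (dy F) w - dy (dx F) w) \<le> 0"
    by (rule field_le_epsilon[of _ 0, simplified])
  then show ?thesis by simp
qed

section \<open>Flat linear equations on plane domains\<close>

text \<open>The 1-form with coefficients \<alpha> and \<beta>, evaluated at the point
  \<open>w\<close> on the tangent vector \<open>h\<close>.\<close>

definition form :: "(complex \<Rightarrow> 'v::real_vector) \<Rightarrow> (complex \<Rightarrow> 'v) \<Rightarrow> complex \<Rightarrow> complex \<Rightarrow> 'v" where
  "form \<alpha> \<beta> w h = Re h *\<^sub>R \<alpha> w + Im h *\<^sub>R \<beta> w"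

lemma form_add: "form \<alpha> \<beta> w (h + k) = form \<alpha> \<beta> w h + form \<alpha> \<beta> w k"
  by (simp add: form_def algebra_simps)

lemma norm_form_le:
  assumes "norm (\<alpha> w) \<le> L" "norm (\<beta> w) \<le> L"
  shows "norm (form \<alpha> \<beta> w h) \<le> 2 * L * norm h"
proof -
  have "norm (form \<alpha> \<beta> w h) \<le> \<bar>Re h\<bar> * norm (\<alpha> w) + \<bar>Im h\<bar> * norm (\<beta> w)"
    unfolding form_def by (rule order_trans[OF norm_triangle_ineq]) simp
  also have "\<dots> \<le> norm h * L + norm h * L"
    by (intro add_mono mult_mono abs_Re_le_cmod abs_Im_le_cmod assms) auto
  finally show ?thesis by simp
qed

section \<open>Linear differential equations on the unit interval\<close>

text \<open>At a maximum M of the norm of \<open>D\<close> the mean value inequality reads M \<le>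
  M/2 + c. The factor 1/2 on an interval of length 1 takes the place of an exponential bound; the
  radii below are chosen to reach it.\<close>

lemma linear_growth_bound:
  fixes D :: "real \<Rightarrow> 'g::real_normed_vector"
  assumes D: "\<And>t. t \<in> {0..1} \<Longrightarrow> (D has_vector_derivative D' t) (at t within {0..1})"
    and "D 0 = 0" and B: "\<And>t. t \<in> {0..1} \<Longrightarrow> norm (D' t) \<le> norm (D t) / 2 + c"
    and "t \<in> {0..1}"
  shows "norm (D t) \<le> 2 * c"
proof -
  have "continuous_on {0..1} D"
    using D by (meson continuous_on_vector_derivative)
  then have "continuous_on {0..1} (\<lambda>t. norm (D t))"
    by (intro continuous_intros)
  then obtain s where s: "s \<in> {0..1}" "\<And>t. t \<in> {0..1} \<Longrightarrow> norm (D t) \<le> norm (D s)"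
    using continuous_attains_sup[of "{0..1::real}" "\<lambda>t. norm (D t)"] by auto
  have pos: "0 \<le> norm (D s) / 2 + c"
    using B[OF s(1)] norm_ge_zero order_trans by blast
  have "norm (D s - D 0) \<le> (norm (D s) / 2 + c) * norm (s - 0)"
  proof (rule differentiable_bound[of "{0..1}" _ "\<lambda>t h. h *\<^sub>R D' t"])
    fix t :: real assume t: "t \<in> {0..1}"
    show "(D has_derivative (\<lambda>h. h *\<^sub>R D' t)) (at t within {0..1})"
      using D[OF t] by (simp add: has_vector_derivative_def)
    show "onorm (\<lambda>h. h *\<^sub>R D' t) \<le> norm (D s) / 2 + c"
      using B[OF t] s(2)[OF t] by (simp add: onorm_scaleR_left onorm_id)
  qed (use s in auto)
  also have "\<dots> \<le> norm (D s) / 2 + c"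
    using pos s(1) by (simp add: mult_left_le)
  finally have "norm (D s) \<le> 2 * c" using \<open>D 0 = 0\<close> by simp
  then show ?thesis using s(2)[OF \<open>t \<in> {0..1}\<close>] by simp
qed

text \<open>Picard iteration: the factor 1/2 makes the integral operator a contraction on the whole
  interval at once.\<close>

lemma linear_ode_solution:
  fixes B :: "'g::banach \<Rightarrow> 'v::real_normed_vector \<Rightarrow> 'g"
  assumes "bounded_bilinear B" and a: "continuous_on {0..1} a"
    and small: "\<And>p t. t \<in> {0..1} \<Longrightarrow> norm (B p (a t)) \<le> norm p / 2"
  shows "\<exists>\<phi>. \<phi> 0 = g \<and> (\<forall>t\<in>{0..1}. (\<phi> has_vector_derivative B (\<phi> t) (a t)) (at t within {0..1}))"
proof -
  interpret bounded_bilinear B by fact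
  \<comment> \<open>Clamping to the unit interval extends functions on it to bounded continuous
    functions on the line, which form a complete space as a type.\<close>
  define cl where "cl t = max 0 (min 1 t)" for t :: real
  have cl: "cl t \<in> {0..1}" "t \<in> {0..1} \<Longrightarrow> cl t = t" for t
    by (auto simp: cl_def)
  have cont_cl: "continuous_on UNIV cl"
    unfolding cl_def by (intro continuous_intros)
  define I where "I \<phi> t = g + integral {0..t} (\<lambda>s. B (\<phi> s) (a s))" for \<phi> t
  have contB: "continuous_on {0..1} (\<lambda>s. B (apply_bcontfun \<phi> s) (a s))" for \<phi>
    by (intro continuous_on continuous_on_apply_bcontfun a)
  have contI: "continuous_on {0..1} (I (apply_bcontfun \<phi>))" for \<phi>
    unfolding I_def
    by (intro continuous_intros indefinite_integral_continuous_1 integrable_continuous_interval contB)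
  define T where "T \<phi> = Bcontfun (\<lambda>t. I (apply_bcontfun \<phi>) (cl t))" for \<phi>
  have T: "apply_bcontfun (T \<phi>) t = I (apply_bcontfun \<phi>) (cl t)" for \<phi> t
  proof -
    have "continuous_on UNIV (\<lambda>t. I (apply_bcontfun \<phi>) (cl t))"
      by (rule continuous_on_compose2[OF contI cont_cl]) (use cl in auto)
    moreover have "bounded (range (\<lambda>t. I (apply_bcontfun \<phi>) (cl t)))"
    proof (rule bounded_subset)
      show "bounded (I (apply_bcontfun \<phi>) ` {0..1})"
        by (intro compact_imp_bounded compact_continuous_image contI) auto
    qed (use cl in auto)
    ultimately show ?thesis
      unfolding T_def by (subst Bcontfun_inverse) (auto simp: bcontfun_def)
  qed
  have "\<exists>!\<phi>. T \<phi> = \<phi>"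
  proof (rule banach_fix_type[of "1/2"])
    show "\<forall>\<phi> \<psi>. dist (T \<phi>) (T \<psi>) \<le> 1/2 * dist \<phi> \<psi>"
    proof (intro allI dist_bound)
      fix \<phi> \<psi> t
      have sub: "{0..cl t} \<subseteq> {0..1}" using cl(1)[of t] by auto
      have int: "(\<lambda>s. B (apply_bcontfun \<phi> s) (a s)) integrable_on {0..cl t}" for \<phi>
        using integrable_continuous_interval[OF contB] integrable_subinterval_real sub by blast
      have "norm (integral {0..cl t} (\<lambda>s. B (apply_bcontfun \<phi> s - apply_bcontfun \<psi> s) (a s)))
          \<le> (dist \<phi> \<psi> / 2) * (cl t - 0)"
      proof (rule integral_bound)
        show "continuous_on {0..cl t} (\<lambda>s. B (apply_bcontfun \<phi> s - apply_bcontfun \<psi> s) (a s))"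
          by (intro continuous_on continuous_intros continuous_on_apply_bcontfun continuous_on_subset[OF a sub])
        fix s assume s: "s \<in> {0..cl t}"
        have "norm (apply_bcontfun \<phi> s - apply_bcontfun \<psi> s) \<le> dist \<phi> \<psi>"
          by (metis dist_bounded dist_norm)
        then show "norm (B (apply_bcontfun \<phi> s - apply_bcontfun \<psi> s) (a s)) \<le> dist \<phi> \<psi> / 2"
          using small[of s "apply_bcontfun \<phi> s - apply_bcontfun \<psi> s"] s sub by fastforce
      qed (use cl in auto)
      also have "\<dots> \<le> dist \<phi> \<psi> / 2"
        using cl(1)[of t] by (intro mult_left_le) auto
      finally show "dist (apply_bcontfun (T \<phi>) t) (apply_bcontfun (T \<psi>) t) \<le> 1/2 * dist \<phi> \<psi>"
        using int[of \<phi>] int[of \<psi>]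
        by (simp add: T I_def dist_norm diff_left integral_diff)
    qed
  qed auto
  then obtain \<phi> where \<phi>: "T \<phi> = \<phi>" by blast
  have eq: "apply_bcontfun \<phi> t = I (apply_bcontfun \<phi>) t" if "t \<in> {0..1}" for t
    using T[of \<phi> t] that by (simp add: \<phi> cl)
  have "(apply_bcontfun \<phi> has_vector_derivative B (\<phi> t) (a t)) (at t within {0..1})" if t: "t \<in> {0..1}" for t
  proof (rule has_vector_derivative_transform[OF t eq])
    show "(I (apply_bcontfun \<phi>) has_vector_derivative B (\<phi> t) (a t)) (at t within {0..1})"
      unfolding I_def using integral_has_vector_derivative[OF contB t]
      by (auto intro!: derivative_eq_intros)
  qed
  moreover have "apply_bcontfun \<phi> 0 = g" using eq[of 0] by (simp add: I_def)
  ultimately show ?thesis by blast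
qed

section \<open>Uniform first and second order estimates on compact discs\<close>

lemma C1_bounds:
  fixes F :: "complex \<Rightarrow> 'v::real_normed_vector"
  assumes "open V" "C_k_on 1 V F" "cball w0 r \<subseteq> V"
  shows "\<exists>L\<ge>0. \<forall>u\<in>cball w0 r. norm (F u) \<le> L \<and> norm (dx F u) \<le> L \<and> norm (dy F u) \<le> L \<and>
    (\<forall>v\<in>cball w0 r. norm (F v - F u) \<le> L * norm (v - u))"
proof -
  have C: "C_k_on (Suc 0) V F" using assms by simp
  have bdd: "\<exists>L. \<forall>u\<in>cball w0 r. norm (G u) \<le> L" if "continuous_on V G" for G :: "complex \<Rightarrow> 'v"
    using compact_imp_bounded[OF compact_continuous_image[OF continuous_on_subset[OF that assms(3)] compact_cball]]
    by (auto simp: bounded_iff)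
  have cont: "continuous_on V F" "continuous_on V (dx F)" "continuous_on V (dy F)"
    using C_k_on_lower[OF C] C by simp_all
  obtain L0 L1 L2 where L0: "\<And>u. u \<in> cball w0 r \<Longrightarrow> norm (F u) \<le> L0"
    and L1: "\<And>u. u \<in> cball w0 r \<Longrightarrow> norm (dx F u) \<le> L1"
    and L2: "\<And>u. u \<in> cball w0 r \<Longrightarrow> norm (dy F u) \<le> L2"
    using bdd[OF cont(1)] bdd[OF cont(2)] bdd[OF cont(3)] by blast
  define M where "M = max 0 (max L0 (max L1 L2))"
  have M: "M \<ge> 0" "u \<in> cball w0 r \<Longrightarrow> norm (F u) \<le> M \<and> norm (dx F u) \<le> M \<and> norm (dy F u) \<le> M" for u
    using L0[of u] L1[of u] L2[of u] by (auto simp: M_def)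
  have "norm (F v - F u) \<le> (2 * M) * norm (v - u)" if "u \<in> cball w0 r" "v \<in> cball w0 r" for u v
  proof (rule differentiable_bound[OF convex_cball _ _ that(2,1)])
    fix x assume x: "x \<in> cball w0 r"
    show "(F has_derivative form (dx F) (dy F) x) (at x within cball w0 r)"
      unfolding form_def[abs_def]
      by (rule has_derivative_at_withinI[OF C_k_on_has_derivative[OF C assms(1)]]) (use x assms(3) in auto)
    show "onorm (form (dx F) (dy F) x) \<le> 2 * M"
      using norm_form_le[of "dx F" x M "dy F"] M x by (intro onorm_bound) auto
  qed
  then show ?thesis
  proof (intro exI[of _ "2 * M"] conjI ballI)
    fix u assume "u \<in> cball w0 r"
    with M show "norm (F u) \<le> 2 * M" "norm (dx F u) \<le> 2 * M" "norm (dy F u) \<le> 2 * M"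
      by (smt (verit, best))+
  qed (use M in auto)
qed

text \<open>The quadratic remainder comes from Lipschitz bounds for the two partial derivatives on
  the compact disc, fed into the mean value inequality on the segment from \<open>u\<close> to
  \<open>v\<close>. A single \<open>L\<close> covers all estimates.\<close>

lemma C2_bounds:
  fixes F :: "complex \<Rightarrow> 'v::real_normed_vector"
  assumes "open V" "C_k_on 2 V F" "cball w0 r \<subseteq> V"
  shows "\<exists>L\<ge>0. \<forall>u\<in>cball w0 r. norm (F u) \<le> L \<and> norm (dx F u) \<le> L \<and> norm (dy F u) \<le> L \<and>
    (\<forall>v\<in>cball w0 r. norm (F v - F u) \<le> L * norm (v - u) \<and>
      norm (F v - F u - form (dx F) (dy F) u (v - u)) \<le> L * (norm (v - u))\<^sup>2)"
proof -
  have C: "C_k_on (Suc 1) V F" using assms by (simp add: numeral_2_eq_2)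
  then have Cx: "C_k_on 1 V (dx F)" and Cy: "C_k_on 1 V (dy F)" by auto
  obtain L0 where L0: "L0 \<ge> 0" "\<And>u. u \<in> cball w0 r \<Longrightarrow> norm (F u) \<le> L0 \<and> norm (dx F u) \<le> L0 \<and> norm (dy F u) \<le> L0 \<and>
    (\<forall>v\<in>cball w0 r. norm (F v - F u) \<le> L0 * norm (v - u))"
    using C1_bounds[OF assms(1) C_k_on_lower[OF C] assms(3)] by blast
  obtain L1 where L1: "L1 \<ge> 0" "\<And>u v. u \<in> cball w0 r \<Longrightarrow> v \<in> cball w0 r \<Longrightarrow> norm (dx F v - dx F u) \<le> L1 * norm (v - u)"
    using C1_bounds[OF assms(1) Cx assms(3)] by blast
  obtain L2 where L2: "L2 \<ge> 0" "\<And>u v. u \<in> cball w0 r \<Longrightarrow> v \<in> cball w0 r \<Longrightarrow> norm (dy F v - dy F u) \<le> L2 * norm (v - u)"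
    using C1_bounds[OF assms(1) Cy assms(3)] by blast
  define M where "M = L1 + L2"
  have T: "norm (F v - F u - form (dx F) (dy F) u (v - u)) \<le> norm (v - u) * (2 * M * norm (v - u))"
    if u: "u \<in> cball w0 r" and v: "v \<in> cball w0 r" for u v
  proof (rule differentiable_bound_linearization[where S="closed_segment u v"])
    show "u + t *\<^sub>R (v - u) \<in> closed_segment u v" if "t \<in> {0..1}" for t
      using that by (auto simp: in_segment algebra_simps intro!: exI[of _ t])
    have seg: "closed_segment u v \<subseteq> cball w0 r"
      using u v by (simp add: closed_segment_subset)
    fix x assume x: "x \<in> closed_segment u v"
    then have xb: "x \<in> cball w0 r" using seg by auto
    show "(F has_derivative form (dx F) (dy F) x) (at x within closed_segment u v)"
      unfolding form_def[abs_def]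
      by (rule has_derivative_at_withinI[OF C_k_on_has_derivative[OF C assms(1)]]) (use xb assms(3) in auto)
    have xu: "norm (x - u) \<le> norm (v - u)"
      using segment_bound1[OF x] by (simp add: norm_minus_commute)
    have "norm (dx F x - dx F u) \<le> M * norm (v - u)" "norm (dy F x - dy F u) \<le> M * norm (v - u)"
      using L1 L2 u xb xu by (auto simp: M_def intro!: order_trans[OF _ mult_mono[OF _ xu]])
    then have "norm (form (\<lambda>x. dx F x - dx F u) (\<lambda>x. dy F x - dy F u) x h) \<le> 2 * (M * norm (v - u)) * norm h" for h
      by (rule norm_form_le)
    then show "onorm (form (dx F) (dy F) x - form (dx F) (dy F) u) \<le> 2 * M * norm (v - u)"
      using L1 L2 by (intro onorm_bound) (auto simp: M_def form_def fun_diff_def algebra_simps)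
  qed auto
  define L where "L = L0 + 2 * M"
  have L: "L \<ge> L0" "L \<ge> 2 * M" "L \<ge> 0" using L0(1) L1(1) L2(1) by (auto simp: L_def M_def)
  show ?thesis
  proof (intro exI[of _ L] conjI ballI)
    fix u assume u: "u \<in> cball w0 r"
    show "norm (F u) \<le> L" "norm (dx F u) \<le> L" "norm (dy F u) \<le> L"
      using L0(2)[OF u] L by auto
    fix v assume v: "v \<in> cball w0 r"
    have "norm (F v - F u) \<le> L0 * norm (v - u)" using L0(2)[OF u] v by auto
    also have "\<dots> \<le> L * norm (v - u)" using L by (intro mult_right_mono) auto
    finally show "norm (F v - F u) \<le> L * norm (v - u)" .
    have "norm (F v - F u - form (dx F) (dy F) u (v - u)) \<le> (2 * M) * (norm (v - u))\<^sup>2"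
      using T[OF u v] by (simp add: power2_eq_square mult_ac)
    also have "\<dots> \<le> L * (norm (v - u))\<^sup>2" using L by (intro mult_right_mono) auto
    finally show "norm (F v - F u - form (dx F) (dy F) u (v - u)) \<le> L * (norm (v - u))\<^sup>2" .
  qed (use L in auto)
qed

text \<open>Comparing solutions on neighbouring rays produces a quadratic remainder; this converts
  it into differentiability.\<close>

lemma has_derivative_quadratic:
  assumes L: "bounded_linear L" and "d > 0"
    and bnd: "\<And>h. norm h < d \<Longrightarrow> norm (F (w + h) - F w - L h) \<le> C * (norm h)\<^sup>2"
  shows "(F has_derivative L) (at w)"
  unfolding has_derivative_at_alt
proof (intro conjI allI impI L)
  fix e :: real assume "e > 0"
  \<comment> \<open>Positive even if \<open>C\<close> is not, so that e / C' is a positive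
    radius.\<close>
  define C' where "C' = \<bar>C\<bar> + 1"
  have C': "C' > 0" "C \<le> C'" by (auto simp: C'_def)
  show "\<exists>d>0. \<forall>y. norm (y - w) < d \<longrightarrow> norm (F y - F w - L (y - w)) \<le> e * norm (y - w)"
  proof (intro exI[of _ "min d (e / C')"] conjI allI impI)
    show "min d (e / C') > 0" using \<open>d > 0\<close> \<open>e > 0\<close> C' by auto
    fix y assume y: "norm (y - w) < min d (e / C')"
    have "norm (F y - F w - L (y - w)) \<le> C * (norm (y - w))\<^sup>2"
      using bnd[of "y - w"] y by simp
    also have "\<dots> \<le> C' * (norm (y - w))\<^sup>2" using C' by (intro mult_right_mono) auto
    also have "\<dots> = (C' * norm (y - w)) * norm (y - w)" by (simp add: power2_eq_square)
    also have "\<dots> \<le> e * norm (y - w)"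
      using y C' by (intro mult_right_mono) (auto simp: field_simps)
    finally show "norm (F y - F w - L (y - w)) \<le> e * norm (y - w)" .
  qed
qed

section \<open>Local uniqueness and existence for flat equations\<close>

definition solves :: "('g::real_normed_vector \<Rightarrow> 'v::real_vector \<Rightarrow> 'g) \<Rightarrow> (complex \<Rightarrow> 'v) \<Rightarrow> (complex \<Rightarrow> 'v::real_vector) \<Rightarrow>
    (complex \<Rightarrow> 'g) \<Rightarrow> complex \<Rightarrow> bool" where
  "solves B \<alpha> \<beta> F w \<longleftrightarrow> (F has_derivative (\<lambda>h. B (F w) (form \<alpha> \<beta> w h))) (at w)"

text \<open>The Frobenius condition: the two sides are the y-derivative of
  \<open>B F \<alpha>\<close> and the x-derivative of \<open>B F \<beta>\<close>, with dF replaced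
  through the equation at a point where \<open>F\<close> has the value \<open>p\<close>. All
  \<open>p\<close> occur because solutions with every initial value are sought.\<close>

definition flat :: "('g::real_normed_vector \<Rightarrow> 'v::real_normed_vector \<Rightarrow> 'g) \<Rightarrow> (complex \<Rightarrow> 'v) \<Rightarrow> (complex \<Rightarrow> 'v) \<Rightarrow> complex \<Rightarrow> bool" where
  "flat B \<alpha> \<beta> w \<longleftrightarrow> (\<forall>p.
     B p (dy \<alpha> w) + B (B p (\<beta> w)) (\<alpha> w) = B p (dx \<beta> w) + B (B p (\<alpha> w)) (\<beta> w))"

text \<open>Symmetry of the second derivative of a would-be solution in arbitrary directions
  \<open>v\<close> and \<open>h\<close>. The difference of the two sides is alternating in these
  directions, hence the area factor \<open>?c\<close> times its value on the coordinate
  directions.\<close>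

lemma flat_swap:
  assumes "bounded_bilinear B" "flat B \<alpha> \<beta> w"
  shows "B p (form (\<lambda>w. form (dx \<alpha>) (dy \<alpha>) w v) (\<lambda>w. form (dx \<beta>) (dy \<beta>) w v) w h) + B (B p (form \<alpha> \<beta> w v)) (form \<alpha> \<beta> w h)
    = B p (form (\<lambda>w. form (dx \<alpha>) (dy \<alpha>) w h) (\<lambda>w. form (dx \<beta>) (dy \<beta>) w h) w v) + B (B p (form \<alpha> \<beta> w h)) (form \<alpha> \<beta> w v)"
    (is "?l = ?r")
proof -
  interpret bounded_bilinear B by fact
  let ?c = "Re h * Im v - Im h * Re v"
  have "?l - ?r = ?c *\<^sub>R (B p (dy \<alpha> w) + B (B p (\<beta> w)) (\<alpha> w) - (B p (dx \<beta> w) + B (B p (\<alpha> w)) (\<beta> w)))"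
    by (simp add: form_def add_left add_right scaleR_left scaleR_right algebra_simps)
  also have "\<dots> = 0" using assms(2) by (simp add: flat_def)
  finally show ?thesis by simp
qed

text \<open>The bound 1/2 keeps segments between points of the disc at length at most 1.\<close>

lemma small_radius:
  fixes w0 :: complex
  assumes "open V" "w0 \<in> V"
  obtains r where "r > 0" "cball w0 r \<subseteq> V" "r \<le> 1/2"
proof -
  obtain r where "r > 0" "cball w0 r \<subseteq> V" using assms open_contains_cball by blast
  moreover from this have "cball w0 (min r (1/2)) \<subseteq> V"
    using subset_cball[of "min r (1/2)" r w0] by (meson min.cobounded1 subset_trans)
  ultimately show ?thesis using that[of "min r (1/2)"] by simp
qed

lemma ray_has_vector_derivative:
  assumes "(F has_derivative F') (at (w + t *\<^sub>R v))"
  shows "((\<lambda>t. F (w + t *\<^sub>R v)) has_vector_derivative F' v) (at t within T)"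
proof -
  interpret bounded_linear F' using assms by (rule has_derivative_bounded_linear)
  have "((\<lambda>t. F (w + t *\<^sub>R v)) has_derivative (\<lambda>h. F' (h *\<^sub>R v))) (at t within T)"
    by (rule has_derivative_compose[where f="\<lambda>t. w + t *\<^sub>R v" and g=F, OF _ assms]) (auto intro!: derivative_eq_intros)
  then show ?thesis by (simp add: has_vector_derivative_def scaleR)
qed

text \<open>Along a ray the difference of the two solutions satisfies the homogeneous linear
  equation and starts at 0, so the growth bound applies with inhomogeneity 0.\<close>

lemma solves_unique_locally:
  fixes B :: "'g::real_normed_vector \<Rightarrow> 'v::real_normed_vector \<Rightarrow> 'g"
  assumes bb: "bounded_bilinear B" and "open V" "w0 \<in> V" "continuous_on V \<alpha>" "continuous_on V \<beta>"
    and F: "\<And>w. w \<in> V \<Longrightarrow> solves B \<alpha> \<beta> F w" and G: "\<And>w. w \<in> V \<Longrightarrow> solves B \<alpha> \<beta> G w" and "F w0 = G w0"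
  shows "\<exists>r>0. ball w0 r \<subseteq> V \<and> (\<forall>w\<in>ball w0 r. F w = G w)"
proof -
  interpret bounded_bilinear B by fact
  obtain K where K: "K > 0" "\<And>a b. norm (B a b) \<le> norm a * norm b * K"
    using pos_bounded by blast
  obtain r0 where r0: "r0 > 0" "cball w0 r0 \<subseteq> V" using small_radius[OF assms(2,3)] by metis
  have bdd: "\<exists>L. \<forall>u\<in>cball w0 r0. norm (g u) \<le> L" if "continuous_on V g" for g :: "complex \<Rightarrow> 'v"
    using compact_imp_bounded[OF compact_continuous_image[OF continuous_on_subset[OF that r0(2)] compact_cball]]
    by (auto simp: bounded_iff)
  obtain L1 where L1: "\<And>u. u \<in> cball w0 r0 \<Longrightarrow> norm (\<alpha> u) \<le> L1" using bdd assms by blast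
  obtain L2 where L2: "\<And>u. u \<in> cball w0 r0 \<Longrightarrow> norm (\<beta> u) \<le> L2" using bdd assms by blast
  define L where "L = 1 + \<bar>L1\<bar> + \<bar>L2\<bar>"
  have L: "L > 0" "u \<in> cball w0 r0 \<Longrightarrow> norm (\<alpha> u) \<le> L" "u \<in> cball w0 r0 \<Longrightarrow> norm (\<beta> u) \<le> L" for u
    using L1[of u] L2[of u] by (auto simp: L_def)
  \<comment> \<open>On rays of length at most \<open>r\<close> the form is bounded by 2 L r, and 2 L
    r K \<le> 1/2 is the factor that the growth bound asks for.\<close>
  define r where "r = min r0 (1 / (4 * L * K))"
  have rr: "r > 0" "r \<le> r0" "r \<le> 1 / (4 * L * K)"
    using r0 L K by (auto simp: r_def)
  then have r: "r > 0" "ball w0 r \<subseteq> cball w0 r0" "4 * L * K * r \<le> 1"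
    using L K by (auto simp: field_simps)
  have "F w = G w" if w: "w \<in> ball w0 r" for w
  proof -
    define v where "v = w - w0"
    have v: "norm v \<le> r" using w by (simp add: v_def dist_norm norm_minus_commute)
    define D where "D t = F (w0 + t *\<^sub>R v) - G (w0 + t *\<^sub>R v)" for t
    have inb: "w0 + t *\<^sub>R v \<in> cball w0 r0" if "t \<in> {0..1}" for t
    proof -
      have "norm (t *\<^sub>R v) \<le> r0"
        using v that r_def mult_mono[of t 1 "norm v" r0] by auto
      then show ?thesis by (simp add: dist_norm)
    qed
    have "norm (D 1) \<le> 2 * 0"
    proof (rule linear_growth_bound[where D'="\<lambda>t. B (D t) (form \<alpha> \<beta> (w0 + t *\<^sub>R v) v)"])
      fix t :: real assume t: "t \<in> {0..1}"
      have V: "w0 + t *\<^sub>R v \<in> V" using inb[OF t] r0 by auto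
      show "(D has_vector_derivative B (D t) (form \<alpha> \<beta> (w0 + t *\<^sub>R v) v)) (at t within {0..1})"
        unfolding D_def diff_left
        by (intro has_vector_derivative_diff ray_has_vector_derivative
            F[OF V, unfolded solves_def] G[OF V, unfolded solves_def])
      have "norm (form \<alpha> \<beta> (w0 + t *\<^sub>R v) v) \<le> 2 * L * norm v"
        using L inb[OF t] by (intro norm_form_le) auto
      also have "\<dots> \<le> 2 * L * r" using v L by auto
      finally have "norm (B (D t) (form \<alpha> \<beta> (w0 + t *\<^sub>R v) v)) \<le> norm (D t) * (2 * L * r) * K"
        using K by (intro order_trans[OF K(2)] mult_right_mono mult_left_mono) auto
      also have "\<dots> = norm (D t) * (4 * L * K * r) / 2" by simp
      also have "\<dots> \<le> norm (D t) / 2" by (intro divide_right_mono mult_left_le r(3)) auto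
      finally show "norm (B (D t) (form \<alpha> \<beta> (w0 + t *\<^sub>R v) v)) \<le> norm (D t) / 2 + 0" by simp
    qed (auto simp: D_def \<open>F w0 = G w0\<close>)
    then show ?thesis by (simp add: D_def v_def)
  qed
  then show ?thesis using r r0 by (intro exI[of _ r]) auto
qed

text \<open>
  A solution through \<open>w1\<close> is obtained by integrating along the rays from \<open>w1\<close>. For neighbouring rays
  to \<open>w\<close> and \<open>w + h\<close>, flatness makes the difference of the two solutions minus its expected linear
  part satisfy a linear differential inequality along the ray with inhomogeneity of order \<open>h\<^sup>2\<close>.
\<close>

lemma solves_exists_locally:
  fixes B :: "'g::banach \<Rightarrow> 'v::real_normed_vector \<Rightarrow> 'g"
  assumes bb: "bounded_bilinear B" and "open V" "w0 \<in> V" "C_k_on 2 V \<alpha>" "C_k_on 2 V \<beta>"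
    and flat: "\<And>w. w \<in> V \<Longrightarrow> flat B \<alpha> \<beta> w"
  shows "\<exists>r>0. ball w0 r \<subseteq> V \<and> (\<forall>w1\<in>ball w0 r. \<forall>g. \<exists>F. F w1 = g \<and> (\<forall>w\<in>ball w0 r. solves B \<alpha> \<beta> F w))"
proof -
  interpret bounded_bilinear B by fact
  obtain K where K: "K > 0" "\<And>a b. norm (B a b) \<le> norm a * norm b * K"
    using pos_bounded by blast
  obtain r0 where r0: "r0 > 0" "cball w0 r0 \<subseteq> V" "r0 \<le> 1/2" using small_radius[OF assms(2,3)] by metis
  obtain L1 where L1: "L1 \<ge> 0" "\<And>u. u \<in> cball w0 r0 \<Longrightarrow> norm (\<alpha> u) \<le> L1 \<and> norm (dx \<alpha> u) \<le> L1 \<and> norm (dy \<alpha> u) \<le> L1 \<and>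
    (\<forall>v\<in>cball w0 r0. norm (\<alpha> v - \<alpha> u) \<le> L1 * norm (v - u) \<and>
      norm (\<alpha> v - \<alpha> u - form (dx \<alpha>) (dy \<alpha>) u (v - u)) \<le> L1 * (norm (v - u))\<^sup>2)"
    using C2_bounds[OF assms(2,4) r0(2)] by metis
  obtain L2 where L2: "L2 \<ge> 0" "\<And>u. u \<in> cball w0 r0 \<Longrightarrow> norm (\<beta> u) \<le> L2 \<and> norm (dx \<beta> u) \<le> L2 \<and> norm (dy \<beta> u) \<le> L2 \<and>
    (\<forall>v\<in>cball w0 r0. norm (\<beta> v - \<beta> u) \<le> L2 * norm (v - u) \<and>
      norm (\<beta> v - \<beta> u - form (dx \<beta>) (dy \<beta>) u (v - u)) \<le> L2 * (norm (v - u))\<^sup>2)"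
    using C2_bounds[OF assms(2,5) r0(2)] by metis
  define L where "L = 1 + L1 + L2"
  have L: "L > 0" "L1 \<le> L" "L2 \<le> L" using L1(1) L2(1) by (auto simp: L_def)
  have form_bound: "norm (form \<alpha> \<beta> u h) \<le> 2 * L * norm h"
    and form_dx_bound: "norm (form (dx \<alpha>) (dy \<alpha>) u h) \<le> 2 * L * norm h"
    and form_dy_bound: "norm (form (dx \<beta>) (dy \<beta>) u h) \<le> 2 * L * norm h" if "u \<in> cball w0 r0" for u h
    using L1(2)[OF that] L2(2)[OF that] L by (auto intro!: norm_form_le)
  have form_lip: "norm (form \<alpha> \<beta> v h - form \<alpha> \<beta> u h) \<le> 2 * L * norm (v - u) * norm h"
    if u: "u \<in> cball w0 r0" and v: "v \<in> cball w0 r0" for u v h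
  proof -
    have "norm (\<alpha> v - \<alpha> u) \<le> L * norm (v - u)" "norm (\<beta> v - \<beta> u) \<le> L * norm (v - u)"
      using L1(2)[OF u] L2(2)[OF u] v L
      by (blast intro: order_trans mult_right_mono norm_ge_zero)+
    then have "norm (form (\<lambda>v. \<alpha> v - \<alpha> u) (\<lambda>v. \<beta> v - \<beta> u) v h) \<le> 2 * (L * norm (v - u)) * norm h"
      by (rule norm_form_le)
    then show ?thesis by (simp add: form_def algebra_simps)
  qed
  define dform where "dform u k h = form (\<lambda>w. form (dx \<alpha>) (dy \<alpha>) w k) (\<lambda>w. form (dx \<beta>) (dy \<beta>) w k) u h" for u k h
  have dform_bound: "norm (dform u k h) \<le> 4 * L * norm k * norm h" if "u \<in> cball w0 r0" for u k h
  proof -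
    have "norm (dform u k h) \<le> 2 * (2 * L * norm k) * norm h"
      unfolding dform_def using that by (intro norm_form_le form_dx_bound form_dy_bound)
    then show ?thesis by simp
  qed
  have taylor: "norm (form \<alpha> \<beta> v h - form \<alpha> \<beta> u h - dform u (v - u) h) \<le> 2 * L * (norm (v - u))\<^sup>2 * norm h"
    if u: "u \<in> cball w0 r0" and v: "v \<in> cball w0 r0" for u v h
  proof -
    let ?a = "\<lambda>v. \<alpha> v - \<alpha> u - form (dx \<alpha>) (dy \<alpha>) u (v - u)"
    let ?b = "\<lambda>v. \<beta> v - \<beta> u - form (dx \<beta>) (dy \<beta>) u (v - u)"
    have "norm (?a v) \<le> L * (norm (v - u))\<^sup>2" "norm (?b v) \<le> L * (norm (v - u))\<^sup>2"
      using L1(2)[OF u] L2(2)[OF u] v L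
      by (blast intro: order_trans mult_right_mono zero_le_power2)+
    then have "norm (form ?a ?b v h) \<le> 2 * (L * (norm (v - u))\<^sup>2) * norm h"
      by (rule norm_form_le)
    then show ?thesis by (simp add: form_def dform_def algebra_simps)
  qed
  \<comment> \<open>Rays now start at an arbitrary \<open>w1\<close> of the ball and may have length
    up to 2 r, hence 8 in place of the 4 of the uniqueness proof.\<close>
  define r where "r = min r0 (1 / (8 * L * K))"
  have rr: "r > 0" "r \<le> r0" "r \<le> 1 / (8 * L * K)"
    using r0 L K by (auto simp: r_def)
  then have r: "r > 0" "ball w0 r \<subseteq> cball w0 r0" "8 * L * K * r \<le> 1" "r \<le> 1/2"
    using r0 L K by (auto simp: field_simps)
  have "\<exists>F. F w1 = g \<and> (\<forall>w\<in>ball w0 r. solves B \<alpha> \<beta> F w)" if w1: "w1 \<in> ball w0 r" for w1 g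
  proof -
    have inb: "w1 + t *\<^sub>R (w - w1) \<in> cball w0 r0" if "w \<in> ball w0 r" "t \<in> {0..1}" for w t
    proof -
      have "w1 + t *\<^sub>R (w - w1) = (1 - t) *\<^sub>R w1 + t *\<^sub>R w" by (simp add: algebra_simps)
      moreover have "\<dots> \<in> ball w0 r"
        using convex_ball[of w0 r] w1 that by (auto simp: convex_alt)
      ultimately show ?thesis using r(2) by auto
    qed
    have short: "norm (w - w1) \<le> 2 * r" "norm (w - w1) \<le> 1" if "w \<in> ball w0 r" for w
    proof -
      have "dist w w1 \<le> dist w w0 + dist w1 w0" by (rule dist_triangle2)
      then show "norm (w - w1) \<le> 2 * r" using that w1 by (simp add: dist_norm norm_minus_commute)
      then show "norm (w - w1) \<le> 1" using r by simp
    qed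
    have half: "norm (B p (form \<alpha> \<beta> (w1 + t *\<^sub>R (w - w1)) (w - w1))) \<le> norm p / 2"
      if w: "w \<in> ball w0 r" and t: "t \<in> {0..1}" for p w t
    proof -
      have "norm (form \<alpha> \<beta> (w1 + t *\<^sub>R (w - w1)) (w - w1)) \<le> 2 * L * (2 * r)"
        using short[OF w] L by (intro order_trans[OF form_bound[OF inb[OF w t]]] mult_left_mono) auto
      then have "norm (B p (form \<alpha> \<beta> (w1 + t *\<^sub>R (w - w1)) (w - w1))) \<le> norm p * (2 * L * (2 * r)) * K"
        using K by (intro order_trans[OF K(2)] mult_right_mono mult_left_mono) auto
      also have "\<dots> = norm p * (8 * L * K * r) / 2" by simp
      also have "\<dots> \<le> norm p / 2" by (intro divide_right_mono mult_left_le r(3)) auto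
      finally show ?thesis .
    qed
    \<comment> \<open>One linear equation for each end point \<open>w\<close>; so far nothing
      relates the solutions on different rays.\<close>
    have "\<exists>\<phi>. \<phi> 0 = g \<and> (\<forall>t\<in>{0..1}. (\<phi> has_vector_derivative
        B (\<phi> t) (form \<alpha> \<beta> (w1 + t *\<^sub>R (w - w1)) (w - w1))) (at t within {0..1}))"
      if w: "w \<in> ball w0 r" for w
    proof (rule linear_ode_solution[OF bb])
      have "continuous_on V \<alpha>" "continuous_on V \<beta>"
        using assms(4,5) by (auto simp: numeral_2_eq_2 intro: differentiable_imp_continuous_on)
      then show "continuous_on {0..1} (\<lambda>t. form \<alpha> \<beta> (w1 + t *\<^sub>R (w - w1)) (w - w1))"
        unfolding form_def using inb[OF w] r0(2)
        by (intro continuous_intros; elim continuous_on_compose2) (auto intro!: continuous_intros)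
    qed (rule half[OF w])
    then obtain \<phi> where \<phi>0: "\<And>w. w \<in> ball w0 r \<Longrightarrow> \<phi> w 0 = g"
      and \<phi>: "\<And>w t. w \<in> ball w0 r \<Longrightarrow> t \<in> {0..1} \<Longrightarrow> (\<phi> w has_vector_derivative
        B (\<phi> w t) (form \<alpha> \<beta> (w1 + t *\<^sub>R (w - w1)) (w - w1))) (at t within {0..1})"
      by metis
    have \<phi>_bound: "norm (\<phi> w t) \<le> 2 * norm g" if w: "w \<in> ball w0 r" and t: "t \<in> {0..1}" for w t
    proof -
      \<comment> \<open>The growth bound wants initial value 0, so it is applied to \<phi> - g, at
        the price of the inhomogeneity norm g / 2.\<close>
      have "norm (\<phi> w t - g) \<le> 2 * (norm g / 2)"
      proof (rule linear_growth_bound[OF _ _ _ t])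
        fix t :: real assume t: "t \<in> {0..1}"
        show "((\<lambda>t. \<phi> w t - g) has_vector_derivative
            B (\<phi> w t) (form \<alpha> \<beta> (w1 + t *\<^sub>R (w - w1)) (w - w1))) (at t within {0..1})"
          using \<phi>[OF w t] by (auto intro!: derivative_eq_intros)
        show "norm (B (\<phi> w t) (form \<alpha> \<beta> (w1 + t *\<^sub>R (w - w1)) (w - w1))) \<le> norm (\<phi> w t - g) / 2 + norm g / 2"
          using half[OF w t, of "\<phi> w t"] norm_triangle_ineq[of "\<phi> w t - g" g] by simp
      qed (use \<phi>0[OF w] in simp)
      then show ?thesis using norm_triangle_ineq[of "\<phi> w t - g" g] by simp
    qed
    \<comment> \<open>\<open>P\<close> bounds all ray solutions; the two summands of
      \<open>C\<close> come from the estimates of \<open>?T1\<close> and \<open>?T2\<close>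
      below.\<close>
    define P where "P = 2 * norm g"
    define C where "C = 6 * K * P * L + 8 * K\<^sup>2 * L\<^sup>2 * P"
    have P: "P \<ge> 0" by (simp add: P_def)
    have main: "norm (\<phi> (w + h) 1 - \<phi> w 1 - B (\<phi> w 1) (form \<alpha> \<beta> w h)) \<le> 2 * (C * (norm h)\<^sup>2)"
      if w: "w \<in> ball w0 r" and wh: "w + h \<in> ball w0 r" for w h
    proof -
      define v where "v = w - w1"
      define v' where "v' = w + h - w1"
      define u where "u t = w1 + t *\<^sub>R v" for t
      define u' where "u' t = w1 + t *\<^sub>R v'" for t
      have v': "v' = v + h" "norm v' \<le> 1" using short(2)[OF wh] by (auto simp: v_def v'_def)
      have uu: "u' t - u t = t *\<^sub>R h" for t by (simp add: u_def u'_def v'(1) algebra_simps)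
      define \<psi> where "\<psi> = \<phi> w"
      define \<psi>' where "\<psi>' = \<phi> (w + h)"
      \<comment> \<open>When the end point moves by \<open>h\<close>, the point at parameter
        \<open>t\<close> moves by t h, so the predicted change of the solution is t times the
        right-hand side on \<open>h\<close>. \<open>D\<close> is the error of this prediction: it
        vanishes at 0, and at 1 it is the remainder of the derivative.\<close>
      define D where "D t = \<psi>' t - \<psi> t - t *\<^sub>R B (\<psi> t) (form \<alpha> \<beta> (u t) h)" for t
      have "norm (D 1) \<le> 2 * (C * (norm h)\<^sup>2)"
      proof (rule linear_growth_bound)
        fix t :: real assume t: "t \<in> {0..1}"
        have ub: "u t \<in> cball w0 r0" and ub': "u' t \<in> cball w0 r0"
          using inb[OF w t] inb[OF wh t] by (simp_all add: u_def v_def u'_def v'_def)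
        then have uV: "u t \<in> V" using r0 by auto
        have C2: "C_k_on (Suc 1) V \<alpha>" "C_k_on (Suc 1) V \<beta>"
          using assms(4,5) by (simp_all add: numeral_2_eq_2)
        have "((\<lambda>t. \<alpha> (u t)) has_vector_derivative form (dx \<alpha>) (dy \<alpha>) (u t) v) (at t within {0..1})"
          "((\<lambda>t. \<beta> (u t)) has_vector_derivative form (dx \<beta>) (dy \<beta>) (u t) v) (at t within {0..1})"
          using C_k_on_has_derivative[OF C2(1) assms(2) uV] C_k_on_has_derivative[OF C2(2) assms(2) uV]
          unfolding u_def form_def by (auto dest: ray_has_vector_derivative)
        then have d1: "((\<lambda>t. form \<alpha> \<beta> (u t) h) has_vector_derivative dform (u t) v h) (at t within {0..1})"
          unfolding form_def[of \<alpha> \<beta>] dform_def form_def[of "\<lambda>w. form (dx \<alpha>) (dy \<alpha>) w v"]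
          by (auto intro!: derivative_eq_intros)
        have d2: "(\<psi> has_vector_derivative B (\<psi> t) (form \<alpha> \<beta> (u t) v)) (at t within {0..1})"
          "(\<psi>' has_vector_derivative B (\<psi>' t) (form \<alpha> \<beta> (u' t) v')) (at t within {0..1})"
          using \<phi>[OF w t] \<phi>[OF wh t] by (simp_all add: u_def v_def u'_def v'_def \<psi>_def \<psi>'_def)
        let ?D' = "B (\<psi>' t) (form \<alpha> \<beta> (u' t) v') - B (\<psi> t) (form \<alpha> \<beta> (u t) v)
            - (t *\<^sub>R (B (\<psi> t) (dform (u t) v h) + B (B (\<psi> t) (form \<alpha> \<beta> (u t) v)) (form \<alpha> \<beta> (u t) h))
              + B (\<psi> t) (form \<alpha> \<beta> (u t) h))"
        show "(D has_vector_derivative ?D') (at t within {0..1})"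
          unfolding D_def using d2 has_vector_derivative[OF d2(1) d1]
          by (auto intro!: derivative_eq_intros)
        let ?S = "form \<alpha> \<beta> (u' t) v' - form \<alpha> \<beta> (u t) v'"
        let ?T0 = "B (D t) (form \<alpha> \<beta> (u' t) v')"
        let ?R = "form \<alpha> \<beta> (u' t) v' - form \<alpha> \<beta> (u t) v' - dform (u t) (u' t - u t) v'"
        let ?T1 = "B (\<psi> t) ((?R) + t *\<^sub>R dform (u t) h h)"
        let ?T2 = "t *\<^sub>R B (B (\<psi> t) (form \<alpha> \<beta> (u t) h)) ((?S) + form \<alpha> \<beta> (u t) h)"
        \<comment> \<open>The only use of flatness: after exchanging \<open>v\<close> and
          \<open>h\<close>, the terms linear in \<open>h\<close> cancel against the expansion of the
          form along the neighbouring ray.\<close>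
        have swap: "B (\<psi> t) (dform (u t) v h) + B (B (\<psi> t) (form \<alpha> \<beta> (u t) v)) (form \<alpha> \<beta> (u t) h)
          = B (\<psi> t) (dform (u t) h v) + B (B (\<psi> t) (form \<alpha> \<beta> (u t) h)) (form \<alpha> \<beta> (u t) v)"
          unfolding dform_def by (rule flat_swap[OF bb flat[OF uV]])
        have lin: "dform (u t) (t *\<^sub>R h) (v + h) = t *\<^sub>R dform (u t) h v + t *\<^sub>R dform (u t) h h"
          by (simp add: dform_def form_def algebra_simps)
        \<comment> \<open>\<open>?T0\<close> is the homogeneous part; \<open>?T1\<close> collects
          the second order terms of the form itself, \<open>?T2\<close> those with a product of two
          forms.\<close>
        have D': "?D' = ?T0 + (?T1 + ?T2)"
          unfolding swap uu D_def v'(1) lin form_add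
          by (simp add: add_left add_right diff_left diff_right scaleR_left scaleR_right algebra_simps)
        have T0: "norm ?T0 \<le> norm (D t) / 2"
          using half[OF wh t, of "D t"] by (simp add: u'_def v'_def)
        have T1: "norm ?T1 \<le> P * (6 * L * (norm h)\<^sup>2) * K"
        proof -
          have th: "norm (t *\<^sub>R h) \<le> norm h" using t by (simp add: mult_left_le_one_le)
          have "norm (?R)
              \<le> 2 * L * (norm (t *\<^sub>R h))\<^sup>2 * norm v'"
            using taylor[OF ub ub', of v'] by (simp only: uu)
          also have "\<dots> \<le> 2 * L * (norm h)\<^sup>2 * 1"
            using th v'(2) L by (intro mult_mono power_mono) auto
          finally have 1: "norm (?R) \<le> 2 * L * (norm h)\<^sup>2"
            by simp
          have "norm (t *\<^sub>R dform (u t) h h) \<le> norm (dform (u t) h h)"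
            using t by (simp add: mult_left_le_one_le)
          also have "\<dots> \<le> 4 * L * (norm h)\<^sup>2"
            using dform_bound[OF ub, of h h] by (simp add: power2_eq_square mult.assoc)
          finally have "norm ((?R) + t *\<^sub>R dform (u t) h h)
              \<le> 6 * L * (norm h)\<^sup>2"
            using 1 norm_triangle_ineq[of "?R" "t *\<^sub>R dform (u t) h h"]
            by linarith
          then show ?thesis
            using \<phi>_bound[OF w t] K P by (intro order_trans[OF K(2)] mult_right_mono mult_mono) (auto simp: P_def \<psi>_def)
        qed
        have T2: "norm ?T2 \<le> (P * (2 * L * norm h) * K) * (4 * L * norm h) * K"
        proof -
          have th: "norm (t *\<^sub>R h) \<le> norm h" using t by (simp add: mult_left_le_one_le)
          have "norm (?S) \<le> 2 * L * norm (t *\<^sub>R h) * norm v'"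
            using form_lip[OF ub ub', of v'] by (simp only: uu)
          also have "\<dots> \<le> 2 * L * norm h * 1"
            using th v'(2) L by (intro mult_mono) auto
          finally have 1: "norm ((?S) + form \<alpha> \<beta> (u t) h) \<le> 4 * L * norm h"
            using form_bound[OF ub, of h]
              norm_triangle_ineq[of "?S" "form \<alpha> \<beta> (u t) h"] by linarith
          have 2: "norm (B (\<psi> t) (form \<alpha> \<beta> (u t) h)) \<le> P * (2 * L * norm h) * K"
            using \<phi>_bound[OF w t] form_bound[OF ub, of h] K P
            by (intro order_trans[OF K(2)] mult_right_mono mult_mono) (auto simp: P_def \<psi>_def)
          have "norm ?T2 \<le> norm (B (B (\<psi> t) (form \<alpha> \<beta> (u t) h)) ((?S) + form \<alpha> \<beta> (u t) h))"
            using t by (simp add: mult_left_le_one_le)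
          also have "\<dots> \<le> (P * (2 * L * norm h) * K) * (4 * L * norm h) * K"
            by (rule order_trans[OF K(2)], intro mult_right_mono mult_mono[OF 2 1]) (use K L P in auto)
          finally show ?thesis .
        qed
        have "norm ?D' \<le> norm ?T0 + (norm ?T1 + norm ?T2)"
          unfolding D' by (rule order_trans[OF norm_triangle_ineq add_left_mono[OF norm_triangle_ineq]])
        also have "\<dots> \<le> norm (D t) / 2 + (P * (6 * L * (norm h)\<^sup>2) * K + (P * (2 * L * norm h) * K) * (4 * L * norm h) * K)"
          by (intro add_mono T0 T1 T2)
        also have "\<dots> = norm (D t) / 2 + C * (norm h)\<^sup>2"
          by (simp add: C_def power2_eq_square algebra_simps)
        finally show "norm ?D' \<le> norm (D t) / 2 + C * (norm h)\<^sup>2" .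
      qed (use \<phi>0[OF w] \<phi>0[OF wh] in \<open>simp_all add: D_def \<psi>_def \<psi>'_def\<close>)
      then show ?thesis by (simp add: D_def \<psi>_def \<psi>'_def u_def v_def)
    qed
    define F where "F w = \<phi> w 1" for w
    have "solves B \<alpha> \<beta> F w" if w: "w \<in> ball w0 r" for w
    proof -
      obtain d where d: "d > 0" "ball w d \<subseteq> ball w0 r" using w by (meson open_ball openE)
      show ?thesis unfolding solves_def
      proof (rule has_derivative_quadratic[OF _ d(1)])
        show "bounded_linear (\<lambda>h. B (F w) (form \<alpha> \<beta> w h))"
          unfolding form_def
          by (intro bounded_linear_compose[OF bounded_linear_right] bounded_linear_add
              bounded_linear_compose[OF bounded_linear_scaleR_left] bounded_linear_Re bounded_linear_Im)
        fix h :: complex assume "norm h < d"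
        then have "w + h \<in> ball w d" by (simp add: dist_norm)
        then have "w + h \<in> ball w0 r" using d(2) by blast
        then show "norm (F (w + h) - F w - B (F w) (form \<alpha> \<beta> w h)) \<le> 2 * C * (norm h)\<^sup>2"
          using main[OF w, of h] by (simp add: F_def)
      qed
    qed
    moreover have "F w1 = g"
    proof -
      \<comment> \<open>The ray from \<open>w1\<close> to itself is constant, so its solution keeps
        the initial value.\<close>
      have "(\<phi> w1 has_vector_derivative 0) (at t within {0..1})" if "t \<in> {0..1}" for t
        using \<phi>[OF w1 that] by (simp add: form_def zero_right)
      then obtain c where "\<And>t. t \<in> {0..1} \<Longrightarrow> \<phi> w1 t = c"
        using has_vector_derivative_zero_constant[of "{0..1::real}" "\<phi> w1"] by auto
      then have "\<phi> w1 1 = \<phi> w1 0" by simp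
      then show ?thesis using \<phi>0[OF w1] by (simp add: F_def)
    qed
    ultimately show ?thesis by blast
  qed
  then show ?thesis using r r0 by (intro exI[of _ r]) auto
qed

section \<open>Continuation on simply connected spaces\<close>

lemma connected_local_invariant:
  assumes "connected Q" "z0 \<in> Q" "z1 \<in> Q"
    and "\<And>z. z \<in> Q \<Longrightarrow> eventually (\<lambda>z'. P z' \<longleftrightarrow> P z) (at z within Q)" and "P z0"
  shows "P z1"
  using connected_local_const[of Q z0 z1 P] assms by (simp add: eq_commute)

lemma simply_connected_const_loop:
  assumes "simply_connected S" "path \<gamma>" "path_image \<gamma> \<subseteq> S" "pathfinish \<gamma> = pathstart \<gamma>" "a \<in> S"
  shows "homotopic_loops S \<gamma> (\<lambda>_. a)"
proof -
  have "path (\<lambda>_. a)" "path_image (\<lambda>_. a) \<subseteq> S" "pathfinish (\<lambda>_. a) = pathstart (\<lambda>_. a)"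
    using assms(5) by (auto simp: path_def path_image_def pathstart_def pathfinish_def)
  then show ?thesis using assms(1-4) unfolding simply_connected_def by blast
qed

lemma continuous_on_locally:
  assumes "\<And>z. z \<in> Q \<Longrightarrow> \<exists>N. open N \<and> z \<in> N \<and> continuous_on (Q \<inter> N) c"
  shows "continuous_on Q c"
  unfolding continuous_on_def
proof
  fix z assume z: "z \<in> Q"
  obtain N where N: "open N" "z \<in> N" "continuous_on (Q \<inter> N) c"
    using assms[OF z] by blast
  then have "(c \<longlongrightarrow> c z) (at z within Q \<inter> N)"
    using z unfolding continuous_on_def by blast
  moreover have "at z within Q \<inter> N = at z within Q"
    by (rule at_within_nhd[OF N(2,1)]) auto
  ultimately show "(c \<longlongrightarrow> c z) (at z within Q)" by simp
qed

text \<open>\<open>sol s F\<close> says that \<open>F\<close> solves an equation at the point \<open>s\<close>.\<close>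

locale local_system =
  fixes S :: "'a::topological_space set" and sol :: "'a \<Rightarrow> ('a \<Rightarrow> 'g::t2_space) \<Rightarrow> bool"
  assumes germ: "\<And>W s F G. openin (top_of_set S) W \<Longrightarrow> s \<in> W \<Longrightarrow> (\<And>t. t \<in> W \<Longrightarrow> F t = G t) \<Longrightarrow> sol s F \<Longrightarrow> sol s G"
    and cont: "\<And>W F. openin (top_of_set S) W \<Longrightarrow> (\<And>s. s \<in> W \<Longrightarrow> sol s F) \<Longrightarrow> continuous_on W F"
    and unique: "\<And>W s F G. openin (top_of_set S) W \<Longrightarrow> s \<in> W \<Longrightarrow> (\<And>t. t \<in> W \<Longrightarrow> sol t F) \<Longrightarrow> (\<And>t. t \<in> W \<Longrightarrow> sol t G) \<Longrightarrow>
        F s = G s \<Longrightarrow> \<exists>W'. openin (top_of_set S) W' \<and> s \<in> W' \<and> (\<forall>t\<in>W'. F t = G t)"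
begin

section \<open>Continuation of solutions along maps\<close>

definition sols :: "'a set \<Rightarrow> ('a \<Rightarrow> 'g) set" where
  "sols W = {F. openin (top_of_set S) W \<and> (\<forall>s\<in>W. sol s F)}"

lemma sols_subset: "F \<in> sols W \<Longrightarrow> openin (top_of_set S) W' \<Longrightarrow> W' \<subseteq> W \<Longrightarrow> F \<in> sols W'"
  by (auto simp: sols_def)

lemma sols_cont: "F \<in> sols W \<Longrightarrow> continuous_on W F"
  using cont by (auto simp: sols_def)

lemma sols_unique:
  assumes "F \<in> sols V" "G \<in> sols W" "s \<in> V" "s \<in> W" "F s = G s"
  obtains W' where "openin (top_of_set S) W'" "s \<in> W'" "\<And>t. t \<in> W' \<Longrightarrow> F t = G t"
  using assms unique[of "V \<inter> W" s F G] by (auto simp: sols_def openin_Int)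

text \<open>Analytic continuation along \<open>H\<close>, recorded by values instead of germs, since
  uniqueness lets the germ of a solution be recovered from its value. \<open>H\<close> may be a
  path, a homotopy or the identity, so that one notion serves for all.\<close>

definition lift :: "'b::topological_space set \<Rightarrow> ('b \<Rightarrow> 'a) \<Rightarrow> ('b \<Rightarrow> 'g) \<Rightarrow> bool" where
  "lift Q H c \<longleftrightarrow> (\<forall>z\<in>Q. \<exists>V F N. F \<in> sols V \<and> open N \<and> z \<in> N \<and> (\<forall>z'\<in>N \<inter> Q. H z' \<in> V \<and> c z' = F (H z')))"

lemma liftD:
  assumes "lift Q H c" "z \<in> Q"
  obtains V F N where "F \<in> sols V" "open N" "z \<in> N" "\<And>z'. z' \<in> N \<Longrightarrow> z' \<in> Q \<Longrightarrow> H z' \<in> V"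
    "\<And>z'. z' \<in> N \<Longrightarrow> z' \<in> Q \<Longrightarrow> c z' = F (H z')"
  using assms unfolding lift_def by (metis IntI)

lemma preimage_open:
  assumes "continuous_on Q H" "H ` Q \<subseteq> S" "openin (top_of_set S) W"
  obtains N where "open N" "\<And>z. z \<in> Q \<Longrightarrow> z \<in> N \<longleftrightarrow> H z \<in> W"
proof -
  obtain T where T: "open T" "W = S \<inter> T" using assms(3) by (auto simp: openin_open)
  then obtain N where N: "open N" "N \<inter> Q = H -` T \<inter> Q"
    using assms(1) unfolding continuous_on_open_invariant by blast
  have "z \<in> N \<longleftrightarrow> H z \<in> W" if "z \<in> Q" for z
  proof -
    have "H z \<in> S" using assms(2) that by auto
    moreover have "z \<in> N \<longleftrightarrow> H z \<in> T" using N(2) that by (auto simp: set_eq_iff)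
    ultimately show ?thesis by (simp add: T(2))
  qed
  then show ?thesis using that[OF N(1)] by auto
qed

lemma lift_solution:
  assumes "F \<in> sols V" "H ` Q \<subseteq> V"
  shows "lift Q H (F \<circ> H)"
  unfolding lift_def using assms by (intro ballI exI[of _ V] exI[of _ F] exI[of _ UNIV]) auto

lemma lift_cong:
  assumes "lift Q H c" "\<And>z. z \<in> Q \<Longrightarrow> H z = H' z" "\<And>z. z \<in> Q \<Longrightarrow> c z = c' z"
  shows "lift Q H' c'"
  unfolding lift_def
proof
  fix z assume "z \<in> Q"
  then obtain V F N where "F \<in> sols V" "open N" "z \<in> N" "\<And>z'. z' \<in> N \<Longrightarrow> z' \<in> Q \<Longrightarrow> H z' \<in> V"
    "\<And>z'. z' \<in> N \<Longrightarrow> z' \<in> Q \<Longrightarrow> c z' = F (H z')" using liftD[OF assms(1)] by metis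
  then show "\<exists>V F N. F \<in> sols V \<and> open N \<and> z \<in> N \<and> (\<forall>z'\<in>N \<inter> Q. H' z' \<in> V \<and> c' z' = F (H' z'))"
    by (intro exI[of _ V] exI[of _ F] exI[of _ N]) (auto simp flip: assms(2,3))
qed

text \<open>Covers restriction to subsets, to the edges of a square and to the halves of a
  concatenated path.\<close>

lemma lift_compose:
  assumes "lift Q H c" "continuous_on Q' \<gamma>" "\<gamma> ` Q' \<subseteq> Q"
  shows "lift Q' (H \<circ> \<gamma>) (c \<circ> \<gamma>)"
  unfolding lift_def
proof
  fix z assume z: "z \<in> Q'"
  then have "\<gamma> z \<in> Q" using assms(3) by auto
  then obtain V F N where V: "F \<in> sols V" "open N" "\<gamma> z \<in> N" "\<And>z'. z' \<in> N \<Longrightarrow> z' \<in> Q \<Longrightarrow> H z' \<in> V"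
    "\<And>z'. z' \<in> N \<Longrightarrow> z' \<in> Q \<Longrightarrow> c z' = F (H z')" using liftD[OF assms(1)] by metis
  obtain N' where N': "open N'" "N' \<inter> Q' = \<gamma> -` N \<inter> Q'"
    using assms(2) V(2) unfolding continuous_on_open_invariant by blast
  have zN': "z \<in> N'" using z V(3) N'(2) by auto
  have in_N: "\<gamma> z' \<in> N" "\<gamma> z' \<in> Q" if "z' \<in> N'" "z' \<in> Q'" for z'
    using that N'(2) assms(3) by auto
  show "\<exists>V F N. F \<in> sols V \<and> open N \<and> z \<in> N \<and> (\<forall>z'\<in>N \<inter> Q'. (H \<circ> \<gamma>) z' \<in> V \<and> (c \<circ> \<gamma>) z' = F ((H \<circ> \<gamma>) z'))"
    by (intro exI[of _ V] exI[of _ F] exI[of _ N']) (simp add: V(1,4,5) N'(1) in_N zN')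
qed

lemma lift_subset: "lift Q H c \<Longrightarrow> Q' \<subseteq> Q \<Longrightarrow> lift Q' H c"
  using lift_compose[of Q H c Q' id] by simp

lemma lift_continuous:
  assumes "lift Q H c" "continuous_on Q H"
  shows "continuous_on Q c"
proof (rule continuous_on_locally)
  fix z assume z: "z \<in> Q"
  obtain V F N where V: "F \<in> sols V" "open N" "z \<in> N" "\<And>z'. z' \<in> N \<Longrightarrow> z' \<in> Q \<Longrightarrow> H z' \<in> V"
    "\<And>z'. z' \<in> N \<Longrightarrow> z' \<in> Q \<Longrightarrow> c z' = F (H z')" using liftD[OF assms(1) z] by metis
  have "H ` (Q \<inter> N) \<subseteq> V" using V(4) by auto
  then have "continuous_on (Q \<inter> N) (F \<circ> H)"
    by (intro continuous_on_compose continuous_on_subset[OF sols_cont[OF V(1)]]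
        continuous_on_subset[OF assms(2)]) auto
  then have "continuous_on (Q \<inter> N) c"
    using V(5) by (subst continuous_on_cong[OF refl, of _ _ "F \<circ> H"]) auto
  then show "\<exists>N. open N \<and> z \<in> N \<and> continuous_on (Q \<inter> N) c" using V(2,3) by blast
qed

text \<open>The set where the lifts agree is relatively open by uniqueness of local solutions; so is
  its complement, because lifts are continuous into a Hausdorff space.\<close>

lemma lift_unique:
  assumes c: "lift Q H c" and d: "lift Q H d" and H: "continuous_on Q H" "H ` Q \<subseteq> S" and Q: "connected Q"
    and z0: "z0 \<in> Q" "c z0 = d z0" and z1: "z1 \<in> Q"
  shows "c z1 = d z1"
proof (rule connected_local_invariant[OF Q z0(1) z1])
  fix z assume z: "z \<in> Q"
  show "eventually (\<lambda>z'. (c z' = d z') \<longleftrightarrow> (c z = d z)) (at z within Q)"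
  proof (cases "c z = d z")
    case True
    obtain V F N where V: "F \<in> sols V" "open N" "z \<in> N" "\<And>z'. z' \<in> N \<Longrightarrow> z' \<in> Q \<Longrightarrow> H z' \<in> V"
      "\<And>z'. z' \<in> N \<Longrightarrow> z' \<in> Q \<Longrightarrow> c z' = F (H z')" using liftD[OF c z] by metis
    obtain W G M where W: "G \<in> sols W" "open M" "z \<in> M" "\<And>z'. z' \<in> M \<Longrightarrow> z' \<in> Q \<Longrightarrow> H z' \<in> W"
      "\<And>z'. z' \<in> M \<Longrightarrow> z' \<in> Q \<Longrightarrow> d z' = G (H z')" using liftD[OF d z] by metis
    obtain W' where W': "openin (top_of_set S) W'" "H z \<in> W'" "\<And>t. t \<in> W' \<Longrightarrow> F t = G t"
      using sols_unique[OF V(1) W(1), of "H z"] V W z True by metis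
    obtain N' where N': "open N'" "\<And>z. z \<in> Q \<Longrightarrow> z \<in> N' \<longleftrightarrow> H z \<in> W'"
      using preimage_open[OF H W'(1)] by metis
    have "open (N \<inter> M \<inter> N')" "z \<in> N \<inter> M \<inter> N'" using V W N' W' z by auto
    then have "eventually (\<lambda>z'. z' \<in> N \<inter> M \<inter> N' \<and> z' \<in> Q) (at z within Q)"
      by (auto simp: eventually_at_topological)
    then show ?thesis
      by eventually_elim (use V W N' W' True in auto)
  next
    case False
    have "(c \<longlongrightarrow> c z) (at z within Q)" "(d \<longlongrightarrow> d z) (at z within Q)"
      using lift_continuous[OF c H(1)] lift_continuous[OF d H(1)] z by (auto simp: continuous_on_def)
    moreover obtain A B where "open A" "open B" "c z \<in> A" "d z \<in> B" "A \<inter> B = {}"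
      using hausdorff[OF False] by blast
    ultimately have "eventually (\<lambda>z'. c z' \<in> A) (at z within Q)" "eventually (\<lambda>z'. d z' \<in> B) (at z within Q)"
      by (auto dest: topological_tendstoD)
    then show ?thesis
      by eventually_elim (use False \<open>A \<inter> B = {}\<close> in auto)
  qed
qed (use z0 in simp)

text \<open>The value may be prescribed at any point of \<open>Q\<close>, so that lifts on adjacent
  pieces can be matched at a point of their overlap.\<close>

definition liftable :: "'b::topological_space set \<Rightarrow> ('b \<Rightarrow> 'a) \<Rightarrow> bool" where
  "liftable Q H \<longleftrightarrow> (\<forall>z\<in>Q. \<forall>g. \<exists>c. lift Q H c \<and> c z = g)"

text \<open>Away from the overlap the other closed piece is cut off. At an overlap point the two
  local solutions have the same value, hence agree nearby, and one of them describes both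
  pieces.\<close>

lemma lift_Un:
  assumes H: "continuous_on (Q1 \<union> Q2) H" "H ` (Q1 \<union> Q2) \<subseteq> S" and cl: "closed Q1" "closed Q2"
    and c1: "lift Q1 H c1" and c2: "lift Q2 H c2" and eq: "\<And>z. z \<in> Q1 \<Longrightarrow> z \<in> Q2 \<Longrightarrow> c1 z = c2 z"
  shows "lift (Q1 \<union> Q2) H (\<lambda>z. if z \<in> Q1 then c1 z else c2 z)" (is "lift _ _ ?c")
  unfolding lift_def
proof
  fix z assume z: "z \<in> Q1 \<union> Q2"
  let ?P = "\<exists>V F N. F \<in> sols V \<and> open N \<and> z \<in> N \<and> (\<forall>z'\<in>N \<inter> (Q1 \<union> Q2). H z' \<in> V \<and> ?c z' = F (H z'))"
  consider "z \<in> Q1 - Q2" | "z \<in> Q2 - Q1" | "z \<in> Q1" "z \<in> Q2" using z by blast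
  then show ?P
  proof cases
    case 1
    then obtain V F N where "F \<in> sols V" "open N" "z \<in> N" "\<And>z'. z' \<in> N \<Longrightarrow> z' \<in> Q1 \<Longrightarrow> H z' \<in> V"
      "\<And>z'. z' \<in> N \<Longrightarrow> z' \<in> Q1 \<Longrightarrow> c1 z' = F (H z')" using liftD[OF c1] by (metis DiffD1)
    then show ?P using 1 cl by (intro exI[of _ V] exI[of _ F] exI[of _ "N - Q2"]) auto
  next
    case 2
    then obtain V F N where "F \<in> sols V" "open N" "z \<in> N" "\<And>z'. z' \<in> N \<Longrightarrow> z' \<in> Q2 \<Longrightarrow> H z' \<in> V"
      "\<And>z'. z' \<in> N \<Longrightarrow> z' \<in> Q2 \<Longrightarrow> c2 z' = F (H z')" using liftD[OF c2] by (metis DiffD1)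
    then show ?P using 2 cl by (intro exI[of _ V] exI[of _ F] exI[of _ "N - Q1"]) auto
  next
    case 3
    obtain V F N where V: "F \<in> sols V" "open N" "z \<in> N" "\<And>z'. z' \<in> N \<Longrightarrow> z' \<in> Q1 \<Longrightarrow> H z' \<in> V"
      "\<And>z'. z' \<in> N \<Longrightarrow> z' \<in> Q1 \<Longrightarrow> c1 z' = F (H z')" using liftD[OF c1 3(1)] by metis
    obtain W G M where W: "G \<in> sols W" "open M" "z \<in> M" "\<And>z'. z' \<in> M \<Longrightarrow> z' \<in> Q2 \<Longrightarrow> H z' \<in> W"
      "\<And>z'. z' \<in> M \<Longrightarrow> z' \<in> Q2 \<Longrightarrow> c2 z' = G (H z')" using liftD[OF c2 3(2)] by metis
    obtain W' where W': "openin (top_of_set S) W'" "H z \<in> W'" "\<And>t. t \<in> W' \<Longrightarrow> F t = G t"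
      using sols_unique[OF V(1) W(1), of "H z"] V W 3 eq by metis
    have VW: "openin (top_of_set S) (V \<inter> W \<inter> W')"
      using V(1) W(1) W'(1) by (auto simp: sols_def openin_Int)
    obtain N' where N': "open N'" "\<And>z. z \<in> Q1 \<union> Q2 \<Longrightarrow> z \<in> N' \<longleftrightarrow> H z \<in> V \<inter> W \<inter> W'"
      using preimage_open[OF H VW] by metis
    have "F \<in> sols (V \<inter> W \<inter> W')" using sols_subset[OF V(1) VW] by auto
    then show ?P
      using V W W' N' z 3 by (intro exI[of _ "V \<inter> W \<inter> W'"] exI[of _ F] exI[of _ "N \<inter> M \<inter> N'"]) auto
  qed
qed

text \<open>Once the lifts agree at the single point \<open>e\<close>, connectedness of the overlap
  makes them agree on all of it.\<close>

lemma liftable_Un: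
  assumes H: "continuous_on (Q1 \<union> Q2) H" "H ` (Q1 \<union> Q2) \<subseteq> S" and cl: "closed Q1" "closed Q2"
    and conn: "connected (Q1 \<inter> Q2)" and e: "e \<in> Q1" "e \<in> Q2"
    and l1: "liftable Q1 H" and l2: "liftable Q2 H"
  shows "liftable (Q1 \<union> Q2) H"
  unfolding liftable_def
proof (intro ballI allI)
  fix z g assume z: "z \<in> Q1 \<union> Q2"
  have "\<exists>c1 c2. lift Q1 H c1 \<and> lift Q2 H c2 \<and> c1 e = c2 e \<and> (z \<in> Q1 \<longrightarrow> c1 z = g) \<and> (z \<notin> Q1 \<longrightarrow> c2 z = g)"
  proof (cases "z \<in> Q1")
    case True
    then obtain c1 where "lift Q1 H c1" "c1 z = g" using l1 unfolding liftable_def by blast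
    moreover obtain c2 where "lift Q2 H c2" "c2 e = c1 e" using l2 e unfolding liftable_def by blast
    ultimately show ?thesis using True by metis
  next
    case False
    then obtain c2 where "lift Q2 H c2" "c2 z = g" using l2 z unfolding liftable_def by blast
    moreover obtain c1 where "lift Q1 H c1" "c1 e = c2 e" using l1 e unfolding liftable_def by blast
    ultimately show ?thesis using False by metis
  qed
  then obtain c1 c2 where c: "lift Q1 H c1" "lift Q2 H c2" "c1 e = c2 e" "z \<in> Q1 \<longrightarrow> c1 z = g" "z \<notin> Q1 \<longrightarrow> c2 z = g"
    by blast
  have eq: "c1 z = c2 z" if "z \<in> Q1" "z \<in> Q2" for z
  proof (rule lift_unique[OF _ _ _ _ conn])
    show "lift (Q1 \<inter> Q2) H c1" "lift (Q1 \<inter> Q2) H c2" using c lift_subset by blast+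
    show "continuous_on (Q1 \<inter> Q2) H" using H(1) by (rule continuous_on_subset) auto
  qed (use H c e that in auto)
  then show "\<exists>c. lift (Q1 \<union> Q2) H c \<and> c z = g"
    using lift_Un[OF H cl c(1,2) eq] c(4,5) by (intro exI[of _ "\<lambda>z. if z \<in> Q1 then c1 z else c2 z"]) auto
qed

end

section \<open>Monodromy on simply connected spaces\<close>

text \<open>Solutions with every initial value over a common \<open>W\<close> make the space of
  solution germs a covering of \<open>S\<close>, which allows continuation along every path.
  Path-connectedness of \<open>W\<close> is used in \<open>global_solution\<close> to continue
  inside \<open>W\<close>.\<close>

locale trivial_local_system = local_system S sol
  for S :: "'a::topological_space set" and sol :: "'a \<Rightarrow> ('a \<Rightarrow> 'g::t2_space) \<Rightarrow> bool" +
  assumes exist: "\<And>s. s \<in> S \<Longrightarrow> \<exists>W. openin (top_of_set S) W \<and> s \<in> W \<and> path_connected W \<and>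
      (\<forall>s'\<in>W. \<forall>g. \<exists>F. (\<forall>t\<in>W. sol t F) \<and> F s' = g)"
begin

lemma exist_sols:
  assumes "s \<in> S"
  obtains W where "openin (top_of_set S) W" "s \<in> W" "path_connected W"
    "\<And>s' g. s' \<in> W \<Longrightarrow> \<exists>F\<in>sols W. F s' = g"
  using exist[OF assms] by (auto simp: sols_def)

text \<open>Two nested bisections by \<open>Bolzano\<close> do the work of a Lebesgue number:
  rectangles sharing an edge are glued by \<open>liftable_Un\<close>, along the second coordinate
  into thin strips and then along the first.\<close>

lemma liftable_square:
  fixes H :: "real \<times> real \<Rightarrow> 'a"
  assumes H: "continuous_on ({0..1} \<times> {0..1}) H" "H ` ({0..1} \<times> {0..1}) \<subseteq> S"
  shows "liftable ({0..1} \<times> {0..1}) H"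
proof -
  have sub: "continuous_on Q H" "H ` Q \<subseteq> S" if "Q \<subseteq> {0..1} \<times> {0..1}" for Q
    using H that by (auto intro: continuous_on_subset)
  have local: "\<exists>\<epsilon>>0. \<forall>Q. Q \<subseteq> {0..1} \<times> {0..1} \<longrightarrow> Q \<subseteq> ball z \<epsilon> \<longrightarrow> liftable Q H" if z: "z \<in> {0..1} \<times> {0..1}" for z
  proof -
    have "H z \<in> S" using H(2) z by blast
    then obtain W where W: "openin (top_of_set S) W" "H z \<in> W" "path_connected W"
      "\<And>s' g. s' \<in> W \<Longrightarrow> \<exists>F\<in>sols W. F s' = g" using exist_sols by metis
    obtain N where N: "open N" "\<And>z. z \<in> {0..1} \<times> {0..1} \<Longrightarrow> z \<in> N \<longleftrightarrow> H z \<in> W"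
      using preimage_open[OF H W(1)] by metis
    then obtain \<epsilon> where \<epsilon>: "\<epsilon> > 0" "ball z \<epsilon> \<subseteq> N" using W(2) z by (metis openE)
    show ?thesis
    proof (intro exI[of _ \<epsilon>] conjI allI impI \<epsilon>(1))
      fix Q assume Q: "Q \<subseteq> {0..1} \<times> {0..1}" "Q \<subseteq> ball z \<epsilon>"
      then have HW: "H z' \<in> W" if "z' \<in> Q" for z' using N(2)[of z'] \<epsilon> that by blast
      show "liftable Q H" unfolding liftable_def
      proof (intro ballI allI)
        fix z' g assume "z' \<in> Q"
        then obtain F where F: "F \<in> sols W" "F (H z') = g" using W(4) HW by blast
        have "lift Q H (F \<circ> H)" by (rule lift_solution[OF F(1)]) (use sub[OF Q(1)] HW in auto)
        then show "\<exists>c. lift Q H c \<and> c z' = g" using F by auto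
      qed
    qed
  qed
  \<comment> \<open>The width \<delta> may depend on \<open>c\<close> and \<open>d\<close>, and
    gluing takes the minimum of two widths. All thin strips around \<open>x\<close> are covered
    because \<open>Bolzano\<close> asks for all small intervals containing a point.\<close>
  let ?strip = "\<lambda>x c d. \<exists>\<delta>>0. \<forall>a b. 0 \<le> a \<longrightarrow> b \<le> 1 \<longrightarrow> a \<le> x \<longrightarrow> x \<le> b \<longrightarrow> b - a < \<delta> \<longrightarrow> liftable ({a..b} \<times> {c..d}) H"
  have strip: "?strip x 0 1" if x: "x \<in> {0..1}" for x
  proof -
    define P where "P c d \<longleftrightarrow> (0 \<le> c \<longrightarrow> d \<le> 1 \<longrightarrow> ?strip x c d)" for c d
    have "P 0 1"
    proof (rule Bolzano)
      fix c d e assume cde: "P c d" "P d e" "c \<le> d" "d \<le> e"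
      show "P c e" unfolding P_def
      proof (intro impI)
        assume ce: "0 \<le> c" "e \<le> 1"
        have s: "?strip x c d" "?strip x d e"
          using cde ce unfolding P_def by (simp_all only: order_trans[OF ce(1) cde(3)] order_trans[OF cde(4) ce(2)] simp_thms)
        obtain \<delta>1 \<delta>2 where \<delta>: "\<delta>1 > 0" "\<delta>2 > 0"
          and 1: "\<And>a b. 0 \<le> a \<Longrightarrow> b \<le> 1 \<Longrightarrow> a \<le> x \<Longrightarrow> x \<le> b \<Longrightarrow> b - a < \<delta>1 \<Longrightarrow> liftable ({a..b} \<times> {c..d}) H"
          and 2: "\<And>a b. 0 \<le> a \<Longrightarrow> b \<le> 1 \<Longrightarrow> a \<le> x \<Longrightarrow> x \<le> b \<Longrightarrow> b - a < \<delta>2 \<Longrightarrow> liftable ({a..b} \<times> {d..e}) H"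
          using s by blast
        show "?strip x c e"
        proof (intro exI[of _ "min \<delta>1 \<delta>2"] conjI allI impI)
          fix a b assume ab: "0 \<le> a" "b \<le> 1" "a \<le> x" "x \<le> b" "b - a < min \<delta>1 \<delta>2"
          have un: "{a..b} \<times> {c..e} = {a..b} \<times> {c..d} \<union> {a..b} \<times> {d..e}"
            using cde by auto
          have int: "({a..b} \<times> {c..d}) \<inter> ({a..b} \<times> {d..e}) = {a..b} \<times> {d}"
            using cde by auto
          have "{a..b} \<times> {c..d} \<union> {a..b} \<times> {d..e} \<subseteq> {0..1} \<times> {0..1}"
            using ab ce cde by auto
          then show "liftable ({a..b} \<times> {c..e}) H" unfolding un
            by (intro liftable_Un[where e="(x, d)"] sub 1 2)
              (use ab cde in \<open>auto simp: int intro!: closed_Times connected_Times\<close>)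
        qed (use \<delta> in auto)
      qed
    next
      fix y :: real assume y: "0 \<le> y" "y \<le> 1"
      then obtain \<epsilon> where \<epsilon>: "\<epsilon> > 0" "\<And>Q. Q \<subseteq> {0..1} \<times> {0..1} \<Longrightarrow> Q \<subseteq> ball (x, y) \<epsilon> \<Longrightarrow> liftable Q H"
        using local[of "(x, y)"] x by auto
      show "\<exists>d>0. \<forall>a b. a \<le> y \<and> y \<le> b \<and> b - a < d \<longrightarrow> P a b"
      proof (intro exI[of _ "\<epsilon> / 2"] conjI allI impI)
        fix c d assume cd: "c \<le> y \<and> y \<le> d \<and> d - c < \<epsilon> / 2"
        show "P c d" unfolding P_def
        proof (intro impI exI[of _ "\<epsilon> / 2"] conjI allI)
          fix a b assume *: "0 \<le> c" "d \<le> 1" "0 \<le> a" "b \<le> 1" "a \<le> x" "x \<le> b" "b - a < \<epsilon> / 2"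
          show "liftable ({a..b} \<times> {c..d}) H"
          proof (rule \<epsilon>(2))
            show "{a..b} \<times> {c..d} \<subseteq> ball (x, y) \<epsilon>"
            proof clarify
              fix u v assume uv: "u \<in> {a..b}" "v \<in> {c..d}"
              have "dist (x, y) (u, v) \<le> dist x u + dist y v"
                by (simp add: dist_Pair_Pair sqrt_sum_squares_le_sum)
              also have "\<dots> < \<epsilon>" using uv * cd by (auto simp: dist_real_def)
              finally show "(u, v) \<in> ball (x, y) \<epsilon>" by simp
            qed
          qed (use * in auto)
        qed (use \<epsilon> in auto)
      qed (use \<epsilon> in auto)
    qed simp
    then show ?thesis by (simp add: P_def)
  qed
  define P where "P a b \<longleftrightarrow> (0 \<le> a \<longrightarrow> b \<le> 1 \<longrightarrow> liftable ({a..b} \<times> {0..1}) H)" for a b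
  have "P 0 1"
  proof (rule Bolzano)
    fix a b c assume abc: "P a b" "P b c" "a \<le> b" "b \<le> c"
    show "P a c" unfolding P_def
    proof (intro impI)
      assume ac: "0 \<le> a" "c \<le> 1"
      have un: "{a..c} \<times> {0..1::real} = {a..b} \<times> {0..1} \<union> {b..c} \<times> {0..1}"
        using abc by auto
      have int: "({a..b} \<times> {0..1::real}) \<inter> ({b..c} \<times> {0..1}) = {b} \<times> {0..1}"
        using abc by auto
      have "{a..b} \<times> {0..1} \<union> {b..c} \<times> {0..1} \<subseteq> {0..1} \<times> {0..1::real}"
        using abc ac by auto
      then show "liftable ({a..c} \<times> {0..1}) H" unfolding un
        by (intro liftable_Un[where e="(b, 0)"] sub)
          (use abc ac in \<open>auto simp: int P_def intro!: closed_Times connected_Times\<close>)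
    qed
  next
    fix x :: real assume "0 \<le> x" "x \<le> 1"
    then have "?strip x 0 1" using strip by simp
    then show "\<exists>d>0. \<forall>a b. a \<le> x \<and> x \<le> b \<and> b - a < d \<longrightarrow> P a b"
      unfolding P_def by blast
  qed simp
  then show ?thesis by (simp add: P_def)
qed

text \<open>The path is lifted as a square that is constant in its second coordinate, and the lift
  is read off on the edge where that coordinate is 0.\<close>

lemma path_lift:
  assumes "path \<gamma>" "path_image \<gamma> \<subseteq> S"
  obtains c where "lift {0..1} \<gamma> c" "c 0 = g"
proof -
  have \<gamma>: "continuous_on {0..1} \<gamma>" "\<gamma> ` {0..1} \<subseteq> S" using assms by (auto simp: path_def path_image_def)
  have "continuous_on ({0..1} \<times> {0..1::real}) (\<gamma> \<circ> fst)"
    by (intro continuous_on_compose continuous_intros) (simp add: \<gamma>)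
  then have "liftable ({0..1} \<times> {0..1::real}) (\<gamma> \<circ> fst)"
    by (rule liftable_square) (use \<gamma> in auto)
  then obtain c where c: "lift ({0..1} \<times> {0..1::real}) (\<gamma> \<circ> fst) c" "c (0, 0) = g"
    unfolding liftable_def by force
  have "lift {0..1} ((\<gamma> \<circ> fst) \<circ> (\<lambda>t. (t, 0::real))) (c \<circ> (\<lambda>t. (t, 0::real)))"
    by (rule lift_compose[OF c(1)]) (auto intro!: continuous_intros)
  then show ?thesis using that[of "c \<circ> (\<lambda>t. (t, 0::real))"] c by (simp add: comp_def)
qed

text \<open>A free homotopy from the loop to a constant loop is lifted. On the final edge the lift
  is constant, and the two sides of the square follow the same track of base points, so equality of
  the end values travels back from the final edge to the loop.\<close>

lemma loop_lift_closed:
  assumes S: "simply_connected S" and \<gamma>: "path \<gamma>" "path_image \<gamma> \<subseteq> S" "pathfinish \<gamma> = pathstart \<gamma>"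
    and c: "lift {0..1} \<gamma> c"
  shows "c 1 = c 0"
proof -
  define a where "a = \<gamma> 0"
  have "a \<in> S" using \<gamma>(2) by (auto simp: a_def path_image_def)
  then have "homotopic_loops S \<gamma> (\<lambda>_. a)"
    using simply_connected_const_loop[OF S \<gamma>] by simp
  then obtain h where h: "continuous_on ({0..1} \<times> {0..1}) h" "h \<in> ({0..1} \<times> {0..1}) \<rightarrow> S"
     "\<And>x. x \<in> {0..1} \<Longrightarrow> h (0, x) = \<gamma> x" "\<And>x. x \<in> {0..1} \<Longrightarrow> h (1, x) = a"
     "\<And>t. t \<in> {0..1::real} \<Longrightarrow> h (t, 1) = h (t, 0::real)"
    unfolding homotopic_loops by (auto simp: pathstart_def pathfinish_def)
  have hS: "h ` ({0..1} \<times> {0..1}) \<subseteq> S" using h(2) by auto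
  obtain d where d: "lift ({0..1} \<times> {0..1}) h d" "d (0, 0) = c 0"
    using liftable_square[OF h(1) hS] unfolding liftable_def by force
  have edge: "lift {0..1} (h \<circ> e) (d \<circ> e)" "continuous_on {0..1} (h \<circ> e)" "(h \<circ> e) ` {0..1} \<subseteq> S"
    if "continuous_on {0..1} e" "e ` {0..1} \<subseteq> {0..1} \<times> {0..1}" for e :: "real \<Rightarrow> real \<times> real"
  proof -
    show "lift {0..1} (h \<circ> e) (d \<circ> e)" by (rule lift_compose[OF d(1) that])
    show "continuous_on {0..1} (h \<circ> e)"
      by (rule continuous_on_compose[OF that(1) continuous_on_subset[OF h(1) that(2)]])
    show "(h \<circ> e) ` {0..1} \<subseteq> S" using hS that(2) by (auto simp: image_subset_iff)
  qed
  have right: "d (1, 1) = d (1, 0)"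
  proof -
    let ?e = "\<lambda>x. (1, x) :: real \<times> real"
    have e: "lift {0..1} (h \<circ> ?e) (d \<circ> ?e)" "continuous_on {0..1} (h \<circ> ?e)" "(h \<circ> ?e) ` {0..1} \<subseteq> S"
      by (rule edge; force intro!: continuous_intros)+
    \<comment> \<open>Over the edge where the homotopy is constant, a constant function is a lift
      too, so by uniqueness \<open>d\<close> is constant there.\<close>
    let ?k = "\<lambda>x::real. (1, 0) :: real \<times> real"
    have k: "lift {0..1} (h \<circ> ?k) (d \<circ> ?k)"
      by (rule edge(1)) (auto intro!: continuous_intros)
    have "lift {0..1} (h \<circ> ?e) (d \<circ> ?k)"
      by (rule lift_cong[OF k]) (use h(4) in auto)
    from lift_unique[OF e(1) this e(2,3), of 0 1] show ?thesis by simp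
  qed
  have top: "d (0, 1) = d (0, 0)"
  proof -
    let ?e0 = "\<lambda>x. (x, 0) :: real \<times> real" and ?e1 = "\<lambda>x. (x, 1) :: real \<times> real"
    have e0: "lift {0..1} (h \<circ> ?e0) (d \<circ> ?e0)" "continuous_on {0..1} (h \<circ> ?e0)" "(h \<circ> ?e0) ` {0..1} \<subseteq> S"
      by (rule edge; force intro!: continuous_intros)+
    have e1: "lift {0..1} (h \<circ> ?e1) (d \<circ> ?e1)"
      by (rule edge(1); force intro!: continuous_intros)
    \<comment> \<open>By \<open>h(5)\<close> both sides of the square lift the same path, and by
      \<open>right\<close> they agree at its end.\<close>
    have "lift {0..1} (h \<circ> ?e0) (d \<circ> ?e1)"
      by (rule lift_cong[OF e1]) (use h(5) in auto)
    from lift_unique[OF e0(1) this e0(2,3), of 1 0] show ?thesis using right by simp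
  qed
  let ?e = "\<lambda>x. (0, x) :: real \<times> real"
  have e: "lift {0..1} (h \<circ> ?e) (d \<circ> ?e)" by (rule edge(1)) (force intro!: continuous_intros)+
  have "lift {0..1} \<gamma> (d \<circ> ?e)"
    by (rule lift_cong[OF e]) (use h(3) in auto)
  from lift_unique[OF c this, of 0 1] show ?thesis
    using \<gamma> top d(2) by (auto simp: path_def path_image_def)
qed

text \<open>Simple connectedness is expressed by free homotopies of loops; the track of a homotopy
  between two constant loops is a path joining the two points.\<close>

lemma path_to:
  assumes "simply_connected S" "a \<in> S" "b \<in> S"
  obtains \<gamma> where "path \<gamma>" "path_image \<gamma> \<subseteq> S" "\<gamma> 0 = a" "\<gamma> 1 = b"
proof -
  have "homotopic_loops S (\<lambda>_. a) (\<lambda>_. b)"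
    using assms by (intro simply_connected_const_loop)
      (auto simp: path_def path_image_def pathstart_def pathfinish_def)
  then obtain h where h: "continuous_on ({0..1} \<times> {0..1}) h" "h \<in> ({0..1::real} \<times> {0..1::real}) \<rightarrow> S"
     "\<And>x. x \<in> {0..1} \<Longrightarrow> h (0, x) = a" "\<And>x. x \<in> {0..1} \<Longrightarrow> h (1, x) = b"
    unfolding homotopic_loops by auto
  show ?thesis
  proof (rule that[of "h \<circ> (\<lambda>t. (t, 0::real))"])
    show "path (h \<circ> (\<lambda>t. (t, 0::real)))" unfolding path_def
      by (intro continuous_on_compose continuous_intros continuous_on_subset[OF h(1)]) auto
  qed (use h in \<open>auto simp: path_image_def\<close>)
qed

theorem global_solution:
  assumes S: "simply_connected S" and s0: "s0 \<in> S"
  shows "\<exists>F. F s0 = g \<and> (\<forall>s\<in>S. sol s F)"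
proof -
  \<comment> \<open>\<open>v\<close> is a value at \<open>s\<close> reached by continuing
    \<open>g\<close> along some path; the point is that \<open>R\<close> is the graph of a
    function.\<close>
  define R where "R s v \<longleftrightarrow> (\<exists>\<gamma> c. path \<gamma> \<and> path_image \<gamma> \<subseteq> S \<and> \<gamma> 0 = s0 \<and> \<gamma> 1 = s \<and> lift {0..1} \<gamma> c \<and> c 0 = g \<and> c 1 = v)" for s v
  have half: "continuous_on {0..1} \<gamma>" "\<gamma> ` {0..1} \<subseteq> S" if "path \<gamma>" "path_image \<gamma> \<subseteq> S" for \<gamma> :: "real \<Rightarrow> 'a"
    using that by (auto simp: path_def path_image_def)
  have uniq: "v = w" if "R s v" "R s w" for s v w
  proof -
    obtain \<gamma>1 c1 where 1: "path \<gamma>1" "path_image \<gamma>1 \<subseteq> S" "\<gamma>1 0 = s0" "\<gamma>1 1 = s" "lift {0..1} \<gamma>1 c1" "c1 0 = g" "c1 1 = v"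
      using \<open>R s v\<close> unfolding R_def by blast
    obtain \<gamma>2 c2 where 2: "path \<gamma>2" "path_image \<gamma>2 \<subseteq> S" "\<gamma>2 0 = s0" "\<gamma>2 1 = s" "lift {0..1} \<gamma>2 c2" "c2 0 = g" "c2 1 = w"
      using \<open>R s w\<close> unfolding R_def by blast
    \<comment> \<open>The two continuations are the halves of the lift along this loop, run through
      from its two ends, which carry the same value \<open>g\<close>; they meet at parameter
      1/2.\<close>
    define \<gamma> where "\<gamma> = \<gamma>1 +++ reversepath \<gamma>2"
    have \<gamma>: "path \<gamma>" "path_image \<gamma> \<subseteq> S" "pathfinish \<gamma> = pathstart \<gamma>"
    proof -
      have ends: "pathfinish \<gamma>1 = pathfinish \<gamma>2" "pathstart \<gamma>1 = pathstart \<gamma>2"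
        using 1 2 by (simp_all add: pathstart_def pathfinish_def)
      show "path \<gamma>" using 1(1) 2(1) ends by (simp add: \<gamma>_def)
      show "path_image \<gamma> \<subseteq> S" using 1(2) 2(2) by (simp add: \<gamma>_def subset_path_image_join)
      show "pathfinish \<gamma> = pathstart \<gamma>" using ends by (simp add: \<gamma>_def)
    qed
    obtain c where c: "lift {0..1} \<gamma> c" "c 0 = g" using path_lift[OF \<gamma>(1,2)] by metis
    have c1: "c 1 = g" using loop_lift_closed[OF S \<gamma> c(1)] c(2) by simp
    have "lift {0..1} (\<gamma> \<circ> (\<lambda>t. t / 2)) (c \<circ> (\<lambda>t. t / 2))"
      by (rule lift_compose[OF c(1)]) (auto intro!: continuous_intros)
    then have "lift {0..1} \<gamma>1 (c \<circ> (\<lambda>t. t / 2))"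
      by (rule lift_cong) (auto simp: \<gamma>_def joinpaths_def)
    from lift_unique[OF 1(5) this half[OF 1(1,2)], of 0 1] have "v = c (1/2)"
      using 1 c by simp
    moreover have "lift {0..1} (\<gamma> \<circ> (\<lambda>t. 1 - t / 2)) (c \<circ> (\<lambda>t. 1 - t / 2))"
      by (rule lift_compose[OF c(1)]) (auto intro!: continuous_intros)
    then have "lift {0..1} \<gamma>2 (c \<circ> (\<lambda>t. 1 - t / 2))"
      by (rule lift_cong) (use 1 2 in \<open>auto simp: \<gamma>_def joinpaths_def reversepath_def\<close>)
    from lift_unique[OF 2(5) this half[OF 2(1,2)], of 0 1] have "w = c (1/2)"
      using 2 c1 by simp
    ultimately show ?thesis by simp
  qed
  have ex: "\<exists>v. R s v" if s: "s \<in> S" for s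
  proof -
    obtain \<gamma> where \<gamma>: "path \<gamma>" "path_image \<gamma> \<subseteq> S" "\<gamma> 0 = s0" "\<gamma> 1 = s" using path_to[OF S s0 s] by metis
    obtain c where "lift {0..1} \<gamma> c" "c 0 = g" using path_lift[OF \<gamma>(1,2)] by metis
    then show ?thesis using \<gamma> unfolding R_def by blast
  qed
  define F where "F s = (THE v. R s v)" for s
  have F_eq: "F s = v" if "R s v" for s v
    unfolding F_def using uniq that by blast
  have RF: "R s (F s)" if "s \<in> S" for s using ex[OF that] F_eq by metis
  have "F s0 = g"
  proof (rule F_eq)
    obtain c where c: "lift {0..1} (\<lambda>_::real. s0) c" "c 0 = g"
      using path_lift[of "\<lambda>_. s0"] s0 by (auto simp: path_def path_image_def)
    have "lift {0..1} ((\<lambda>_::real. s0) \<circ> (\<lambda>_::real. 0::real)) (c \<circ> (\<lambda>_. 0))"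
      by (rule lift_compose[OF c(1)]) auto
    then show "R s0 g" unfolding R_def using s0 c(2)
      by (intro exI[of _ "\<lambda>_. s0"] exI[of _ "c \<circ> (\<lambda>_. 0)"]) (auto simp: path_def path_image_def comp_def)
  qed
  moreover have "sol s F" if s: "s \<in> S" for s
  proof -
    obtain W where W: "openin (top_of_set S) W" "s \<in> W" "path_connected W"
      "\<And>s' g. s' \<in> W \<Longrightarrow> \<exists>F\<in>sols W. F s' = g" using exist_sols[OF s] by metis
    \<comment> \<open>To see that \<open>F\<close> is a solution near \<open>s\<close>, a path to
      \<open>s\<close> is prolonged inside \<open>W\<close>; there the continuation is the local
      solution \<open>G\<close> by uniqueness.\<close>
    then obtain G where G: "G \<in> sols W" "G s = F s" by blast
    have WS: "W \<subseteq> S" using W(1) openin_imp_subset by blast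
    have "G t = F t" if t: "t \<in> W" for t
    proof (rule F_eq[symmetric])
      obtain \<gamma> c1 where 1: "path \<gamma>" "path_image \<gamma> \<subseteq> S" "\<gamma> 0 = s0" "\<gamma> 1 = s" "lift {0..1} \<gamma> c1" "c1 0 = g" "c1 1 = F s"
        using RF[OF s] unfolding R_def by blast
      obtain \<delta> where 2: "path \<delta>" "path_image \<delta> \<subseteq> W" "\<delta> 0 = s" "\<delta> 1 = t"
        using W(3) W(2) t unfolding path_connected_def pathstart_def pathfinish_def by blast
      have dS: "path_image \<delta> \<subseteq> S" using 2 WS by blast
      define \<eta> where "\<eta> = \<gamma> +++ \<delta>"
      have \<eta>: "path \<eta>" "path_image \<eta> \<subseteq> S"
      proof -
        have "pathfinish \<gamma> = pathstart \<delta>" using 1 2 by (simp add: pathstart_def pathfinish_def)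
        then show "path \<eta>" using 1(1) 2(1) by (simp add: \<eta>_def)
        show "path_image \<eta> \<subseteq> S" using 1(2) dS by (simp add: \<eta>_def subset_path_image_join)
      qed
      obtain c where c: "lift {0..1} \<eta> c" "c 0 = g" using path_lift[OF \<eta>] by metis
      have "lift {0..1} (\<eta> \<circ> (\<lambda>t. t / 2)) (c \<circ> (\<lambda>t. t / 2))"
        by (rule lift_compose[OF c(1)]) (auto intro!: continuous_intros)
      then have "lift {0..1} \<gamma> (c \<circ> (\<lambda>t. t / 2))"
        by (rule lift_cong) (auto simp: \<eta>_def joinpaths_def)
      from lift_unique[OF 1(5) this half[OF 1(1,2)], of 0 1] have mid: "F s = c (1/2)"
        using 1 c by simp
      have "lift {0..1} (\<eta> \<circ> (\<lambda>t. 1/2 + t / 2)) (c \<circ> (\<lambda>t. 1/2 + t / 2))"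
        by (rule lift_compose[OF c(1)]) (auto intro!: continuous_intros)
      then have A: "lift {0..1} \<delta> (c \<circ> (\<lambda>t. 1/2 + t / 2))"
        by (rule lift_cong) (use 1 2 in \<open>auto simp: \<eta>_def joinpaths_def algebra_simps\<close>)
      have B: "lift {0..1} \<delta> (G \<circ> \<delta>)"
        by (rule lift_solution[OF G(1)]) (use 2 half[OF 2(1) dS] in \<open>auto simp: path_image_def\<close>)
      from lift_unique[OF A B half[OF 2(1) dS], of 0 1] have "c 1 = G t"
        using 2 G mid by simp
      then show "R t (G t)"
        unfolding R_def using \<eta> c 1 2
        by (intro exI[of _ \<eta>] exI[of _ c]) (auto simp: \<eta>_def joinpaths_def)
    qed
    then show ?thesis
      using germ[OF W(1,2), of G F] G W(2) by (auto simp: sols_def)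
  qed
  ultimately show ?thesis by blast
qed

end

section \<open>Maps into the unit quaternions\<close>

text \<open>On unit quaternions this is the inverse; being linear, in contrast to
  \<open>quat_inv\<close>, it passes through derivatives.\<close>

definition qcnj :: "quat \<Rightarrow> quat" where
  "qcnj p = (fst p, - snd p)"

abbreviation quat_one :: quat where
  "quat_one \<equiv> (1, 0)"

lemma bounded_bilinear_quat_mult: "bounded_bilinear (\<odot>)"
  unfolding bilinear_conv_bounded_bilinear[symmetric] bilinear_def
  by (auto intro!: linearI simp: quat_mult_def prod_eq_iff cross_add_left cross_add_right cross_mult_left
      cross_mult_right inner_add_left inner_add_right algebra_simps)

lemma bounded_linear_qcnj: "bounded_linear qcnj"
  unfolding linear_conv_bounded_linear[symmetric]
  by (auto intro!: linearI simp: qcnj_def)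

lemma bounded_linear_im_quat: "bounded_linear im_quat"
  unfolding linear_conv_bounded_linear[symmetric]
  by (auto intro!: linearI simp: im_quat_def)

lemmas quat_bilinear =
  bounded_bilinear.add_left[OF bounded_bilinear_quat_mult]
  bounded_bilinear.add_right[OF bounded_bilinear_quat_mult]
  bounded_bilinear.diff_left[OF bounded_bilinear_quat_mult]
  bounded_bilinear.diff_right[OF bounded_bilinear_quat_mult]
  bounded_bilinear.minus_left[OF bounded_bilinear_quat_mult]
  bounded_bilinear.minus_right[OF bounded_bilinear_quat_mult]
  bounded_bilinear.scaleR_left[OF bounded_bilinear_quat_mult]
  bounded_bilinear.scaleR_right[OF bounded_bilinear_quat_mult]
  bounded_bilinear.zero_left[OF bounded_bilinear_quat_mult]
  bounded_bilinear.zero_right[OF bounded_bilinear_quat_mult]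

lemma quat_mult_assoc: "p \<odot> q \<odot> r = p \<odot> (q \<odot> r)"
  by (simp add: quat_mult_def prod_eq_iff cross3_simps vec_eq_iff forall_3)

lemma quat_mult_one [simp]: "quat_one \<odot> p = p" "p \<odot> quat_one = p"
  by (simp_all add: quat_mult_def)

lemma norm_quat_sq: "(norm (p::quat))\<^sup>2 = (fst p)\<^sup>2 + snd p \<bullet> snd p"
  by (cases p) (simp add: norm_Pair power2_norm_eq_inner)

lemma qcnj_mult_self: "qcnj p \<odot> p = (norm p)\<^sup>2 *\<^sub>R quat_one" "p \<odot> qcnj p = (norm p)\<^sup>2 *\<^sub>R quat_one"
  unfolding norm_quat_sq by (simp_all add: quat_mult_def qcnj_def power2_eq_square)

lemma norm_qcnj [simp]: "norm (qcnj p) = norm p"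
  by (cases p) (simp add: qcnj_def norm_Pair)

lemma norm_quat_mult: "norm (p \<odot> q) = norm p * norm q"
proof -
  have "(norm (p \<odot> q))\<^sup>2 = (norm p * norm q)\<^sup>2"
    unfolding power_mult_distrib norm_quat_sq
    by (simp add: quat_mult_def power2_eq_square inner_add_left inner_add_right dot_cross_self
        dot_cross inner_commute algebra_simps)
  then show ?thesis by (simp add: power2_eq_iff_nonneg)
qed

lemma quat_cancel_left:
  assumes "norm p = 1"
  shows "qcnj p \<odot> (p \<odot> q) = q" "p \<odot> (qcnj p \<odot> q) = q"
  using assms by (simp_all flip: quat_mult_assoc add: qcnj_mult_self)

lemma quat_inv_unit: "norm p = 1 \<Longrightarrow> quat_inv p = qcnj p"
  by (simp add: quat_inv_def qcnj_def)

text \<open>Left multiplication by a unit quaternion preserves norms, hence inner products by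
  polarisation.\<close>

lemma inner_quat_mult_left: "norm p = 1 \<Longrightarrow> (p \<odot> q) \<bullet> (p \<odot> r) = q \<bullet> r"
proof -
  assume "norm p = 1"
  then have n: "norm (p \<odot> x) = norm x" for x by (simp add: norm_quat_mult)
  show ?thesis
    using n[of "q + r"] n[of q] n[of r] unfolding quat_bilinear
    by (simp add: dot_norm)
qed

lemma im_quat_mult: "im_quat a \<odot> im_quat b = (- (a \<bullet> b), cross3 a b)"
  by (simp add: im_quat_def quat_mult_def)

lemma fst_qcnj_mult: "fst (qcnj p \<odot> q) = p \<bullet> q"
  by (simp add: qcnj_def quat_mult_def inner_prod_def)

lemma inner_im_quat [simp]: "im_quat a \<bullet> im_quat b = a \<bullet> b"
  by (simp add: im_quat_def inner_prod_def)

lemma snd_im_quat [simp]: "snd (im_quat a) = a" "fst (im_quat a) = 0"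
  by (simp_all add: im_quat_def)

section \<open>Maurer-Cartan forms of maps into the 3-sphere\<close>

text \<open>The Maurer-Cartan form \<open>F\<inverse> dF\<close>; its value is the full quaternion only for \<open>F\<close> of constant norm 1.\<close>

definition mc :: "(complex \<Rightarrow> quat) \<Rightarrow> complex \<Rightarrow> complex \<Rightarrow> real^3" where
  "mc F w h = snd (qcnj (F w) \<odot> (Re h *\<^sub>R dx F w + Im h *\<^sub>R dy F w))"

lemma mc_add: "mc F w (h + k) = mc F w h + mc F w k"
  and mc_scaleR: "mc F w (c *\<^sub>R h) = c *\<^sub>R mc F w h"
  by (simp_all add: mc_def quat_bilinear algebra_simps)

lemma mc_eq: "mc F w h = Re h *\<^sub>R mc F w 1 + Im h *\<^sub>R mc F w \<i>"
  by (simp add: mc_def quat_bilinear)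

text \<open>A rotated form is again of the shape \<open>form\<close>, so the theory of flat
  equations applies to it.\<close>

lemma form_mc: "form (\<lambda>w. mc F w c) (\<lambda>w. mc F w (c * \<i>)) w h = mc F w (c * h)"
proof -
  have "c * h = Re h *\<^sub>R c + Im h *\<^sub>R (c * \<i>)" by (simp add: complex_eq_iff)
  then show ?thesis by (simp only: form_def mc_add mc_scaleR)
qed

lemma mc_eqI:
  assumes "norm (F w) = 1" "\<And>h. Re h *\<^sub>R dx F w + Im h *\<^sub>R dy F w = F w \<odot> im_quat (a h)"
  shows "mc F w h = a h"
  using assms by (simp add: mc_def quat_cancel_left)

lemma C_k_on_mc:
  assumes "open V" "C_k_on (Suc k) V F"
  shows "C_k_on k V (\<lambda>w. mc F w c)"
proof -
  have "C_k_on k V (\<lambda>w. qcnj (F w) \<odot> (Re c *\<^sub>R dx F w + Im c *\<^sub>R dy F w))"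
    using assms C_k_on_lower[OF assms(2)]
    by (intro C_k_on_bilinear[OF bounded_bilinear_quat_mult] C_k_on_linear[OF bounded_linear_qcnj]
        C_k_on_add C_k_on_scaleR) auto
  then show ?thesis
    unfolding mc_def by (rule C_k_on_linear[OF bounded_linear_snd assms(1)])
qed

text \<open>Since the norm of \<open>F\<close> is constant, dF is orthogonal to \<open>F\<close>;
  that inner product is the real part of \<open>qcnj F\<close> times dF, which is therefore
  imaginary.\<close>

lemma quat_derivative_mc:
  assumes "open V" "C_k_on 1 V F" "\<forall>w\<in>V. norm (F w) = 1" "w \<in> V"
  shows "Re h *\<^sub>R dx F w + Im h *\<^sub>R dy F w = F w \<odot> im_quat (mc F w h)"
proof -
  have D: "(F has_derivative (\<lambda>h. Re h *\<^sub>R dx F w + Im h *\<^sub>R dy F w)) (at w)" (is "(_ has_derivative ?D) _")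
    using C_k_on_has_derivative[of 0] assms by simp
  have "((\<lambda>w. F w \<bullet> F w) has_derivative (\<lambda>h. F w \<bullet> ?D h + ?D h \<bullet> F w)) (at w)"
    by (rule has_derivative_inner[OF D D])
  moreover have "((\<lambda>w. F w \<bullet> F w) has_derivative (\<lambda>h. 0)) (at w)"
    by (rule has_derivative_transform_within_open[OF has_derivative_const assms(1,4)])
      (simp add: assms(3) dot_square_norm)
  ultimately have "(\<lambda>h. F w \<bullet> ?D h + ?D h \<bullet> F w) = (\<lambda>h. 0)"
    by (rule has_derivative_unique)
  then have "F w \<bullet> ?D h + ?D h \<bullet> F w = 0" by (rule fun_cong)
  then have "F w \<bullet> ?D h = 0" by (simp only: inner_commute[of "?D h" "F w"] double_zero)
  then have "qcnj (F w) \<odot> ?D h = im_quat (mc F w h)"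
    by (intro prod_eqI) (simp_all only: fst_qcnj_mult mc_def snd_im_quat)
  then have "F w \<odot> (qcnj (F w) \<odot> ?D h) = F w \<odot> im_quat (mc F w h)" by (rule arg_cong)
  moreover have "norm (F w) = 1" using assms(3,4) by blast
  ultimately show ?thesis by (simp only: quat_cancel_left(2))
qed

lemma quat_dx_dy_mc:
  assumes "open V" "C_k_on 1 V F" "\<forall>w\<in>V. norm (F w) = 1" "w \<in> V"
  shows "dx F w = F w \<odot> im_quat (mc F w 1)" "dy F w = F w \<odot> im_quat (mc F w \<i>)"
  using quat_derivative_mc[OF assms, of 1] quat_derivative_mc[OF assms, of \<i>] by simp_all

lemma mc_compose:
  assumes "open V" "w \<in> V" "\<And>v. v \<in> V \<Longrightarrow> G v = F (\<tau> v)"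
    and "F differentiable (at (\<tau> w))" "(\<tau> has_field_derivative t) (at w)"
  shows "mc G w h = mc F (\<tau> w) (t * h)"
proof -
  have F: "(F has_derivative (\<lambda>h. Re h *\<^sub>R dx F (\<tau> w) + Im h *\<^sub>R dy F (\<tau> w))) (at (\<tau> w))"
    by (rule has_derivative_dx_dy[OF assms(4)])
  have "((\<lambda>v. F (\<tau> v)) has_derivative (\<lambda>h. Re (t * h) *\<^sub>R dx F (\<tau> w) + Im (t * h) *\<^sub>R dy F (\<tau> w))) (at w)"
    using has_derivative_compose[where f=\<tau> and g=F, OF _ F] assms(5) unfolding has_field_derivative_def by blast
  then have "(G has_derivative (\<lambda>h. Re (t * h) *\<^sub>R dx F (\<tau> w) + Im (t * h) *\<^sub>R dy F (\<tau> w))) (at w)"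
    by (rule has_derivative_transform_within_open[OF _ assms(1,2)]) (simp add: assms(3))
  then have G: "dx G w = Re t *\<^sub>R dx F (\<tau> w) + Im t *\<^sub>R dy F (\<tau> w)"
    "dy G w = - Im t *\<^sub>R dx F (\<tau> w) + Re t *\<^sub>R dy F (\<tau> w)"
    by (simp_all add: dx_eq dy_eq)
  show ?thesis
    unfolding mc_def G assms(3)[OF assms(2)] by (simp add: algebra_simps)
qed

lemma has_derivative_mc:
  assumes "open V" "C_k_on 2 V F" "w \<in> V"
  shows "((\<lambda>w. mc F w c) has_derivative
    (\<lambda>h. Re h *\<^sub>R (Re c *\<^sub>R dx (\<lambda>w. mc F w 1) w + Im c *\<^sub>R dx (\<lambda>w. mc F w \<i>) w)
       + Im h *\<^sub>R (Re c *\<^sub>R dy (\<lambda>w. mc F w 1) w + Im c *\<^sub>R dy (\<lambda>w. mc F w \<i>) w))) (at w)"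
proof -
  have C: "C_k_on (Suc (Suc 0)) V F" using assms(2) by (simp add: numeral_2_eq_2)
  note D = C_k_on_has_derivative[OF C_k_on_mc[OF assms(1) C] assms(1,3)]
  have "((\<lambda>w. Re c *\<^sub>R mc F w 1 + Im c *\<^sub>R mc F w \<i>) has_derivative
    (\<lambda>h. Re c *\<^sub>R (Re h *\<^sub>R dx (\<lambda>w. mc F w 1) w + Im h *\<^sub>R dy (\<lambda>w. mc F w 1) w)
       + Im c *\<^sub>R (Re h *\<^sub>R dx (\<lambda>w. mc F w \<i>) w + Im h *\<^sub>R dy (\<lambda>w. mc F w \<i>) w))) (at w)"
    by (intro has_derivative_add has_derivative_scaleR_right D)
  then show ?thesis
    unfolding mc_eq[of F _ c] by (simp add: algebra_simps)
qed

lemma dx_mc: "open V \<Longrightarrow> C_k_on 2 V F \<Longrightarrow> w \<in> V \<Longrightarrow>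
    dx (\<lambda>w. mc F w c) w = Re c *\<^sub>R dx (\<lambda>w. mc F w 1) w + Im c *\<^sub>R dx (\<lambda>w. mc F w \<i>) w"
  and dy_mc: "open V \<Longrightarrow> C_k_on 2 V F \<Longrightarrow> w \<in> V \<Longrightarrow>
    dy (\<lambda>w. mc F w c) w = Re c *\<^sub>R dy (\<lambda>w. mc F w 1) w + Im c *\<^sub>R dy (\<lambda>w. mc F w \<i>) w"
  using has_derivative_mc[of V F w c] by (simp_all add: dx_eq dy_eq)

text \<open>Up to sign, the coefficient of the exterior derivative of the form.\<close>

definition curl_mc :: "(complex \<Rightarrow> quat) \<Rightarrow> complex \<Rightarrow> real^3" where
  "curl_mc F w = dy (\<lambda>w. mc F w 1) w - dx (\<lambda>w. mc F w \<i>) w"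

text \<open>The tension field of \<open>F\<close>, translated to the identity.\<close>

definition div_mc :: "(complex \<Rightarrow> quat) \<Rightarrow> complex \<Rightarrow> real^3" where
  "div_mc F w = dx (\<lambda>w. mc F w 1) w + dy (\<lambda>w. mc F w \<i>) w"

definition cross_mc :: "(complex \<Rightarrow> quat) \<Rightarrow> complex \<Rightarrow> real^3" where
  "cross_mc F w = cross3 (mc F w 1) (mc F w \<i>)"

text \<open>A product of imaginary quaternions has minus the inner product as real part and the
  cross product as imaginary part; so both the harmonic map equation and the structure equation can
  be read off from these formulas.\<close>

lemma second_derivatives_mc:
  assumes V: "open V" "C_k_on 2 V F" and n: "\<forall>w\<in>V. norm (F w) = 1" and w: "w \<in> V"
  shows "dx (dx F) w = F w \<odot> (im_quat (mc F w 1) \<odot> im_quat (mc F w 1) + im_quat (dx (\<lambda>w. mc F w 1) w))"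
    and "dy (dx F) w = F w \<odot> (im_quat (mc F w \<i>) \<odot> im_quat (mc F w 1) + im_quat (dy (\<lambda>w. mc F w 1) w))"
    and "dx (dy F) w = F w \<odot> (im_quat (mc F w 1) \<odot> im_quat (mc F w \<i>) + im_quat (dx (\<lambda>w. mc F w \<i>) w))"
    and "dy (dy F) w = F w \<odot> (im_quat (mc F w \<i>) \<odot> im_quat (mc F w \<i>) + im_quat (dy (\<lambda>w. mc F w \<i>) w))"
proof -
  have C: "C_k_on (Suc (Suc 0)) V F" "C_k_on 1 V F"
    using V C_k_on_lower[of 1 V F] by (simp_all add: numeral_2_eq_2)
  note 1 = quat_dx_dy_mc[OF V(1) C(2) n]
  have D: "((\<lambda>w. F w \<odot> im_quat (mc F w c)) has_derivative
      (\<lambda>h. F w \<odot> im_quat (Re h *\<^sub>R dx (\<lambda>w. mc F w c) w + Im h *\<^sub>R dy (\<lambda>w. mc F w c) w)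
         + (Re h *\<^sub>R dx F w + Im h *\<^sub>R dy F w) \<odot> im_quat (mc F w c))) (at w)" for c
    by (intro bounded_bilinear.FDERIV[OF bounded_bilinear_quat_mult]
        bounded_linear.has_derivative[OF bounded_linear_im_quat]
        C_k_on_has_derivative[OF C(1) V(1) w] C_k_on_has_derivative[OF C_k_on_mc[OF V(1) C(1)] V(1) w])
  have "dx (dx F) w = dx (\<lambda>w. F w \<odot> im_quat (mc F w 1)) w" "dy (dx F) w = dy (\<lambda>w. F w \<odot> im_quat (mc F w 1)) w"
    "dx (dy F) w = dx (\<lambda>w. F w \<odot> im_quat (mc F w \<i>)) w" "dy (dy F) w = dy (\<lambda>w. F w \<odot> im_quat (mc F w \<i>)) w"
    by (auto intro: dx_cong_open[OF V(1) w] dy_cong_open[OF V(1) w] simp: 1)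
  then show "dx (dx F) w = F w \<odot> (im_quat (mc F w 1) \<odot> im_quat (mc F w 1) + im_quat (dx (\<lambda>w. mc F w 1) w))"
    "dy (dx F) w = F w \<odot> (im_quat (mc F w \<i>) \<odot> im_quat (mc F w 1) + im_quat (dy (\<lambda>w. mc F w 1) w))"
    "dx (dy F) w = F w \<odot> (im_quat (mc F w 1) \<odot> im_quat (mc F w \<i>) + im_quat (dx (\<lambda>w. mc F w \<i>) w))"
    "dy (dy F) w = F w \<odot> (im_quat (mc F w \<i>) \<odot> im_quat (mc F w \<i>) + im_quat (dy (\<lambda>w. mc F w \<i>) w))"
    using D[of 1] D[of \<i>] by (simp_all add: dx_eq dy_eq 1[OF w] quat_mult_assoc quat_bilinear add.commute)
qed

text \<open>The two mixed derivatives contain the same imaginary quaternions multiplied in opposite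
  orders; the imaginary parts of these products differ in sign, whence the factor 2.\<close>

lemma curl_mc_eq:
  assumes V: "open V" "C_k_on 2 V F" and n: "\<forall>w\<in>V. norm (F w) = 1" and w: "w \<in> V"
  shows "curl_mc F w = 2 *\<^sub>R cross_mc F w"
proof -
  have "dx (dy F) w = dy (dx F) w" by (rule dx_dy_commute[OF V(2,1) w])
  then have "qcnj (F w) \<odot> dx (dy F) w = qcnj (F w) \<odot> dy (dx F) w" by simp
  then have "snd (im_quat (mc F w 1) \<odot> im_quat (mc F w \<i>) + im_quat (dx (\<lambda>w. mc F w \<i>) w))
    = snd (im_quat (mc F w \<i>) \<odot> im_quat (mc F w 1) + im_quat (dy (\<lambda>w. mc F w 1) w))"
    unfolding second_derivatives_mc[OF V n w] quat_cancel_left(1)[OF bspec[OF n w]] by simp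
  then have "cross_mc F w + dx (\<lambda>w. mc F w \<i>) w = - cross_mc F w + dy (\<lambda>w. mc F w 1) w"
    by (simp add: im_quat_mult cross_mc_def cross_skew[of "mc F w \<i>"])
  then show ?thesis by (simp add: curl_mc_def scaleR_2 algebra_simps)
qed

text \<open>Rotation by \<open>c\<close> mixes curl and divergence. The cases of interest are k = 0
  for harmonic maps and k = 2 / sqrt 3 for the first factor of an almost complex surface.\<close>

lemma curl_rotated_mc:
  assumes V: "open V" "C_k_on 2 V F" and n: "\<forall>w\<in>V. norm (F w) = 1" and w: "w \<in> V"
    and d: "div_mc F w = k *\<^sub>R cross_mc F w"
  shows "dy (\<lambda>w. mc F w c) w - dx (\<lambda>w. mc F w (c * \<i>)) w = (2 * Re c + k * Im c) *\<^sub>R cross_mc F w"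
    and "dx (\<lambda>w. mc F w c) w + dy (\<lambda>w. mc F w (c * \<i>)) w = (k * Re c - 2 * Im c) *\<^sub>R cross_mc F w"
proof -
  have "dy (\<lambda>w. mc F w c) w - dx (\<lambda>w. mc F w (c * \<i>)) w = Re c *\<^sub>R curl_mc F w + Im c *\<^sub>R div_mc F w"
    "dx (\<lambda>w. mc F w c) w + dy (\<lambda>w. mc F w (c * \<i>)) w = Re c *\<^sub>R div_mc F w - Im c *\<^sub>R curl_mc F w"
    unfolding dx_mc[OF V w, of c] dy_mc[OF V w, of c] dx_mc[OF V w, of "c * \<i>"] dy_mc[OF V w, of "c * \<i>"]
    by (simp_all add: curl_mc_def div_mc_def algebra_simps)
  then show "dy (\<lambda>w. mc F w c) w - dx (\<lambda>w. mc F w (c * \<i>)) w = (2 * Re c + k * Im c) *\<^sub>R cross_mc F w"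
    "dx (\<lambda>w. mc F w c) w + dy (\<lambda>w. mc F w (c * \<i>)) w = (k * Re c - 2 * Im c) *\<^sub>R cross_mc F w"
    by (simp_all add: curl_mc_eq[OF V n w] d algebra_simps)
qed

text \<open>The factor is the determinant of multiplication by \<open>c\<close> on the
  plane.\<close>

lemma cross_rotated_mc: "cross3 (mc F w c) (mc F w (c * \<i>)) = (norm c)\<^sup>2 *\<^sub>R cross_mc F w"
  unfolding mc_eq[of F w c] mc_eq[of F w "c * \<i>"] cmod_power2 cross_mc_def
  by (simp add: cross_add_left cross_add_right cross_mult_left cross_mult_right
      Cross3.left_diff_distrib Cross3.right_diff_distrib
      cross_skew[of "mc F w \<i>"] power2_eq_square algebra_simps)

section \<open>The two bilinear actions and their flatness conditions\<close>

definition quat_action :: "quat \<Rightarrow> real^3 \<Rightarrow> quat" where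
  "quat_action p v = p \<odot> im_quat v"

text \<open>Translations of \<open>\<real>\<^sup>3\<close>, embedded as the affine hyperplane of first coordinate 1.\<close>

definition affine_action :: "quat \<Rightarrow> real^3 \<Rightarrow> quat" where
  "affine_action p v = (0, fst p *\<^sub>R v)"

lemma bounded_bilinear_quat_action: "bounded_bilinear quat_action"
  unfolding quat_action_def
  by (rule bounded_bilinear.comp[OF bounded_bilinear_quat_mult bounded_linear_ident bounded_linear_im_quat])

lemma bounded_bilinear_affine_action: "bounded_bilinear affine_action"
  unfolding bilinear_conv_bounded_bilinear[symmetric] bilinear_def
  by (auto intro!: linearI simp: affine_action_def algebra_simps)

text \<open>The quadratic terms of flatness form the commutator of \<alpha> and \<beta>, in which
  the real parts cancel and twice the cross product remains.\<close>

lemma flat_quat_action: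
  assumes "dy \<alpha> w - dx \<beta> w = 2 *\<^sub>R cross3 (\<alpha> w) (\<beta> w)"
  shows "flat quat_action \<alpha> \<beta> w"
proof -
  have "dy \<alpha> w = dx \<beta> w + 2 *\<^sub>R cross3 (\<alpha> w) (\<beta> w)" using assms by (simp add: algebra_simps)
  then have "im_quat (dy \<alpha> w) + im_quat (\<beta> w) \<odot> im_quat (\<alpha> w) = im_quat (dx \<beta> w) + im_quat (\<alpha> w) \<odot> im_quat (\<beta> w)"
    by (simp add: im_quat_mult prod_eq_iff inner_commute cross_skew[of "\<beta> w"] scaleR_2)
  then show ?thesis
    by (simp add: flat_def quat_action_def quat_mult_assoc flip: quat_bilinear(2))
qed

text \<open>Applying \<open>affine_action\<close> twice gives 0, as its values have first coordinate
  0: translations commute and only closedness is left.\<close>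

lemma flat_affine_action: "dy \<alpha> w = dx \<beta> w \<Longrightarrow> flat affine_action \<alpha> \<beta> w"
  by (simp add: flat_def affine_action_def)

section \<open>Integration on Riemann surfaces\<close>

abbreviation rep :: "('a \<Rightarrow> 'b) \<Rightarrow> 'a set \<Rightarrow> ('a \<Rightarrow> complex) \<Rightarrow> complex \<Rightarrow> 'b" where
  "rep f U \<phi> \<equiv> f \<circ> inv_into U \<phi>"

locale riemann =
  fixes S :: "'a::t2_space set" and A :: "'a charts"
  assumes RS: "riemann_surface S A"
begin

lemma chart:
  assumes "(U, \<phi>) \<in> A"
  shows chart_openin: "openin (top_of_set S) U" and chart_open: "open (\<phi> ` U)"
    and chart_homeomorphism: "homeomorphism U (\<phi> ` U) \<phi> (inv_into U \<phi>)"
    and chart_inv: "s \<in> U \<Longrightarrow> inv_into U \<phi> (\<phi> s) = s"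
    and chart_inv_in: "w \<in> \<phi> ` U \<Longrightarrow> inv_into U \<phi> w \<in> U"
    and chart_inv2: "w \<in> \<phi> ` U \<Longrightarrow> \<phi> (inv_into U \<phi> w) = w"
    and chart_cont: "continuous_on U \<phi>" and chart_inv_cont: "continuous_on (\<phi> ` U) (inv_into U \<phi>)"
    and chart_subset: "U \<subseteq> S"
proof -
  show *: "openin (top_of_set S) U" "open (\<phi> ` U)" "homeomorphism U (\<phi> ` U) \<phi> (inv_into U \<phi>)"
    using RS assms unfolding riemann_surface_def by fast+
  then show "s \<in> U \<Longrightarrow> inv_into U \<phi> (\<phi> s) = s" "continuous_on U \<phi>" "continuous_on (\<phi> ` U) (inv_into U \<phi>)"
    by (auto simp: homeomorphism_def)
  show "U \<subseteq> S" using *(1) openin_imp_subset by blast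
qed (auto simp: inv_into_into f_inv_into_f)

lemma transition_holomorphic:
  "(U, \<phi>) \<in> A \<Longrightarrow> (W, \<eta>) \<in> A \<Longrightarrow> (\<eta> \<circ> inv_into U \<phi>) holomorphic_on \<phi> ` (U \<inter> W)"
  using RS unfolding riemann_surface_def by fast

lemma ex_chart:
  assumes "s \<in> S"
  obtains U \<phi> where "(U, \<phi>) \<in> A" "s \<in> U"
proof -
  have "(\<Union>(U, \<phi>)\<in>A. U) = S" using RS unfolding riemann_surface_def by fast
  then show ?thesis using assms that by auto
qed

lemma open_chart_image:
  assumes "(U, \<phi>) \<in> A" "openin (top_of_set S) W"
  shows "open (\<phi> ` (U \<inter> W))"
proof -
  have "openin (top_of_set U) (U \<inter> W)"
    using assms(2) chart_subset[OF assms(1)] by (auto simp: openin_open)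
  then have "openin (top_of_set (\<phi> ` U)) (\<phi> ` (U \<inter> W))"
    using homeomorphism_imp_open_map[OF chart_homeomorphism[OF assms(1)]] by blast
  then show ?thesis using chart_open[OF assms(1)] openin_open_trans by blast
qed

lemma openin_chart_preimage:
  assumes "(U, \<phi>) \<in> A" "open B"
  shows "openin (top_of_set S) (U \<inter> \<phi> -` B)"
  using continuous_openin_preimage_gen[OF chart_cont[OF assms(1)] assms(2)]
    chart_openin[OF assms(1)] openin_trans by blast

section \<open>Global solutions on a simply connected surface\<close>

text \<open>Forms on the surface are not introduced by themselves: every form in use is h |-> mc f
  (c h) for a smooth map \<open>f\<close>, which supplies the coefficients in each chart. The
  equation is demanded in all charts around \<open>s\<close>; \<open>gsol_chart_independent\<close>
  reduces this to one chart.\<close>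

definition gsol :: "('g::real_normed_vector \<Rightarrow> real^3 \<Rightarrow> 'g) \<Rightarrow> complex \<Rightarrow> ('a \<Rightarrow> quat) \<Rightarrow> 'a \<Rightarrow> ('a \<Rightarrow> 'g) \<Rightarrow> bool" where
  "gsol B c f s F \<longleftrightarrow> (\<forall>(U, \<phi>)\<in>A. s \<in> U \<longrightarrow>
     solves B (\<lambda>w. mc (rep f U \<phi>) w c) (\<lambda>w. mc (rep f U \<phi>) w (c * \<i>)) (rep F U \<phi>) (\<phi> s))"

lemma gsolD:
  assumes "gsol B c f s F" "(U, \<phi>) \<in> A" "s \<in> U"
  shows "((rep F U \<phi>) has_derivative (\<lambda>h. B (F s) (mc (rep f U \<phi>) (\<phi> s) (c * h)))) (at (\<phi> s))"
  using assms chart_inv[OF assms(2,3)] by (auto simp: gsol_def solves_def form_mc)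

lemma C_k_on_chart: "smooth_map A f \<Longrightarrow> (U, \<phi>) \<in> A \<Longrightarrow> C_k_on k (\<phi> ` U) (rep f U \<phi>)"
  unfolding smooth_map_def by fast

lemma gsol_chart_independent:
  assumes f: "smooth_map A f" and U: "(U, \<phi>) \<in> A" "s \<in> U"
    and F: "((rep F U \<phi>) has_derivative (\<lambda>h. B (F s) (mc (rep f U \<phi>) (\<phi> s) (c * h)))) (at (\<phi> s))"
  shows "gsol B c f s F"
  unfolding gsol_def
proof clarify
  fix W \<eta> assume W: "(W, \<eta>) \<in> A" "s \<in> W"
  define \<tau> where "\<tau> = \<phi> \<circ> inv_into W \<eta>"
  define D where "D = \<eta> ` (W \<inter> U)"
  have D: "open D" "\<eta> s \<in> D"
    using open_chart_image[OF W(1) chart_openin[OF U(1)]] W U by (auto simp: D_def)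
  have "\<tau> holomorphic_on D"
    using transition_holomorphic[OF W(1) U(1)] by (simp add: \<tau>_def D_def)
  then obtain t where t: "(\<tau> has_field_derivative t) (at (\<eta> s))"
    using D by (auto simp: holomorphic_on_open field_differentiable_def)
  have \<tau>s: "\<tau> (\<eta> s) = \<phi> s" using chart_inv[OF W] by (simp add: \<tau>_def)
  have inD: "inv_into W \<eta> v = inv_into U \<phi> (\<tau> v)" if "v \<in> D" for v
    using that chart_inv[OF W(1)] chart_inv[OF U(1)] by (auto simp: D_def \<tau>_def)
  have "rep f U \<phi> differentiable (at (\<tau> (\<eta> s)))"
    unfolding \<tau>s by (rule C_k_on_differentiable[OF C_k_on_chart[OF f U(1)] chart_open[OF U(1)]]) (use U in auto)
  \<comment> \<open>Multiplication by \<open>c\<close> commutes with multiplication by the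
    derivative \<open>t\<close> of the transition. This is where holomorphy of the transition
    enters.\<close>
  then have mc: "mc (rep f W \<eta>) (\<eta> s) (c * h) = mc (rep f U \<phi>) (\<phi> s) (c * (t * h))" for h
    using mc_compose[OF D, of "rep f W \<eta>" "rep f U \<phi>" \<tau> t "c * h"] t inD
    by (simp add: \<tau>s mult_ac)
  have "((\<lambda>v. (rep F U \<phi>) (\<tau> v)) has_derivative
      (\<lambda>h. B (F s) (mc (rep f U \<phi>) (\<phi> s) (c * (t * h))))) (at (\<eta> s))"
    by (rule has_derivative_compose[where f=\<tau>, OF t[unfolded has_field_derivative_def]]) (use F in \<open>simp add: \<tau>s comp_def\<close>)
  then have "((rep F W \<eta>) has_derivative (\<lambda>h. B (F s) (mc (rep f U \<phi>) (\<phi> s) (c * (t * h))))) (at (\<eta> s))"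
    by (rule has_derivative_transform_within_open[OF _ D]) (simp add: inD)
  then show "solves B (\<lambda>w. mc (rep f W \<eta>) w c) (\<lambda>w. mc (rep f W \<eta>) w (c * \<i>)) (rep F W \<eta>) (\<eta> s)"
    using chart_inv[OF W] by (simp add: solves_def form_mc mc)
qed

lemma gsol_iff_charts:
  "(\<forall>s\<in>S. gsol B c f s F) \<longleftrightarrow> (\<forall>(U, \<phi>)\<in>A. \<forall>w\<in>\<phi> ` U.
     ((rep F U \<phi>) has_derivative (\<lambda>h. B (F (inv_into U \<phi> w)) (mc (rep f U \<phi>) w (c * h)))) (at w))"
    (is "?l = ?r")
proof
  assume l: ?l
  show ?r
  proof clarify
    fix U \<phi> s assume U: "(U, \<phi>) \<in> A" "s \<in> U"
    then have "gsol B c f s F" using l chart_subset by blast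
    from gsolD[OF this U] show "((rep F U \<phi>) has_derivative (\<lambda>h. B (F (inv_into U \<phi> (\<phi> s)))
        (mc (rep f U \<phi>) (\<phi> s) (c * h)))) (at (\<phi> s))"
      by (simp add: chart_inv[OF U])
  qed
next
  assume r: ?r
  show ?l unfolding gsol_def
  proof clarify
    fix s U \<phi> assume U: "(U, \<phi>) \<in> A" "s \<in> U"
    then have "((rep F U \<phi>) has_derivative (\<lambda>h. B (F (inv_into U \<phi> (\<phi> s)))
        (mc (rep f U \<phi>) (\<phi> s) (c * h)))) (at (\<phi> s))"
      using r by fast
    then show "solves B (\<lambda>w. mc (rep f U \<phi>) w c) (\<lambda>w. mc (rep f U \<phi>) w (c * \<i>)) (rep F U \<phi>) (\<phi> s)"
      by (simp add: solves_def form_mc)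
  qed
qed

lemma local_system_gsol:
  fixes B :: "'g::real_normed_vector \<Rightarrow> real^3 \<Rightarrow> 'g"
  assumes B: "bounded_bilinear B" and f: "smooth_map A f"
  shows "local_system S (gsol B c f)"
proof
  fix W s and F G :: "'a \<Rightarrow> 'g"
  assume W: "openin (top_of_set S) W" "s \<in> W" and eq: "\<And>t. t \<in> W \<Longrightarrow> F t = G t" and F: "gsol B c f s F"
  obtain U \<phi> where U: "(U, \<phi>) \<in> A" "s \<in> U"
    using ex_chart W openin_imp_subset by (metis subsetD)
  show "gsol B c f s G"
  proof (rule gsol_chart_independent[OF f U])
    have "((rep F U \<phi>) has_derivative (\<lambda>h. B (G s) (mc (rep f U \<phi>) (\<phi> s) (c * h)))) (at (\<phi> s))"
      using gsolD[OF F U] eq[OF W(2)] by simp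
    then show "((rep G U \<phi>) has_derivative (\<lambda>h. B (G s) (mc (rep f U \<phi>) (\<phi> s) (c * h)))) (at (\<phi> s))"
      by (rule has_derivative_transform_within_open[OF _ open_chart_image[OF U(1) W(1)]])
        (use U W eq chart_inv[OF U(1)] in auto)
  qed
next
  fix W and F :: "'a \<Rightarrow> 'g"
  assume W: "openin (top_of_set S) W" and F: "\<And>s. s \<in> W \<Longrightarrow> gsol B c f s F"
  show "continuous_on W F"
  proof (rule continuous_on_locally)
    fix s assume s: "s \<in> W"
    obtain U \<phi> where U: "(U, \<phi>) \<in> A" "s \<in> U"
      using ex_chart W s openin_imp_subset by (metis subsetD)
    obtain T where T: "open T" "U = S \<inter> T" using chart_openin[OF U(1)] by (auto simp: openin_open)
    have WS: "W \<subseteq> S" using W openin_imp_subset by blast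
    have "continuous_on (\<phi> ` (U \<inter> W)) (rep F U \<phi>)"
    proof (rule continuous_at_imp_continuous_on, clarify)
      fix t assume "t \<in> U" "t \<in> W"
      then show "isCont (rep F U \<phi>) (\<phi> t)"
        using gsolD[OF F U(1)] has_derivative_continuous by blast
    qed
    then have "continuous_on (U \<inter> W) ((rep F U \<phi>) \<circ> \<phi>)"
      by (rule continuous_on_compose[OF continuous_on_subset[OF chart_cont[OF U(1)]], rotated]) auto
    then have "continuous_on (U \<inter> W) F"
      by (subst continuous_on_cong[OF refl, of _ _ "(rep F U \<phi>) \<circ> \<phi>"]) (use chart_inv[OF U(1)] in auto)
    moreover have "U \<inter> W = W \<inter> T" using T WS by auto
    ultimately show "\<exists>N. open N \<and> s \<in> N \<and> continuous_on (W \<inter> N) F" using T U by auto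
  qed
next
  fix W s and F G :: "'a \<Rightarrow> 'g"
  assume W: "openin (top_of_set S) W" "s \<in> W" and F: "\<And>t. t \<in> W \<Longrightarrow> gsol B c f t F"
    and G: "\<And>t. t \<in> W \<Longrightarrow> gsol B c f t G" and eq: "F s = G s"
  obtain U \<phi> where U: "(U, \<phi>) \<in> A" "s \<in> U"
    using ex_chart W openin_imp_subset by (metis subsetD)
  let ?f = "rep f U \<phi>"
  let ?V = "\<phi> ` (U \<inter> W)"
  have sub: "?V \<subseteq> \<phi> ` U" by auto
  have cont: "continuous_on ?V (\<lambda>w. mc ?f w c)" for c
  proof (rule continuous_on_subset[OF _ sub])
    have "C_k_on 0 (\<phi> ` U) (\<lambda>w. mc ?f w c)"
      by (rule C_k_on_mc[OF chart_open[OF U(1)] C_k_on_chart[OF f U(1)]])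
    then show "continuous_on (\<phi> ` U) (\<lambda>w. mc ?f w c)" by simp
  qed
  have "\<exists>r>0. ball (\<phi> s) r \<subseteq> ?V \<and> (\<forall>w\<in>ball (\<phi> s) r. (rep F U \<phi>) w = (rep G U \<phi>) w)"
  proof (rule solves_unique_locally[OF B open_chart_image[OF U(1) W(1)] _ cont cont])
    fix w assume "w \<in> ?V"
    then obtain t where t: "w = \<phi> t" "t \<in> U" "t \<in> W" by auto
    show "solves B (\<lambda>w. mc ?f w c) (\<lambda>w. mc ?f w (c * \<i>)) (rep F U \<phi>) w"
      "solves B (\<lambda>w. mc ?f w c) (\<lambda>w. mc ?f w (c * \<i>)) (rep G U \<phi>) w"
      using F[OF t(3)] G[OF t(3)] U(1) t unfolding gsol_def by fast+
  qed (use U W eq chart_inv[OF U] in auto)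
  then obtain r where r: "r > 0" "ball (\<phi> s) r \<subseteq> ?V"
    "\<And>w. w \<in> ball (\<phi> s) r \<Longrightarrow> F (inv_into U \<phi> w) = G (inv_into U \<phi> w)" by auto
  show "\<exists>W'. openin (top_of_set S) W' \<and> s \<in> W' \<and> (\<forall>t\<in>W'. F t = G t)"
  proof (intro exI[of _ "U \<inter> \<phi> -` ball (\<phi> s) r"] conjI ballI)
    show "openin (top_of_set S) (U \<inter> \<phi> -` ball (\<phi> s) r)"
      by (rule openin_chart_preimage[OF U(1) open_ball])
    fix t assume "t \<in> U \<inter> \<phi> -` ball (\<phi> s) r"
    then show "F t = G t" using r(3)[of "\<phi> t"] chart_inv[OF U(1), of t] by auto
  qed (use U r in auto)
qed

text \<open>A disc of the plane, transported by a chart, is the common domain of local solutions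
  with every initial value.\<close>

lemma trivial_local_system_gsol:
  fixes B :: "'g::banach \<Rightarrow> real^3 \<Rightarrow> 'g"
  assumes B: "bounded_bilinear B" and f: "smooth_map A f"
    and flat: "\<And>U \<phi> w. (U, \<phi>) \<in> A \<Longrightarrow> w \<in> \<phi> ` U \<Longrightarrow>
      flat B (\<lambda>w. mc (rep f U \<phi>) w c) (\<lambda>w. mc (rep f U \<phi>) w (c * \<i>)) w"
  shows "trivial_local_system S (gsol B c f)"
proof (intro trivial_local_system.intro trivial_local_system_axioms.intro local_system_gsol[OF B f])
  fix s assume "s \<in> S"
  then obtain U \<phi> where U: "(U, \<phi>) \<in> A" "s \<in> U" using ex_chart by metis
  let ?f = "rep f U \<phi>"
  have C: "C_k_on 2 (\<phi> ` U) (\<lambda>w. mc ?f w c)" for c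
    by (rule C_k_on_mc[OF chart_open[OF U(1)] C_k_on_chart[OF f U(1)]])
  obtain r where r: "r > 0" "ball (\<phi> s) r \<subseteq> \<phi> ` U"
    and ex: "\<And>w1 g. w1 \<in> ball (\<phi> s) r \<Longrightarrow> \<exists>F. F w1 = g \<and>
      (\<forall>w\<in>ball (\<phi> s) r. solves B (\<lambda>w. mc ?f w c) (\<lambda>w. mc ?f w (c * \<i>)) F w)"
    using solves_exists_locally[OF B chart_open[OF U(1)] _ C C flat[OF U(1)], of "\<phi> s"] U by auto
  define W where "W = U \<inter> \<phi> -` ball (\<phi> s) r"
  have W: "openin (top_of_set S) W" unfolding W_def by (rule openin_chart_preimage[OF U(1) open_ball])
  have "W = inv_into U \<phi> ` ball (\<phi> s) r"
  proof (intro set_eqI iffI)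
    fix t assume t: "t \<in> W"
    then show "t \<in> inv_into U \<phi> ` ball (\<phi> s) r"
      using chart_inv[OF U(1), of t] by (auto simp: W_def intro!: image_eqI[of _ _ "\<phi> t"])
  next
    fix t assume "t \<in> inv_into U \<phi> ` ball (\<phi> s) r"
    then show "t \<in> W" using r(2) chart_inv_in[OF U(1)] chart_inv2[OF U(1)] by (force simp: W_def)
  qed
  then have "path_connected W"
    using r(2) by (auto intro!: path_connected_continuous_image continuous_on_subset[OF chart_inv_cont[OF U(1)]]
        convex_imp_path_connected)
  moreover have "\<exists>F. (\<forall>t\<in>W. gsol B c f t F) \<and> F s' = g" if s': "s' \<in> W" for s' g
  proof -
    obtain F where F: "F (\<phi> s') = g"
      "\<And>w. w \<in> ball (\<phi> s) r \<Longrightarrow> solves B (\<lambda>w. mc ?f w c) (\<lambda>w. mc ?f w (c * \<i>)) F w"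
      using ex[of "\<phi> s'" g] s' by (auto simp: W_def)
    have "gsol B c f t (F \<circ> \<phi>)" if t: "t \<in> W" for t
    proof (rule gsol_chart_independent[OF f U(1)])
      show tU: "t \<in> U" using t by (simp add: W_def)
      have "(F has_derivative (\<lambda>h. B (F (\<phi> t)) (mc ?f (\<phi> t) (c * h)))) (at (\<phi> t))"
        using F(2)[of "\<phi> t"] t by (simp add: W_def solves_def form_mc)
      then have "((F \<circ> \<phi> \<circ> inv_into U \<phi>) has_derivative (\<lambda>h. B (F (\<phi> t)) (mc ?f (\<phi> t) (c * h)))) (at (\<phi> t))"
        by (rule has_derivative_transform_within_open[OF _ chart_open[OF U(1)]])
          (use tU chart_inv2[OF U(1)] in auto)
      then show "((F \<circ> \<phi> \<circ> inv_into U \<phi>) has_derivative (\<lambda>h. B ((F \<circ> \<phi>) t) (mc ?f (\<phi> t) (c * h)))) (at (\<phi> t))"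
        by simp
    qed
    then show ?thesis using F(1) by (intro exI[of _ "F \<circ> \<phi>"]) auto
  qed
  ultimately show "\<exists>W. openin (top_of_set S) W \<and> s \<in> W \<and> path_connected W \<and>
      (\<forall>s'\<in>W. \<forall>g. \<exists>F. (\<forall>t\<in>W. gsol B c f t F) \<and> F s' = g)"
    using W U r by (intro exI[of _ W]) (auto simp: W_def)
qed

text \<open>Both solutions are lifts of the identity map of the connected set
  \<open>S\<close>.\<close>

lemma gsol_unique:
  fixes B :: "'g::real_normed_vector \<Rightarrow> real^3 \<Rightarrow> 'g"
  assumes B: "bounded_bilinear B" and f: "smooth_map A f"
    and F: "\<And>s. s \<in> S \<Longrightarrow> gsol B c f s F" and G: "\<And>s. s \<in> S \<Longrightarrow> gsol B c f s G"
    and "s0 \<in> S" "F s0 = G s0" "s \<in> S"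
  shows "F s = G s"
proof -
  interpret local_system S "gsol B c f" by (rule local_system_gsol[OF B f])
  have sols: "F \<in> sols S" "G \<in> sols S"
    by (auto simp: sols_def F G)
  have "lift S id (F \<circ> id)" by (rule lift_solution[OF sols(1)]) auto
  moreover have "lift S id (G \<circ> id)" by (rule lift_solution[OF sols(2)]) auto
  moreover have "connected S" using RS by (simp add: riemann_surface_def)
  ultimately show ?thesis
    using lift_unique[of S id "F \<circ> id" "G \<circ> id" s0 s] assms(5-7) by simp
qed

text \<open>Bootstrapping: the derivatives of \<open>F\<close> are bilinear in \<open>F\<close> and
  smooth coefficients, so class C^k improves to C^(k+1).\<close>

lemma gsol_smooth:
  assumes B: "bounded_bilinear B" and f: "smooth_map A f" and F: "\<And>s. s \<in> S \<Longrightarrow> gsol B c f s F"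
  shows "smooth_map A F"
  unfolding smooth_map_def
proof clarify
  fix U \<phi> k assume U: "(U, \<phi>) \<in> A"
  let ?f = "rep f U \<phi>" and ?F = "rep F U \<phi>"
  have D: "(?F has_derivative (\<lambda>h. B (?F w) (mc ?f w (c * h)))) (at w)" if "w \<in> \<phi> ` U" for w
    using gsol_iff_charts[of B c f F] F U that by auto
  interpret bounded_bilinear B by fact
  have lin: "B p (mc ?f w (c * h)) = Re h *\<^sub>R B p (mc ?f w c) + Im h *\<^sub>R B p (mc ?f w (c * \<i>))" for p w h
    unfolding form_mc[of ?f c w h, symmetric] by (simp only: form_def add_right scaleR_right)
  show "C_k_on k (\<phi> ` U) ?F"
  proof (induction k)
    case 0
    have "continuous_on (\<phi> ` U) ?F"
      by (rule continuous_at_imp_continuous_on, rule ballI, rule has_derivative_continuous, rule D)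
    then show ?case by simp
  next
    case (Suc k)
    show ?case
    proof (rule C_k_on_SucI[OF chart_open[OF U]])
      show "(?F has_derivative (\<lambda>h. Re h *\<^sub>R B (?F w) (mc ?f w c) + Im h *\<^sub>R B (?F w) (mc ?f w (c * \<i>)))) (at w)"
        if "w \<in> \<phi> ` U" for w
        by (rule has_derivative_eq_rhs[OF D[OF that]]) (rule ext, rule lin)
      show "C_k_on k (\<phi> ` U) (\<lambda>w. B (?F w) (mc ?f w c))" "C_k_on k (\<phi> ` U) (\<lambda>w. B (?F w) (mc ?f w (c * \<i>)))"
        by (rule C_k_on_bilinear[OF B chart_open[OF U] Suc C_k_on_mc[OF chart_open[OF U] C_k_on_chart[OF f U]]])+
    qed
  qed
qed

lemma gsol_exists:
  fixes B :: "'g::banach \<Rightarrow> real^3 \<Rightarrow> 'g"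
  assumes B: "bounded_bilinear B" and f: "smooth_map A f" and "simply_connected S" "s0 \<in> S"
    and flat: "\<And>U \<phi> w. (U, \<phi>) \<in> A \<Longrightarrow> w \<in> \<phi> ` U \<Longrightarrow>
      flat B (\<lambda>w. mc (rep f U \<phi>) w c) (\<lambda>w. mc (rep f U \<phi>) w (c * \<i>)) w"
  obtains F where "F s0 = g" "\<And>s. s \<in> S \<Longrightarrow> gsol B c f s F"
  using trivial_local_system.global_solution[OF trivial_local_system_gsol[OF B f flat] assms(3,4)] by blast

text \<open>For the zero bilinear map the equation says that the derivative vanishes; the constant
  map solves it too, and solutions are unique.\<close>

lemma constant_if_derivative_zero:
  fixes F :: "'a \<Rightarrow> 'g::real_normed_vector" and f :: "'a \<Rightarrow> quat"
  assumes f: "smooth_map A f"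
    and F: "\<And>U \<phi> w. (U, \<phi>) \<in> A \<Longrightarrow> w \<in> \<phi> ` U \<Longrightarrow> ((rep F U \<phi>) has_derivative (\<lambda>h. 0)) (at w)"
    and "s0 \<in> S" "s \<in> S"
  shows "F s = F s0"
proof -
  let ?B = "\<lambda>(_::'g) (_::real^3). 0 :: 'g"
  have B: "bounded_bilinear ?B" by (rule bounded_bilinear.intro) (auto intro: exI[of _ 0])
  have "\<forall>s\<in>S. gsol ?B 1 f s F" using F by (subst gsol_iff_charts) auto
  moreover have "\<forall>s\<in>S. gsol ?B 1 f s (\<lambda>_. F s0)"
    by (subst gsol_iff_charts) (auto simp: comp_def)
  ultimately show ?thesis
    using gsol_unique[OF B f, of 1 F "\<lambda>_. F s0" s0 s] assms(3,4) by simp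
qed

text \<open>For imaginary v the product p v is orthogonal to p, so the squared norm has derivative
  0.\<close>

lemma gsol_norm:
  assumes f: "smooth_map A f" and F: "\<And>s. s \<in> S \<Longrightarrow> gsol quat_action c f s F"
    and "s0 \<in> S" "norm (F s0) = 1" "s \<in> S"
  shows "norm (F s) = 1"
proof -
  have "(norm (F s))\<^sup>2 = (norm (F s0))\<^sup>2"
  proof (rule constant_if_derivative_zero[OF f, where F="\<lambda>s. (norm (F s))\<^sup>2"])
    fix U \<phi> w assume U: "(U, \<phi>) \<in> A" "w \<in> \<phi> ` U"
    let ?F = "rep F U \<phi>"
    have D: "(?F has_derivative (\<lambda>h. ?F w \<odot> im_quat (mc (rep f U \<phi>) w (c * h)))) (at w)"
      using gsol_iff_charts[of quat_action c f F] F U by (auto simp: quat_action_def)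
    have "p \<bullet> (p \<odot> im_quat v) = 0" for p v
      by (simp add: im_quat_def quat_mult_def inner_prod_def inner_add_right dot_cross_self)
    then have "((\<lambda>w. ?F w \<bullet> ?F w) has_derivative (\<lambda>h. 0)) (at w)"
      using has_derivative_inner[OF D D] by (simp add: inner_commute)
    then show "(((\<lambda>s. (norm (F s))\<^sup>2) \<circ> inv_into U \<phi>) has_derivative (\<lambda>h. 0)) (at w)"
      by (simp add: comp_def power2_norm_eq_inner)
  qed (use assms in auto)
  then show ?thesis using assms(4) by (simp add: abs_square_eq_1)
qed

text \<open>Left translation commutes with the right multiplication in \<open>quat_action\<close>;
  this symmetry is behind uniqueness up to a left factor.\<close>

lemma gsol_left_mult:
  assumes "gsol quat_action c f s F"
  shows "gsol quat_action c f s (\<lambda>t. a \<odot> F t)"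
  unfolding gsol_def
proof clarify
  fix U \<phi> assume U: "(U, \<phi>) \<in> A" "s \<in> U"
  have "bounded_linear ((\<odot>) a)"
    by (rule bounded_bilinear.bounded_linear_right[OF bounded_bilinear_quat_mult])
  from bounded_linear.has_derivative[OF this gsolD[OF assms U]]
  show "solves quat_action (\<lambda>w. mc (rep f U \<phi>) w c) (\<lambda>w. mc (rep f U \<phi>) w (c * \<i>))
     ((\<lambda>t. a \<odot> F t) \<circ> inv_into U \<phi>) (\<phi> s)"
    using chart_inv[OF U] by (simp add: solves_def form_mc quat_action_def quat_mult_assoc comp_def)
qed

section \<open>Maps with rotated Maurer-Cartan forms\<close>

definition rotated :: "complex \<Rightarrow> ('a \<Rightarrow> quat) \<Rightarrow> ('a \<Rightarrow> quat) \<Rightarrow> bool" where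
  "rotated c f p \<longleftrightarrow> (\<forall>(U, \<phi>)\<in>A. \<forall>w\<in>\<phi> ` U. \<forall>h. mc (rep p U \<phi>) w h = mc (rep f U \<phi>) w (c * h))"

lemma rotatedD: "rotated c f p \<Longrightarrow> (U, \<phi>) \<in> A \<Longrightarrow> w \<in> \<phi> ` U \<Longrightarrow>
    mc (rep p U \<phi>) w h = mc (rep f U \<phi>) w (c * h)"
  unfolding rotated_def by fast

lemma unit_chart: "p ` S \<subseteq> S3 \<Longrightarrow> (U, \<phi>) \<in> A \<Longrightarrow> \<forall>w\<in>\<phi> ` U. norm ((rep p U \<phi>) w) = 1"
  using chart_inv_in chart_subset by fastforce

text \<open>For a map into the unit sphere the differential is the point times its imaginary form,
  so comparing differentials amounts to comparing forms.\<close>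

lemma gsol_iff_rotated:
  assumes p: "smooth_map A p" "p ` S \<subseteq> S3"
  shows "(\<forall>s\<in>S. gsol quat_action c f s p) \<longleftrightarrow> rotated c f p"
proof -
  have "((rep p U \<phi>) has_derivative (\<lambda>h. quat_action (p (inv_into U \<phi> w)) (mc (rep f U \<phi>) w (c * h)))) (at w)
      \<longleftrightarrow> (\<forall>h. mc (rep p U \<phi>) w h = mc (rep f U \<phi>) w (c * h))" (is "?l \<longleftrightarrow> ?r")
    if U: "(U, \<phi>) \<in> A" "w \<in> \<phi> ` U" for U \<phi> w
  proof -
    let ?p = "rep p U \<phi>"
    have n: "norm (?p w) = 1" using unit_chart[OF p(2) U(1)] U(2) by blast
    have D: "(?p has_derivative (\<lambda>h. Re h *\<^sub>R dx ?p w + Im h *\<^sub>R dy ?p w)) (at w)"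
      by (rule C_k_on_has_derivative[OF C_k_on_chart[OF p(1) U(1)] chart_open[OF U(1)] U(2)])
    have eq: "Re h *\<^sub>R dx ?p w + Im h *\<^sub>R dy ?p w = ?p w \<odot> im_quat (mc ?p w h)" for h
      by (rule quat_derivative_mc[OF chart_open[OF U(1)] C_k_on_chart[OF p(1) U(1)] unit_chart[OF p(2) U(1)] U(2)])
    show ?thesis
    proof
      assume ?l
      then have "(\<lambda>h. Re h *\<^sub>R dx ?p w + Im h *\<^sub>R dy ?p w) = (\<lambda>h. quat_action (p (inv_into U \<phi> w)) (mc (rep f U \<phi>) w (c * h)))"
        using D has_derivative_unique by blast
      from fun_cong[OF this] show ?r
        by (intro allI mc_eqI[where F="?p", OF n]) (simp only: quat_action_def comp_def)
    next
      assume ?r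
      then show ?l using D unfolding eq by (simp add: quat_action_def)
    qed
  qed
  then show ?thesis unfolding gsol_iff_charts rotated_def by fast
qed

lemma rotated_exists:
  assumes f: "smooth_map A f" and "simply_connected S"
    and curl: "\<And>U \<phi> w. (U, \<phi>) \<in> A \<Longrightarrow> w \<in> \<phi> ` U \<Longrightarrow>
      dy (\<lambda>w. mc (rep f U \<phi>) w c) w - dx (\<lambda>w. mc (rep f U \<phi>) w (c * \<i>)) w
      = 2 *\<^sub>R cross3 (mc (rep f U \<phi>) w c) (mc (rep f U \<phi>) w (c * \<i>))"
  obtains p where "smooth_map A p" "p ` S \<subseteq> S3" "rotated c f p"
proof -
  obtain s0 where s0: "s0 \<in> S" using RS by (auto simp: riemann_surface_def)
  \<comment> \<open>With initial value 1 the solution stays on the unit sphere by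
    \<open>gsol_norm\<close>.\<close>
  obtain p where p: "p s0 = quat_one" "\<And>s. s \<in> S \<Longrightarrow> gsol quat_action c f s p"
    using gsol_exists[OF bounded_bilinear_quat_action f assms(2) s0 flat_quat_action[OF curl]] by metis
  have "smooth_map A p" by (rule gsol_smooth[OF bounded_bilinear_quat_action f p(2)])
  moreover have "p ` S \<subseteq> S3"
    using gsol_norm[OF f p(2) s0] p(1) by (auto simp: norm_Pair)
  ultimately show ?thesis using that[of p] gsol_iff_rotated p(2) by blast
qed

lemma rotated_unique:
  assumes f: "smooth_map A f"
    and p: "smooth_map A p" "p ` S \<subseteq> S3" "rotated c f p" and q: "smooth_map A q" "q ` S \<subseteq> S3" "rotated c f q"
  shows "\<exists>a\<in>S3. \<forall>s\<in>S. q s = a \<odot> p s"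
proof -
  obtain s0 where s0: "s0 \<in> S" using RS by (auto simp: riemann_surface_def)
  \<comment> \<open>The left factor that makes the two maps agree at \<open>s0\<close>.\<close>
  define a where "a = q s0 \<odot> qcnj (p s0)"
  have n: "norm (p s0) = 1" "norm (q s0) = 1" using p(2) q(2) s0 by auto
  have "q s = a \<odot> p s" if s: "s \<in> S" for s
  proof (rule gsol_unique[OF bounded_bilinear_quat_action f, where c=c and F=q and G="\<lambda>t. a \<odot> p t", OF _ _ s0 _ s])
    show "gsol quat_action c f s q" if "s \<in> S" for s
      using gsol_iff_rotated[OF q(1,2)] q(3) that by blast
    show "gsol quat_action c f s (\<lambda>t. a \<odot> p t)" if "s \<in> S" for s
      using gsol_left_mult gsol_iff_rotated[OF p(1,2)] p(3) that by blast
    show "q s0 = a \<odot> p s0" by (simp add: a_def quat_mult_assoc qcnj_mult_self n)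
  qed
  moreover have "a \<in> S3" using n by (simp add: a_def norm_quat_mult)
  ultimately show ?thesis by blast
qed

end

section \<open>Harmonic maps and almost complex surfaces\<close>

lemma dx_linear: "bounded_linear L \<Longrightarrow> F differentiable (at w) \<Longrightarrow> dx (\<lambda>w. L (F w)) w = L (dx F w)"
  and dy_linear: "bounded_linear L \<Longrightarrow> F differentiable (at w) \<Longrightarrow> dy (\<lambda>w. L (F w)) w = L (dy F w)"
  by (simp_all add: dx_eq[OF bounded_linear.has_derivative[OF _ has_derivative_dx_dy]]
      dy_eq[OF bounded_linear.has_derivative[OF _ has_derivative_dx_dy]])

lemma bounded_linear_cpx_of: "bounded_linear cpx_of"
  unfolding cpx_of_def by (intro bounded_linear_Pair bounded_linear_ident bounded_linear_zero)

lemma dx_real: "F differentiable (at w) \<Longrightarrow> dx (cpx_of \<circ> F) w = (dx F w, 0)"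
  and dy_real: "F differentiable (at w) \<Longrightarrow> dy (cpx_of \<circ> F) w = (dy F w, 0)"
  using dx_linear[OF bounded_linear_cpx_of, of F w] dy_linear[OF bounded_linear_cpx_of, of F w]
  by (simp_all add: comp_def cpx_of_def)

lemma dz_real: "F differentiable (at w) \<Longrightarrow> dz (cpx_of \<circ> F) w = ((1/2) *\<^sub>R dx F w, - (1/2) *\<^sub>R dy F w)"
  and dzbar_real: "F differentiable (at w) \<Longrightarrow> dzbar (cpx_of \<circ> F) w = ((1/2) *\<^sub>R dx F w, (1/2) *\<^sub>R dy F w)"
  by (simp_all add: dx_real dy_real dz_def dzbar_def cpx_scale_def)

text \<open>On real maps the operator is a quarter of the Laplacian; the imaginary part is a
  difference of mixed derivatives and vanishes.\<close>

lemma dzbar_dz_real: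
  assumes V: "open V" "C_k_on 2 V F" and w: "w \<in> V"
  shows "dzbar (dz (cpx_of \<circ> F)) w = ((1/4) *\<^sub>R (dx (dx F) w + dy (dy F) w), 0)"
proof -
  have C: "C_k_on (Suc (Suc 0)) V F" using V(2) by (simp add: numeral_2_eq_2)
  then have C': "C_k_on (Suc 0) V (dx F)" "C_k_on (Suc 0) V (dy F)" by auto
  let ?G = "\<lambda>v. ((1/2) *\<^sub>R dx F v, - (1/2) *\<^sub>R dy F v)"
  have eq: "dz (cpx_of \<circ> F) v = ?G v" if "v \<in> V" for v
    by (rule dz_real[OF C_k_on_differentiable[OF C V(1) that]])
  have "(?G has_derivative (\<lambda>h. ((1/2) *\<^sub>R (Re h *\<^sub>R dx (dx F) w + Im h *\<^sub>R dy (dx F) w),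
      - (1/2) *\<^sub>R (Re h *\<^sub>R dx (dy F) w + Im h *\<^sub>R dy (dy F) w)))) (at w)"
    by (intro has_derivative_Pair has_derivative_scaleR_right C_k_on_has_derivative[OF C'(1) V(1) w]
        C_k_on_has_derivative[OF C'(2) V(1) w])
  then have "dx ?G w = ((1/2) *\<^sub>R dx (dx F) w, - (1/2) *\<^sub>R dx (dy F) w)"
    "dy ?G w = ((1/2) *\<^sub>R dy (dx F) w, - (1/2) *\<^sub>R dy (dy F) w)"
    by (simp_all add: dx_eq dy_eq)
  moreover have "dx (dz (cpx_of \<circ> F)) w = dx ?G w" "dy (dz (cpx_of \<circ> F)) w = dy ?G w"
    using eq by (auto intro: dx_cong_open[OF V(1) w] dy_cong_open[OF V(1) w])
  ultimately show ?thesis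
    using dx_dy_commute[OF V(2,1) w] by (simp add: dzbar_def cpx_scale_def algebra_simps)
qed

lemma quat_mult_real: "p \<odot> (r, 0) = r *\<^sub>R p"
  by (cases p) (simp add: quat_mult_def)

lemma quat_im_inject:
  assumes "norm p = 1"
  shows "p \<odot> im_quat a = p \<odot> im_quat b \<longleftrightarrow> a = b"
  using quat_cancel_left(1)[OF assms] snd_im_quat(1) by metis

text \<open>For every map into the sphere the component of the Laplacian along \<open>F\<close> is -
  m F, so this part of the equation is automatic. The tangential component is \<open>F\<close> times
  the divergence.\<close>

lemma harmonic_equation_iff:
  assumes V: "open V" "C_k_on 2 V F" and n: "\<forall>w\<in>V. norm (F w) = 1" and w: "w \<in> V"
  shows "dzbar (dz (cpx_of \<circ> F)) w =
      cpx_scale (- cpx_bilinear inner (dz (cpx_of \<circ> F) w) (dzbar (cpx_of \<circ> F) w)) ((cpx_of \<circ> F) w)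
    \<longleftrightarrow> div_mc F w = 0"
proof -
  let ?a = "mc F w 1" and ?b = "mc F w \<i>"
  define m where "m = ?a \<bullet> ?a + ?b \<bullet> ?b"
  have C1: "C_k_on 1 V F" using V(2) C_k_on_lower[of 1 V F] by (simp add: numeral_2_eq_2)
  then have D: "F differentiable (at w)"
    using C_k_on_differentiable[of 0 V F w] V(1) w by simp
  have nw: "norm (F w) = 1" using n w by blast
  note d = quat_dx_dy_mc[OF V(1) C1 n w]
  have "dx (dx F) w + dy (dy F) w = F w \<odot> (- m, 0) + F w \<odot> im_quat (div_mc F w)"
    unfolding second_derivatives_mc[OF V n w] quat_bilinear(2)[symmetric] im_quat_mult
    by (simp add: im_quat_def div_mc_def m_def)
  then have L: "dzbar (dz (cpx_of \<circ> F)) w =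
      (- (m / 4) *\<^sub>R F w + (1/4) *\<^sub>R (F w \<odot> im_quat (div_mc F w)), 0)"
    unfolding dzbar_dz_real[OF V w] by (simp only: quat_mult_real scaleR_add_right scaleR_scaleR) simp
  have R: "cpx_scale (- cpx_bilinear inner (dz (cpx_of \<circ> F) w) (dzbar (cpx_of \<circ> F) w)) ((cpx_of \<circ> F) w)
    = (- (m / 4) *\<^sub>R F w, 0)"
    unfolding dz_real[OF D] dzbar_real[OF D] d
    by (simp add: cpx_scale_def cpx_bilinear_def cpx_of_def inner_quat_mult_left[OF nw] m_def inner_commute field_simps)
  have "F w \<odot> im_quat (div_mc F w) = 0 \<longleftrightarrow> div_mc F w = 0"
  proof -
    have "F w \<odot> im_quat 0 = 0"
      by (simp only: linear_0[OF bounded_linear.linear[OF bounded_linear_im_quat]] quat_bilinear)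
    then show ?thesis using quat_im_inject[OF nw, of "div_mc F w" 0] by simp
  qed
  then show ?thesis unfolding L R by simp
qed

lemma hopf_coeff_mc:
  assumes "open V" "C_k_on 1 V F" "\<forall>w\<in>V. norm (F w) = 1" "w \<in> V"
  shows "hopf_coeff F w = Complex ((mc F w 1 \<bullet> mc F w 1 - mc F w \<i> \<bullet> mc F w \<i>) / 4) (- (mc F w 1 \<bullet> mc F w \<i>) / 2)"
proof -
  have D: "F differentiable (at w)"
    using C_k_on_differentiable[of 0 V F w] assms by simp
  have "norm (F w) = 1" using assms by blast
  note n = inner_quat_mult_left[OF this]
  show ?thesis
    unfolding hopf_coeff_def dz_real[OF D] quat_dx_dy_mc[OF assms]
    by (simp add: cpx_bilinear_def n inner_commute field_simps)
qed

text \<open>In the complexification the z-component of the form is multiplied by \<open>c\<close>,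
  and the Hopf coefficient is quadratic in it.\<close>

lemma hopf_coeff_rotated:
  assumes F: "open V" "C_k_on 1 V F" "\<forall>w\<in>V. norm (F w) = 1" and G: "C_k_on 1 V G" "\<forall>w\<in>V. norm (G w) = 1"
    and w: "w \<in> V" and rot: "\<And>h. mc G w h = mc F w (c * h)"
  shows "hopf_coeff G w = c\<^sup>2 * hopf_coeff F w"
proof -
  have G': "mc G w 1 = Re c *\<^sub>R mc F w 1 + Im c *\<^sub>R mc F w \<i>" "mc G w \<i> = Re c *\<^sub>R mc F w \<i> - Im c *\<^sub>R mc F w 1"
    using mc_eq[of F w c] mc_eq[of F w "c * \<i>"] rot[of 1] rot[of \<i>] by simp_all
  show ?thesis
    unfolding hopf_coeff_mc[OF F w] hopf_coeff_mc[OF F(1) G w] G'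
    by (simp add: complex_eq_iff power2_eq_square inner_add_left inner_add_right inner_diff_left inner_diff_right
        inner_commute field_simps)
qed

section \<open>The nearly Kaehler structure in the left trivialisation\<close>

abbreviation sixth_root :: complex where
  "sixth_root \<equiv> Complex (1/2) (sqrt 3 / 2)"

lemma mc_sixth_root: "mc F w (sixth_root * v) = (1/2) *\<^sub>R mc F w v + (sqrt 3 / 2) *\<^sub>R mc F w (\<i> * v)"
proof -
  have "sixth_root * v = (1/2) *\<^sub>R v + (sqrt 3 / 2) *\<^sub>R (\<i> * v)" by (simp add: complex_eq_iff)
  then show ?thesis by (simp only: mc_add mc_scaleR)
qed

text \<open>In the left trivialisation the factors p q^-1 and q p^-1 disappear and \<open>J\<close>
  has constant coefficients.\<close>

lemma nk_J_left:
  assumes "norm p = 1" "norm q = 1"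
  shows "nk_J (p, q) (p \<odot> im_quat a, q \<odot> im_quat b) =
    (p \<odot> im_quat ((1 / sqrt 3) *\<^sub>R (2 *\<^sub>R b - a)), q \<odot> im_quat ((1 / sqrt 3) *\<^sub>R (b - 2 *\<^sub>R a)))"
proof -
  have im: "im_quat (r *\<^sub>R x) = r *\<^sub>R im_quat x" "im_quat (x - y) = im_quat x - im_quat y" for r x y
    by (simp_all add: im_quat_def)
  show ?thesis
    unfolding nk_J_def im quat_bilinear
    by (simp add: quat_inv_unit assms quat_mult_assoc quat_cancel_left algebra_simps)
qed

lemma nk_P_left:
  assumes "norm p = 1" "norm q = 1"
  shows "nk_P (p, q) (p \<odot> im_quat a, q \<odot> im_quat b) = (p \<odot> im_quat b, q \<odot> im_quat a)"
  by (simp add: nk_P_def quat_inv_unit assms quat_mult_assoc quat_cancel_left)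

text \<open>The first component of the equation can be solved for the form of \<open>q\<close> and
  gives the rotation by e^(i pi/3); the second component is then implied.\<close>

lemma acs_equation_iff:
  assumes V: "open V" "C_k_on 1 V \<Psi>" and n: "\<forall>w\<in>V. norm (fst (\<Psi> w)) = 1" "\<forall>w\<in>V. norm (snd (\<Psi> w)) = 1"
    and w: "w \<in> V"
  defines "p \<equiv> fst \<circ> \<Psi>" and "q \<equiv> snd \<circ> \<Psi>"
  shows "frechet_derivative \<Psi> (at w) v = (p w \<odot> im_quat (mc p w v), q w \<odot> im_quat (mc q w v))"
    and "(\<forall>v. nk_J (\<Psi> w) (frechet_derivative \<Psi> (at w) v) = frechet_derivative \<Psi> (at w) (\<i> * v)) \<longleftrightarrow>
      (\<forall>v. mc q w v = mc p w (sixth_root * v))"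
proof -
  have C: "C_k_on 1 V p" "C_k_on 1 V q"
    using C_k_on_linear[OF bounded_linear_fst V] C_k_on_linear[OF bounded_linear_snd V]
    by (simp_all only: p_def q_def comp_def)
  have n': "\<forall>w\<in>V. norm (p w) = 1" "\<forall>w\<in>V. norm (q w) = 1"
    using n by (simp_all add: p_def q_def)
  then have nw: "norm (p w) = 1" "norm (q w) = 1" using w by blast+
  have D: "\<Psi> differentiable (at w)"
    using C_k_on_differentiable[of 0 V \<Psi> w] V w by simp
  have "frechet_derivative \<Psi> (at w) v = Re v *\<^sub>R dx \<Psi> w + Im v *\<^sub>R dy \<Psi> w" for v
    by (rule fun_cong[OF frechet_derivative_at[OF has_derivative_dx_dy[OF D]], symmetric])
  moreover have "dx p w = fst (dx \<Psi> w)" "dy p w = fst (dy \<Psi> w)" "dx q w = snd (dx \<Psi> w)" "dy q w = snd (dy \<Psi> w)"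
    unfolding p_def q_def comp_def
    by (rule dx_linear[OF bounded_linear_fst D] dy_linear[OF bounded_linear_fst D]
        dx_linear[OF bounded_linear_snd D] dy_linear[OF bounded_linear_snd D])+
  ultimately have "frechet_derivative \<Psi> (at w) v = (Re v *\<^sub>R dx p w + Im v *\<^sub>R dy p w, Re v *\<^sub>R dx q w + Im v *\<^sub>R dy q w)" for v
    by (simp add: prod_eq_iff)
  then show F: "frechet_derivative \<Psi> (at w) v = (p w \<odot> im_quat (mc p w v), q w \<odot> im_quat (mc q w v))" for v
    by (simp only: quat_derivative_mc[OF V(1) C(1) n'(1) w] quat_derivative_mc[OF V(1) C(2) n'(2) w])
  have \<Psi>: "\<Psi> w = (p w, q w)" by (simp add: p_def q_def)
  have J: "nk_J (\<Psi> w) (frechet_derivative \<Psi> (at w) v) = frechet_derivative \<Psi> (at w) (\<i> * v) \<longleftrightarrow>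
     (1 / sqrt 3) *\<^sub>R (2 *\<^sub>R mc q w v - mc p w v) = mc p w (\<i> * v) \<and>
     (1 / sqrt 3) *\<^sub>R (mc q w v - 2 *\<^sub>R mc p w v) = mc q w (\<i> * v)" for v
    unfolding \<Psi> F nk_J_left[OF nw] prod.inject quat_im_inject[OF nw(1)] quat_im_inject[OF nw(2)] ..
  have 1: "(1 / sqrt 3) *\<^sub>R (2 *\<^sub>R b - a) = c \<longleftrightarrow> b = (1/2) *\<^sub>R a + (sqrt 3 / 2) *\<^sub>R c" for a b c :: "real^3"
  proof -
    have "(1 / sqrt 3) *\<^sub>R (2 *\<^sub>R b - a) = c \<longleftrightarrow> sqrt 3 *\<^sub>R ((1 / sqrt 3) *\<^sub>R (2 *\<^sub>R b - a)) = sqrt 3 *\<^sub>R c"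
      by (subst scaleR_cancel_left) simp
    also have "\<dots> \<longleftrightarrow> 2 *\<^sub>R b = 2 *\<^sub>R ((1/2) *\<^sub>R a + (sqrt 3 / 2) *\<^sub>R c)"
      by (simp add: algebra_simps)
    also have "\<dots> \<longleftrightarrow> b = (1/2) *\<^sub>R a + (sqrt 3 / 2) *\<^sub>R c"
      by (subst scaleR_cancel_left) simp
    finally show ?thesis .
  qed
  \<comment> \<open>With z = \<open>sixth_root\<close> this is the identity (z - 2) / sqrt 3 = i z
    of complex numbers, applied inside the form of \<open>p\<close>.\<close>
  have 2: "(1 / sqrt 3) *\<^sub>R (mc q w v - 2 *\<^sub>R mc p w v) = mc q w (\<i> * v)"
    if rot: "\<And>v. mc q w v = mc p w (sixth_root * v)" for v
  proof -
    have "(1 / sqrt 3) *\<^sub>R (sixth_root * v - 2 *\<^sub>R v) = sixth_root * (\<i> * v)"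
      by (simp add: complex_eq_iff field_simps)
    then have "mc p w ((1 / sqrt 3) *\<^sub>R (sixth_root * v + (- 2) *\<^sub>R v)) = mc p w (sixth_root * (\<i> * v))"
      by simp
    then show ?thesis unfolding rot[symmetric] mc_scaleR mc_add by simp
  qed
  show "(\<forall>v. nk_J (\<Psi> w) (frechet_derivative \<Psi> (at w) v) = frechet_derivative \<Psi> (at w) (\<i> * v)) \<longleftrightarrow>
      (\<forall>v. mc q w v = mc p w (sixth_root * v))"
    unfolding J 1 mc_sixth_root[symmetric] using 2 by blast
qed

text \<open>Put z = \<open>sixth_root\<close> and let A be the z-component of the form of
  \<open>p\<close>. The left translated \<psi>_z is (A, z A), and \<open>P\<close> exchanges the
  entries. The metric formula \<open>g\<close> below yields (8 z - 2 z^2 - 2) / 3 times A \<bullet>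
  A, and z^2 = z - 1 reduces the factor to 2 z. The proof carries this out in real and imaginary
  parts.\<close>

lemma acs_differential_coeff_hopf:
  assumes V: "open V" "C_k_on 1 V \<Psi>" and n: "\<forall>w\<in>V. norm (fst (\<Psi> w)) = 1" "\<forall>w\<in>V. norm (snd (\<Psi> w)) = 1"
    and w: "w \<in> V" and rot: "\<And>v. mc (snd \<circ> \<Psi>) w v = mc (fst \<circ> \<Psi>) w (sixth_root * v)"
  shows "acs_differential_coeff \<Psi> w = 2 * sixth_root * hopf_coeff (fst \<circ> \<Psi>) w"
proof -
  define p where "p = fst \<circ> \<Psi>"
  define q where "q = snd \<circ> \<Psi>"
  have C: "C_k_on 1 V p"
    using C_k_on_linear[OF bounded_linear_fst V] by (simp only: p_def comp_def)
  have n': "\<forall>w\<in>V. norm (p w) = 1" using n by (simp add: p_def)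
  have nw: "norm (p w) = 1" "norm (q w) = 1" using n w by (auto simp: p_def q_def)
  have \<Psi>: "\<Psi> w = (p w, q w)" by (simp add: p_def q_def)
  have D: "\<Psi> differentiable (at w)"
    using C_k_on_differentiable[of 0 V \<Psi> w] V w by simp
  let ?a = "mc p w 1" and ?b = "mc p w \<i>" and ?a' = "mc q w 1" and ?b' = "mc q w \<i>"
  have d: "dx \<Psi> w = (p w \<odot> im_quat ?a, q w \<odot> im_quat ?a')" "dy \<Psi> w = (p w \<odot> im_quat ?b, q w \<odot> im_quat ?b')"
    unfolding dx_def dy_def using acs_equation_iff(1)[OF V n w] by (simp_all add: p_def q_def)
  have "mc p w (\<i> * \<i>) = - ?a" using mc_eq[of p w "\<i> * \<i>"] by simp
  then have ab: "?a' = (1/2) *\<^sub>R ?a + (sqrt 3 / 2) *\<^sub>R ?b" "?b' = (1/2) *\<^sub>R ?b - (sqrt 3 / 2) *\<^sub>R ?a"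
    using rot[of 1] rot[of \<i>] mc_sixth_root[of p w 1] mc_sixth_root[of p w \<i>] by (simp_all add: p_def q_def)
  have s3: "sqrt 3 * (sqrt 3 * x) = 3 * x" for x :: real by (simp flip: mult.assoc)
  \<comment> \<open>The metric in the left trivialisation, with constant coefficients because
    \<open>J\<close> has them.\<close>
  have g: "nk_g (\<Psi> w) (p w \<odot> im_quat x, q w \<odot> im_quat y) (p w \<odot> im_quat x', q w \<odot> im_quat y')
     = (4 * (x \<bullet> x') + 4 * (y \<bullet> y') - 2 * (x \<bullet> y') - 2 * (y \<bullet> x')) / 3" for x y x' y'
    unfolding nk_g_def \<Psi> nk_J_left[OF nw]
    by (simp add: inner_prod_def[of "(_, _)"] inner_quat_mult_left[OF nw(1)] inner_quat_mult_left[OF nw(2)] inner_diff_left inner_diff_right inner_commute field_simps)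
  let ?A = "?a \<bullet> ?a" and ?B = "?b \<bullet> ?b" and ?C = "?a \<bullet> ?b"
  have inner: "?a \<bullet> ?a' = ?A / 2 + sqrt 3 * ?C / 2" "?b \<bullet> ?b' = ?B / 2 - sqrt 3 * ?C / 2"
    "?a' \<bullet> ?a' = ?A / 4 + sqrt 3 * ?C / 2 + 3 * ?B / 4" "?b' \<bullet> ?b' = ?B / 4 - sqrt 3 * ?C / 2 + 3 * ?A / 4"
    "?a \<bullet> ?b' = ?C / 2 - sqrt 3 * ?A / 2" "?b \<bullet> ?a' = ?C / 2 + sqrt 3 * ?B / 2"
    "?a' \<bullet> ?b' = - ?C / 2 + sqrt 3 * (?B - ?A) / 4"
    unfolding ab by (simp_all add: inner_add_left inner_add_right inner_diff_left inner_diff_right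
        inner_commute[of ?b ?a] s3 field_simps)
  have im: "r *\<^sub>R (x \<odot> im_quat v) = x \<odot> im_quat (r *\<^sub>R v)" for r x v
    by (simp add: im_quat_def flip: quat_bilinear(8))
  have Z: "dz (cpx_of \<circ> \<Psi>) w = ((p w \<odot> im_quat ((1/2) *\<^sub>R ?a), q w \<odot> im_quat ((1/2) *\<^sub>R ?a')),
      (p w \<odot> im_quat (- (1/2) *\<^sub>R ?b), q w \<odot> im_quat (- (1/2) *\<^sub>R ?b')))"
    unfolding dz_real[OF D] d scaleR_Pair im ..
  have P: "cpx_linear (nk_P (\<Psi> w)) (dz (cpx_of \<circ> \<Psi>) w) =
     ((p w \<odot> im_quat ((1/2) *\<^sub>R ?a'), q w \<odot> im_quat ((1/2) *\<^sub>R ?a)),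
      (p w \<odot> im_quat (- (1/2) *\<^sub>R ?b'), q w \<odot> im_quat (- (1/2) *\<^sub>R ?b)))"
    unfolding Z cpx_linear_def fst_conv snd_conv \<Psi> nk_P_left[OF nw] ..
  have "acs_differential_coeff \<Psi> w = Complex
     ((8 * (?a \<bullet> ?a') - 2 * (?a' \<bullet> ?a') - 2 * ?A) / 12 - (8 * (?b \<bullet> ?b') - 2 * (?b' \<bullet> ?b') - 2 * ?B) / 12)
     (- (4 * (?b \<bullet> ?a') + 4 * (?a \<bullet> ?b') - 2 * (?a' \<bullet> ?b') - 2 * ?C) / 6)"
    unfolding acs_differential_coeff_def Let_def P
    unfolding Z cpx_bilinear_def fst_conv snd_conv g
    by (simp add: complex_eq_iff inner_commute field_simps)
  also have "\<dots> = 2 * sixth_root * hopf_coeff p w"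
    unfolding inner hopf_coeff_mc[OF V(1) C n' w] by (simp add: complex_eq_iff field_simps)
  finally show ?thesis by (simp only: p_def)
qed


lemma C_k_on_components:
  fixes \<Psi> :: "complex \<Rightarrow> 'u::real_normed_vector \<times> 'v::real_normed_vector"
  assumes "open V"
  shows "C_k_on k V \<Psi> \<longleftrightarrow> C_k_on k V (fst \<circ> \<Psi>) \<and> C_k_on k V (snd \<circ> \<Psi>)"
proof
  assume "C_k_on k V \<Psi>"
  then show "C_k_on k V (fst \<circ> \<Psi>) \<and> C_k_on k V (snd \<circ> \<Psi>)"
    using C_k_on_linear[OF bounded_linear_fst assms, of k \<Psi>] C_k_on_linear[OF bounded_linear_snd assms, of k \<Psi>]
    by (simp add: comp_def)
next
  assume C: "C_k_on k V (fst \<circ> \<Psi>) \<and> C_k_on k V (snd \<circ> \<Psi>)"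
  have "C_k_on k V (\<lambda>w. ((fst \<circ> \<Psi>) w, 0) + (0, (snd \<circ> \<Psi>) w))"
    using C by (intro C_k_on_add C_k_on_linear[of "\<lambda>x. (x, 0)"] C_k_on_linear[of "\<lambda>x. (0, x)"]
        bounded_linear_Pair bounded_linear_ident bounded_linear_zero assms) (simp_all add: comp_def)
  then show "C_k_on k V \<Psi>" by simp
qed

text \<open>
  This is \<open>(\<surd>3 / 2) e\<^bsup>- i \<pi> / 6\<^esup>\<close>: the differential \<open>dX(h) = mc f (\<i> h)\<close>
  is dilated by \<open>\<surd>3 / 2\<close> and rotated by \<open>- 2 \<pi> / 3\<close>.
\<close>

abbreviation assoc_rot :: complex where
  "assoc_rot \<equiv> Complex (3/4) (- sqrt 3 / 4)"

abbreviation dilated :: "('a \<Rightarrow> real^3) \<Rightarrow> 'a \<Rightarrow> real^3" where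
  "dilated X \<equiv> \<lambda>s. (sqrt 3 / 2) *\<^sub>R X s"

section \<open>The association as a rotation of forms\<close>

context riemann
begin

lemma harmonic_map_iff:
  "harmonic_map S A f \<longleftrightarrow> smooth_map A f \<and> f ` S \<subseteq> S3 \<and>
    (\<forall>(U, \<phi>)\<in>A. \<forall>w\<in>\<phi> ` U. div_mc (rep f U \<phi>) w = 0)"
proof (cases "smooth_map A f \<and> f ` S \<subseteq> S3")
  case True
  then have f: "smooth_map A f" "f ` S \<subseteq> S3" by auto
  have "dzbar (dz (cpx_of \<circ> (rep f U \<phi>))) w = cpx_scale (- cpx_bilinear inner (dz (cpx_of \<circ> (rep f U \<phi>)) w)
      (dzbar (cpx_of \<circ> (rep f U \<phi>)) w)) ((cpx_of \<circ> (rep f U \<phi>)) w)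
    \<longleftrightarrow> div_mc (rep f U \<phi>) w = 0" if "(U, \<phi>) \<in> A" "w \<in> \<phi> ` U" for U \<phi> w
    by (rule harmonic_equation_iff[OF chart_open[OF that(1)] C_k_on_chart[OF f(1) that(1)] unit_chart[OF f(2) that(1)] that(2)])
  then show ?thesis using f unfolding harmonic_map_def Let_def by fast
qed (auto simp: harmonic_map_def)

lemma harmonic_curl:
  assumes f: "harmonic_map S A f" and U: "(U, \<phi>) \<in> A" "w \<in> \<phi> ` U"
  shows "dy (\<lambda>w. mc (rep f U \<phi>) w c) w - dx (\<lambda>w. mc (rep f U \<phi>) w (c * \<i>)) w
      = (2 * Re c) *\<^sub>R cross_mc (rep f U \<phi>) w"
proof -
  have f': "smooth_map A f" "f ` S \<subseteq> S3" and "div_mc (rep f U \<phi>) w = 0"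
    using f U unfolding harmonic_map_iff by fast+
  then have d: "div_mc (rep f U \<phi>) w = 0 *\<^sub>R cross_mc (rep f U \<phi>) w" by simp
  show ?thesis
    unfolding curl_rotated_mc(1)[OF chart_open[OF U(1)] C_k_on_chart[OF f'(1) U(1)] unit_chart[OF f'(2) U(1)] U(2) d]
    by simp
qed

lemma smooth_map_components:
  "smooth_map A \<psi> \<longleftrightarrow> smooth_map A (fst \<circ> \<psi>) \<and> smooth_map A (snd \<circ> \<psi>)"
proof -
  have "C_k_on k (\<phi> ` U) (rep \<psi> U \<phi>) \<longleftrightarrow> C_k_on k (\<phi> ` U) (rep (fst \<circ> \<psi>) U \<phi>) \<and>
      C_k_on k (\<phi> ` U) (rep (snd \<circ> \<psi>) U \<phi>)" if "(U, \<phi>) \<in> A" for U \<phi> k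
    using C_k_on_components[OF chart_open[OF that], of k "rep \<psi> U \<phi>"] by (simp add: comp_assoc)
  then show ?thesis unfolding smooth_map_def by fast
qed

lemma acs_iff:
  "almost_complex_surface S A \<psi> \<longleftrightarrow>
    smooth_map A (fst \<circ> \<psi>) \<and> (fst \<circ> \<psi>) ` S \<subseteq> S3 \<and> smooth_map A (snd \<circ> \<psi>) \<and> (snd \<circ> \<psi>) ` S \<subseteq> S3 \<and>
    rotated sixth_root (fst \<circ> \<psi>) (snd \<circ> \<psi>)"
proof (cases "smooth_map A \<psi> \<and> (fst \<circ> \<psi>) ` S \<subseteq> S3 \<and> (snd \<circ> \<psi>) ` S \<subseteq> S3")
  case True
  then have \<psi>: "smooth_map A \<psi>" "(fst \<circ> \<psi>) ` S \<subseteq> S3" "(snd \<circ> \<psi>) ` S \<subseteq> S3" by auto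
  then have \<psi>': "\<forall>s\<in>S. fst (\<psi> s) \<in> S3 \<and> snd (\<psi> s) \<in> S3" by auto
  have "(\<forall>v. nk_J ((rep \<psi> U \<phi>) w) (frechet_derivative (rep \<psi> U \<phi>) (at w) v)
        = frechet_derivative (rep \<psi> U \<phi>) (at w) (\<i> * v)) \<longleftrightarrow>
      (\<forall>v. mc (rep (snd \<circ> \<psi>) U \<phi>) w v = mc (rep (fst \<circ> \<psi>) U \<phi>) w (sixth_root * v))"
    if U: "(U, \<phi>) \<in> A" "w \<in> \<phi> ` U" for U \<phi> w
    using acs_equation_iff(2)[OF chart_open[OF U(1)] C_k_on_chart[OF \<psi>(1) U(1)] _ _ U(2)]
      unit_chart[OF \<psi>(2) U(1)] unit_chart[OF \<psi>(3) U(1)] by (simp add: comp_assoc)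
  then show ?thesis
    using \<psi> \<psi>' smooth_map_components[of \<psi>]
    unfolding almost_complex_surface_def rotated_def Let_def by fast
next
  case False
  then have "\<not> (smooth_map A \<psi> \<and> (\<forall>s\<in>S. fst (\<psi> s) \<in> S3 \<and> snd (\<psi> s) \<in> S3))" by force
  then show ?thesis
    using False smooth_map_components[of \<psi>] unfolding almost_complex_surface_def by blast
qed

text \<open>A dilation by k multiplies the Laplacian by k and the cross product by k^2, hence
  divides H by k.\<close>

lemma H_surface_dilation:
  assumes X: "H_surface (-1) A X"
  shows "H_surface (- 2 / sqrt 3) A (dilated X)"
    and "(U, \<phi>) \<in> A \<Longrightarrow> w \<in> \<phi> ` U \<Longrightarrow> dx (rep (dilated X) U \<phi>) w = (sqrt 3 / 2) *\<^sub>R dx (rep X U \<phi>) w"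
    and "(U, \<phi>) \<in> A \<Longrightarrow> w \<in> \<phi> ` U \<Longrightarrow> dy (rep (dilated X) U \<phi>) w = (sqrt 3 / 2) *\<^sub>R dy (rep X U \<phi>) w"
proof -
  let ?k = "sqrt 3 / 2"
  note L = bounded_linear_scaleR_right[of ?k]
  have X': "smooth_map A X" using X by (simp add: H_surface_def)
  have eq: "rep (dilated X) U \<phi> = (\<lambda>w. ?k *\<^sub>R (rep X U \<phi>) w)" for U and \<phi> :: "'a \<Rightarrow> complex"
    by (simp add: comp_def)
  have D: "dx (\<lambda>w. ?k *\<^sub>R (rep X U \<phi>) w) w = ?k *\<^sub>R dx (rep X U \<phi>) w"
    "dy (\<lambda>w. ?k *\<^sub>R (rep X U \<phi>) w) w = ?k *\<^sub>R dy (rep X U \<phi>) w"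
    if U: "(U, \<phi>) \<in> A" "w \<in> \<phi> ` U" for U \<phi> w
    using dx_linear[OF L] dy_linear[OF L] C_k_on_differentiable[OF C_k_on_chart[OF X' U(1)] chart_open[OF U(1)] U(2)]
    by blast+
  show "(U, \<phi>) \<in> A \<Longrightarrow> w \<in> \<phi> ` U \<Longrightarrow> dx (rep (dilated X) U \<phi>) w = ?k *\<^sub>R dx (rep X U \<phi>) w"
    "(U, \<phi>) \<in> A \<Longrightarrow> w \<in> \<phi> ` U \<Longrightarrow> dy (rep (dilated X) U \<phi>) w = ?k *\<^sub>R dy (rep X U \<phi>) w"
    unfolding eq by (fact D)+
  show "H_surface (- 2 / sqrt 3) A (dilated X)"
    unfolding H_surface_def smooth_map_def Let_def
  proof (intro conjI ballI; clarify)
    fix U \<phi> k assume "(U, \<phi>) \<in> A"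
    then show "C_k_on k (\<phi> ` U) (rep (dilated X) U \<phi>)"
      unfolding eq by (intro C_k_on_scaleR chart_open C_k_on_chart[OF X'])
  next
    fix U \<phi> s assume U: "(U, \<phi>) \<in> A" "s \<in> U"
    define w where "w = \<phi> s"
    have w: "w \<in> \<phi> ` U" using U by (simp add: w_def)
    let ?Y = "rep X U \<phi>"
    have C: "C_k_on (Suc (Suc 0)) (\<phi> ` U) ?Y" by (rule C_k_on_chart[OF X' U(1)])
    then have C': "C_k_on (Suc 0) (\<phi> ` U) (dx ?Y)" "C_k_on (Suc 0) (\<phi> ` U) (dy ?Y)" by auto
    have "dx (dx (\<lambda>w. ?k *\<^sub>R ?Y w)) w = dx (\<lambda>w. ?k *\<^sub>R dx ?Y w) w"
      "dy (dy (\<lambda>w. ?k *\<^sub>R ?Y w)) w = dy (\<lambda>w. ?k *\<^sub>R dy ?Y w) w"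
      using D[OF U(1)] by (auto intro: dx_cong_open[OF chart_open[OF U(1)] w] dy_cong_open[OF chart_open[OF U(1)] w])
    moreover have "dx (\<lambda>w. ?k *\<^sub>R dx ?Y w) w = ?k *\<^sub>R dx (dx ?Y) w" "dy (\<lambda>w. ?k *\<^sub>R dy ?Y w) w = ?k *\<^sub>R dy (dy ?Y) w"
      by (rule dx_linear[OF L] dy_linear[OF L], rule C_k_on_differentiable[OF C'(1) chart_open[OF U(1)] w]
          C_k_on_differentiable[OF C'(2) chart_open[OF U(1)] w])+
    moreover have "dx (dx ?Y) w + dy (dy ?Y) w = (2 * (-1)) *\<^sub>R cross3 (dx ?Y w) (dy ?Y w)"
      using X U w unfolding H_surface_def Let_def by fast
    ultimately have "dx (dx (\<lambda>w. ?k *\<^sub>R ?Y w)) w + dy (dy (\<lambda>w. ?k *\<^sub>R ?Y w)) w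
        = ?k *\<^sub>R ((2 * (-1)) *\<^sub>R cross3 (dx ?Y w) (dy ?Y w))"
      by (metis scaleR_add_right)
    also have "\<dots> = (2 * (- 2 / sqrt 3)) *\<^sub>R cross3 (?k *\<^sub>R dx ?Y w) (?k *\<^sub>R dy ?Y w)"
      by (simp add: cross_mult_left cross_mult_right real_div_sqrt)
    finally show "dx (dx (rep (dilated X) U \<phi>)) (\<phi> s) + dy (dy (rep (dilated X) U \<phi>)) (\<phi> s)
      = (2 * (- 2 / sqrt 3)) *\<^sub>R cross3 (dx (rep (dilated X) U \<phi>) (\<phi> s)) (dy (rep (dilated X) U \<phi>) (\<phi> s))"
      unfolding eq D[OF U(1) w] w_def[symmetric] .
  qed
qed

text \<open>The vectors \<alpha> and \<beta>, existentially quantified in the definitions of the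
  association, are thereby identified with the values of the form.\<close>

lemma mc_unit_eq:
  assumes p: "p ` S \<subseteq> S3" and U: "(U, \<phi>) \<in> A" "w \<in> \<phi> ` U"
  shows "dx (rep p U \<phi>) w = (rep p U \<phi>) w \<odot> im_quat a \<Longrightarrow> mc (rep p U \<phi>) w 1 = a"
    and "dy (rep p U \<phi>) w = (rep p U \<phi>) w \<odot> im_quat b \<Longrightarrow> mc (rep p U \<phi>) w \<i> = b"
proof -
  have "norm ((rep p U \<phi>) w) = 1" using unit_chart[OF p U(1)] U(2) by blast
  then show "dx (rep p U \<phi>) w = (rep p U \<phi>) w \<odot> im_quat a \<Longrightarrow> mc (rep p U \<phi>) w 1 = a"
    "dy (rep p U \<phi>) w = (rep p U \<phi>) w \<odot> im_quat b \<Longrightarrow> mc (rep p U \<phi>) w \<i> = b"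
    by (simp_all add: mc_def quat_cancel_left)
qed

lemma dx_dy_unit:
  assumes p: "smooth_map A p" "p ` S \<subseteq> S3" and U: "(U, \<phi>) \<in> A" "w \<in> \<phi> ` U"
  shows "dx (rep p U \<phi>) w = (rep p U \<phi>) w \<odot> im_quat (mc (rep p U \<phi>) w 1)"
    and "dy (rep p U \<phi>) w = (rep p U \<phi>) w \<odot> im_quat (mc (rep p U \<phi>) w \<i>)"
  by (rule quat_dx_dy_mc[OF chart_open[OF U(1)] C_k_on_chart[OF p(1) U(1)] unit_chart[OF p(2) U(1)] U(2)])+

lemma rotated_of_basis:
  assumes "\<And>U \<phi> w. (U, \<phi>) \<in> A \<Longrightarrow> w \<in> \<phi> ` U \<Longrightarrow>
    mc (rep p U \<phi>) w 1 = mc (rep f U \<phi>) w c \<and> mc (rep p U \<phi>) w \<i> = mc (rep f U \<phi>) w (c * \<i>)"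
  shows "rotated c f p"
  unfolding rotated_def
proof clarify
  fix U \<phi> s h assume "(U, \<phi>) \<in> A" "s \<in> U"
  then have "mc (rep p U \<phi>) (\<phi> s) 1 = mc (rep f U \<phi>) (\<phi> s) c"
    "mc (rep p U \<phi>) (\<phi> s) \<i> = mc (rep f U \<phi>) (\<phi> s) (c * \<i>)" using assms by auto
  then show "mc (rep p U \<phi>) (\<phi> s) h = mc (rep f U \<phi>) (\<phi> s) (c * h)"
    using mc_eq[of "rep p U \<phi>" "\<phi> s" h] form_mc[of "rep f U \<phi>" c "\<phi> s" h]
    by (simp only: form_def)
qed

lemma mc_assoc_rot:
  "mc F w assoc_rot = (3/4) *\<^sub>R mc F w 1 - (sqrt 3 / 4) *\<^sub>R mc F w \<i>"
  "mc F w (assoc_rot * \<i>) = (sqrt 3 / 4) *\<^sub>R mc F w 1 + (3/4) *\<^sub>R mc F w \<i>"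
  using mc_eq[of F w assoc_rot] mc_eq[of F w "assoc_rot * \<i>"] by simp_all

lemma cos_sin_120: "cos (2 * pi / 3) = - (1 / 2)" "sin (2 * pi / 3) = sqrt 3 / 2"
  using cos_120 sin_120 by (simp_all add: field_simps)

text \<open>Eliminates X: on one side dX is the form of \<open>f\<close> turned by i, on the other
  its dilation is the form of \<open>p\<close> turned by 2 pi / 3.\<close>

lemma rotated_if_associated:
  assumes f: "f ` S \<subseteq> S3" and p: "(fst \<circ> \<psi>) ` S \<subseteq> S3" and assoc: "associated A f \<psi>"
  shows "rotated assoc_rot f (fst \<circ> \<psi>)"
proof (rule rotated_of_basis)
  fix U \<phi> w assume U: "(U, \<phi>) \<in> A" "w \<in> \<phi> ` U"
  obtain X where fX: "harmonic_H_surface A f X" and pX: "acs_H_surface A \<psi> (dilated X)"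
    using assoc unfolding associated_def by blast
  let ?f = "rep f U \<phi>" and ?p = "fst \<circ> \<psi> \<circ> inv_into U \<phi>" and ?X = "rep X U \<phi>"
  have H: "H_surface (-1) A X" using fX by (simp add: harmonic_H_surface_def)
  have "\<exists>a b. dx ?f w = ?f w \<odot> im_quat a \<and> dy ?f w = ?f w \<odot> im_quat b \<and> dx ?X w = b \<and> dy ?X w = - a"
    using fX U unfolding harmonic_H_surface_def Let_def by fast
  then have X1: "dx ?X w = mc ?f w \<i>" "dy ?X w = - mc ?f w 1"
    using mc_unit_eq[OF f U] by auto
  have "\<exists>a b. dx ?p w = ?p w \<odot> im_quat a \<and> dy ?p w = ?p w \<odot> im_quat b \<and>
      dx (rep (dilated X) U \<phi>) w = cos (2 * pi / 3) *\<^sub>R a + sin (2 * pi / 3) *\<^sub>R b \<and>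
      dy (rep (dilated X) U \<phi>) w = - sin (2 * pi / 3) *\<^sub>R a + cos (2 * pi / 3) *\<^sub>R b"
    using pX U unfolding acs_H_surface_def Let_def by fast
  then have X2: "(sqrt 3 / 2) *\<^sub>R mc ?f w \<i> = - (1/2) *\<^sub>R mc ?p w 1 + (sqrt 3 / 2) *\<^sub>R mc ?p w \<i>"
    "(sqrt 3 / 2) *\<^sub>R (- mc ?f w 1) = - (sqrt 3 / 2) *\<^sub>R mc ?p w 1 + - (1/2) *\<^sub>R mc ?p w \<i>"
    using mc_unit_eq[OF p U] unfolding H_surface_dilation(2,3)[OF H U] X1 cos_sin_120 by metis+
  \<comment> \<open>The rotation by 2 pi / 3 in \<open>X2\<close> is inverted by its
    transpose.\<close>
  have "mc ?p w 1 = (- (1/2)) *\<^sub>R ((sqrt 3 / 2) *\<^sub>R mc ?f w \<i>) + (- (sqrt 3 / 2)) *\<^sub>R ((sqrt 3 / 2) *\<^sub>R (- mc ?f w 1))"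
    unfolding X2 by (simp add: algebra_simps flip: scaleR_add_left)
  moreover have "mc ?p w \<i> = (sqrt 3 / 2) *\<^sub>R ((sqrt 3 / 2) *\<^sub>R mc ?f w \<i>) + (- (1/2)) *\<^sub>R ((sqrt 3 / 2) *\<^sub>R (- mc ?f w 1))"
    unfolding X2 by (simp add: algebra_simps flip: scaleR_add_left)
  ultimately show "mc ?p w 1 = mc ?f w assoc_rot \<and> mc ?p w \<i> = mc ?f w (assoc_rot * \<i>)"
    unfolding mc_assoc_rot by simp
qed

text \<open>X is the second component of a solution for the affine action with c = i. Closedness of
  dX is the harmonicity of \<open>f\<close>, and H = -1 is the structure equation.\<close>

lemma associated_if_rotated:
  assumes "simply_connected S" and f: "harmonic_map S A f" and p: "smooth_map A (fst \<circ> \<psi>)" "(fst \<circ> \<psi>) ` S \<subseteq> S3"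
    and rot: "rotated assoc_rot f (fst \<circ> \<psi>)"
  shows "associated A f \<psi>"
proof -
  have f': "smooth_map A f" "f ` S \<subseteq> S3"
    using f unfolding harmonic_map_iff by blast+
  note curl = harmonic_curl[OF f]
  obtain s0 where s0: "s0 \<in> S" using RS by (auto simp: riemann_surface_def)
  have "flat affine_action (\<lambda>w. mc (rep f U \<phi>) w \<i>) (\<lambda>w. mc (rep f U \<phi>) w (\<i> * \<i>)) w"
    if U: "(U, \<phi>) \<in> A" "w \<in> \<phi> ` U" for U \<phi> w
    using curl[OF U, of \<i>] by (intro flat_affine_action) simp
  then obtain G where G: "G s0 = (1, 0)" "\<And>s. s \<in> S \<Longrightarrow> gsol affine_action \<i> f s G"
    using gsol_exists[OF bounded_bilinear_affine_action f'(1) assms(1) s0] by metis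
  have DG: "((rep G U \<phi>) has_derivative (\<lambda>h. (0, fst (G (inv_into U \<phi> w)) *\<^sub>R mc (rep f U \<phi>) w (\<i> * h)))) (at w)"
    if U: "(U, \<phi>) \<in> A" "w \<in> \<phi> ` U" for U \<phi> w
    using gsol_iff_charts[of affine_action \<i> f G] G(2) U unfolding affine_action_def by fast
  \<comment> \<open>The solution stays in the affine hyperplane, so that the action really
    translates its second component.\<close>
  have "fst (G s) = 1" if s: "s \<in> S" for s
  proof -
    have "fst (G s) = fst (G s0)"
    proof (rule constant_if_derivative_zero[OF f'(1) _ s0 s, of "\<lambda>s. fst (G s)"])
      fix U \<phi> w assume "(U, \<phi>) \<in> A" "w \<in> \<phi> ` U"
      from has_derivative_fst[OF DG[OF this]] show "(((\<lambda>s. fst (G s)) \<circ> inv_into U \<phi>) has_derivative (\<lambda>h. 0)) (at w)"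
        by (simp add: comp_def)
    qed
    then show ?thesis using G(1) by simp
  qed
  then have G1: "fst (G (inv_into U \<phi> w)) = 1" if "(U, \<phi>) \<in> A" "w \<in> \<phi> ` U" for U \<phi> w
    using that chart_inv_in chart_subset by blast
  define X where "X = snd \<circ> G"
  have X: "smooth_map A X"
    using gsol_smooth[OF bounded_bilinear_affine_action f'(1) G(2)] smooth_map_components[of G] by (simp add: X_def)
  have dX: "dx (rep X U \<phi>) w = mc (rep f U \<phi>) w \<i>" "dy (rep X U \<phi>) w = - mc (rep f U \<phi>) w 1"
    if U: "(U, \<phi>) \<in> A" "w \<in> \<phi> ` U" for U \<phi> w
  proof -
    have "((rep X U \<phi>) has_derivative (\<lambda>h. mc (rep f U \<phi>) w (\<i> * h))) (at w)"
      using has_derivative_snd[OF DG[OF U]] G1[OF U] by (simp add: X_def comp_def)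
    then show "dx (rep X U \<phi>) w = mc (rep f U \<phi>) w \<i>" "dy (rep X U \<phi>) w = - mc (rep f U \<phi>) w 1"
      using mc_eq[of "rep f U \<phi>" w "\<i> * \<i>"] by (simp_all add: dx_eq dy_eq)
  qed
  have "H_surface (-1) A X"
    unfolding H_surface_def Let_def
  proof (intro conjI X, clarify)
    fix U \<phi> s assume U: "(U, \<phi>) \<in> A" "s \<in> U"
    define w where "w = \<phi> s"
    have w: "w \<in> \<phi> ` U" using U by (simp add: w_def)
    let ?f = "rep f U \<phi>" and ?X = "rep X U \<phi>"
    have C: "C_k_on (Suc 0) (\<phi> ` U) (\<lambda>w. mc ?f w 1)"
      by (rule C_k_on_mc[OF chart_open[OF U(1)] C_k_on_chart[OF f'(1) U(1)]])
    have "dx (dx ?X) w = dx (\<lambda>w. mc ?f w \<i>) w" "dy (dy ?X) w = dy (\<lambda>w. - mc ?f w 1) w"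
      using dX[OF U(1)] by (auto intro: dx_cong_open[OF chart_open[OF U(1)] w] dy_cong_open[OF chart_open[OF U(1)] w])
    moreover have "dy (\<lambda>w. - mc ?f w 1) w = - dy (\<lambda>w. mc ?f w 1) w"
      by (rule dy_linear[OF bounded_linear_minus[OF bounded_linear_ident] C_k_on_differentiable[OF C chart_open[OF U(1)] w]])
    \<comment> \<open>The Laplacian of X is minus the curl of the form of \<open>f\<close>.\<close>
    ultimately have "dx (dx ?X) w + dy (dy ?X) w = - (dy (\<lambda>w. mc ?f w 1) w - dx (\<lambda>w. mc ?f w (1 * \<i>)) w)"
      by simp
    also have "\<dots> = - (2 *\<^sub>R cross_mc ?f w)"
      unfolding curl[OF U(1) w] by simp
    also have "\<dots> = (2 * (-1)) *\<^sub>R cross3 (dx ?X w) (dy ?X w)"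
      unfolding dX[OF U(1) w] by (simp add: cross_mc_def cross_skew[of "mc ?f w 1"])
    finally show "dx (dx ?X) (\<phi> s) + dy (dy ?X) (\<phi> s) = (2 * (-1)) *\<^sub>R cross3 (dx ?X (\<phi> s)) (dy ?X (\<phi> s))"
      by (simp only: w_def)
  qed
  note H = this H_surface_dilation[OF this]
  have "harmonic_H_surface A f X"
    unfolding harmonic_H_surface_def Let_def
  proof (intro conjI H(1) ballI, clarify)
    fix U \<phi> s assume "(U, \<phi>) \<in> A" "s \<in> U"
    then have U: "(U, \<phi>) \<in> A" "\<phi> s \<in> \<phi> ` U" by auto
    show "\<exists>a b. dx (rep f U \<phi>) (\<phi> s) = (rep f U \<phi>) (\<phi> s) \<odot> im_quat a \<and>
        dy (rep f U \<phi>) (\<phi> s) = (rep f U \<phi>) (\<phi> s) \<odot> im_quat b \<and>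
        dx (rep X U \<phi>) (\<phi> s) = b \<and> dy (rep X U \<phi>) (\<phi> s) = - a"
      using dx_dy_unit[OF f' U] dX[OF U] by (intro exI conjI)
  qed
  moreover have "acs_H_surface A \<psi> (dilated X)"
    unfolding acs_H_surface_def Let_def
  proof (intro conjI H(2), clarify)
    fix U \<phi> s assume U: "(U, \<phi>) \<in> A" "s \<in> U"
    define w where "w = \<phi> s"
    have w: "w \<in> \<phi> ` U" using U by (simp add: w_def)
    let ?f = "rep f U \<phi>" and ?p = "fst \<circ> \<psi> \<circ> inv_into U \<phi>"
    have p1: "mc ?p w 1 = mc ?f w assoc_rot" "mc ?p w \<i> = mc ?f w (assoc_rot * \<i>)"
      using rotatedD[OF rot U(1) w, of 1] rotatedD[OF rot U(1) w, of \<i>] by simp_all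
    have s3: "sqrt 3 * (sqrt 3 * x) = 3 * x" "sqrt 3 * sqrt 3 = 3" for x :: real by (simp_all flip: mult.assoc)
    have "(sqrt 3 / 2) *\<^sub>R mc ?f w \<i> = - (1/2) *\<^sub>R mc ?p w 1 + (sqrt 3 / 2) *\<^sub>R mc ?p w \<i>"
      "(sqrt 3 / 2) *\<^sub>R - mc ?f w 1 = - (sqrt 3 / 2) *\<^sub>R mc ?p w 1 + - (1/2) *\<^sub>R mc ?p w \<i>"
      unfolding p1 mc_assoc_rot by (simp_all add: vec_eq_iff s3 field_simps)
    then have "dx (rep (dilated X) U \<phi>) w = cos (2 * pi / 3) *\<^sub>R mc ?p w 1 + sin (2 * pi / 3) *\<^sub>R mc ?p w \<i>"
      "dy (rep (dilated X) U \<phi>) w = - sin (2 * pi / 3) *\<^sub>R mc ?p w 1 + cos (2 * pi / 3) *\<^sub>R mc ?p w \<i>"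
      unfolding H(3,4)[OF U(1) w] dX[OF U(1) w] cos_sin_120 by simp_all
    then show "\<exists>a b. dx ?p (\<phi> s) = ?p (\<phi> s) \<odot> im_quat a \<and> dy ?p (\<phi> s) = ?p (\<phi> s) \<odot> im_quat b \<and>
      dx (rep (dilated X) U \<phi>) (\<phi> s) = cos (2 * pi / 3) *\<^sub>R a + sin (2 * pi / 3) *\<^sub>R b \<and>
      dy (rep (dilated X) U \<phi>) (\<phi> s) = - sin (2 * pi / 3) *\<^sub>R a + cos (2 * pi / 3) *\<^sub>R b"
      using dx_dy_unit[OF p U(1) w] unfolding w_def by (intro exI conjI)
  qed
  ultimately show ?thesis unfolding associated_def by blast
qed

section \<open>Both directions of the correspondence\<close>

lemma rotated_inverse:
  assumes "rotated c f p" "c \<noteq> 0"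
  shows "rotated (1 / c) p f"
  unfolding rotated_def
proof clarify
  fix U \<phi> s h assume "(U, \<phi>) \<in> A" "s \<in> U"
  then show "mc (rep f U \<phi>) (\<phi> s) h = mc (rep p U \<phi>) (\<phi> s) (1 / c * h)"
    using rotatedD[OF assms(1), of U \<phi> "\<phi> s" "1 / c * h"] assms(2) by simp
qed

lemma rotated_trans: "rotated c f p \<Longrightarrow> rotated d p q \<Longrightarrow> rotated (c * d) f q"
  unfolding rotated_def by (fastforce simp: mult.assoc)

lemma harmonic_to_acs:
  assumes "simply_connected S" and f: "harmonic_map S A f"
  shows "\<exists>\<psi>. almost_complex_surface S A \<psi> \<and> associated A f \<psi> \<and>
           (\<forall>\<psi>'. almost_complex_surface S A \<psi>' \<and> associated A f \<psi>' \<longrightarrow>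
              (\<exists>a\<in>S3. \<exists>b\<in>S3. \<forall>s\<in>S. \<psi>' s = (a \<odot> fst (\<psi> s), b \<odot> snd (\<psi> s))))"
proof -
  have f': "smooth_map A f" "f ` S \<subseteq> S3"
    using f unfolding harmonic_map_iff by blast+
  have curl: "dy (\<lambda>w. mc (rep f U \<phi>) w c) w - dx (\<lambda>w. mc (rep f U \<phi>) w (c * \<i>)) w
      = 2 *\<^sub>R cross3 (mc (rep f U \<phi>) w c) (mc (rep f U \<phi>) w (c * \<i>))"
    if "(U, \<phi>) \<in> A" "w \<in> \<phi> ` U" and c: "(norm c)\<^sup>2 = Re c" for U \<phi> w c
    unfolding harmonic_curl[OF f that(1,2)] cross_rotated_mc c by simp
  \<comment> \<open>This is the complex conjugate of \<open>assoc_rot\<close>, so it lies on the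
    same circle |c|^2 = Re c; it is the rotation that produces \<open>q\<close>.\<close>
  let ?d = "assoc_rot * sixth_root"
  have c: "(norm assoc_rot)\<^sup>2 = Re assoc_rot" "(norm ?d)\<^sup>2 = Re ?d"
    by (simp_all only: norm_mult power_mult_distrib cmod_power2) (simp_all add: power_divide)
  obtain p where p: "smooth_map A p" "p ` S \<subseteq> S3" "rotated assoc_rot f p"
    using rotated_exists[OF f'(1) assms(1) curl[OF _ _ c(1)]] by metis
  obtain q where q: "smooth_map A q" "q ` S \<subseteq> S3" "rotated ?d f q"
    using rotated_exists[OF f'(1) assms(1) curl[OF _ _ c(2)]] by metis
  define \<psi> where "\<psi> s = (p s, q s)" for s
  have \<psi>: "fst \<circ> \<psi> = p" "snd \<circ> \<psi> = q" by (auto simp: \<psi>_def)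
  have n0: "assoc_rot \<noteq> 0" by (simp add: complex_eq_iff)
  have "rotated (1 / assoc_rot * ?d) p q"
    by (rule rotated_trans[OF rotated_inverse[OF p(3) n0] q(3)])
  moreover have "1 / assoc_rot * ?d = sixth_root" using n0 by simp
  ultimately have "rotated sixth_root p q" by simp
  then have acs: "almost_complex_surface S A \<psi>"
    unfolding acs_iff \<psi> using p q by blast
  have "associated A f \<psi>"
    by (rule associated_if_rotated[OF assms]) (use p in \<open>simp_all only: \<psi>\<close>)
  \<comment> \<open>Each factor is determined by its form up to a left factor of its own, which
    gives independent \<open>a\<close> and \<open>b\<close>.\<close>
  moreover have "\<exists>a\<in>S3. \<exists>b\<in>S3. \<forall>s\<in>S. \<psi>' s = (a \<odot> fst (\<psi> s), b \<odot> snd (\<psi> s))"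
    if acs': "almost_complex_surface S A \<psi>'" and assoc': "associated A f \<psi>'" for \<psi>'
  proof -
    have p': "smooth_map A (fst \<circ> \<psi>')" "(fst \<circ> \<psi>') ` S \<subseteq> S3" and q': "smooth_map A (snd \<circ> \<psi>')" "(snd \<circ> \<psi>') ` S \<subseteq> S3"
      and r': "rotated sixth_root (fst \<circ> \<psi>') (snd \<circ> \<psi>')"
      using acs' unfolding acs_iff by blast+
    have rp: "rotated assoc_rot f (fst \<circ> \<psi>')"
      by (rule rotated_if_associated[OF f'(2) p'(2) assoc'])
    obtain a where a: "a \<in> S3" "\<forall>s\<in>S. (fst \<circ> \<psi>') s = a \<odot> p s"
      using rotated_unique[OF f'(1) p p' rp] by blast
    obtain b where b: "b \<in> S3" "\<forall>s\<in>S. (snd \<circ> \<psi>') s = b \<odot> q s"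
      using rotated_unique[OF f'(1) q q' rotated_trans[OF rp r']] by blast
    have "\<psi>' s = (a \<odot> fst (\<psi> s), b \<odot> snd (\<psi> s))" if "s \<in> S" for s
      using a(2) b(2) that by (intro prod_eqI) (simp_all add: \<psi>_def)
    then show ?thesis using a(1) b(1) by blast
  qed
  ultimately show ?thesis using acs by blast
qed

text \<open>The structure equation of \<open>q\<close> is compared with that of \<open>p\<close>.
  Rotation by the unit complex number \<open>sixth_root\<close> keeps the cross product, while the
  curl becomes half the curl plus sqrt 3 / 2 times the divergence of the form of
  \<open>p\<close>.\<close>

lemma acs_div_mc:
  assumes p: "smooth_map A p" "p ` S \<subseteq> S3" and q: "smooth_map A q" "q ` S \<subseteq> S3"
    and rot: "rotated sixth_root p q" and U: "(U, \<phi>) \<in> A" "w \<in> \<phi> ` U"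
  shows "div_mc (rep p U \<phi>) w = (2 / sqrt 3) *\<^sub>R cross_mc (rep p U \<phi>) w"
proof -
  let ?p = "rep p U \<phi>" and ?q = "rep q U \<phi>"
  note op = chart_open[OF U(1)]
  note Cp = C_k_on_chart[OF p(1) U(1), of 2] and np = unit_chart[OF p(2) U(1)]
  have curl_p: "curl_mc ?p w = 2 *\<^sub>R cross_mc ?p w" by (rule curl_mc_eq[OF op Cp np U(2)])
  have "curl_mc ?q w = 2 *\<^sub>R cross_mc ?q w"
    by (rule curl_mc_eq[OF op C_k_on_chart[OF q(1) U(1)] unit_chart[OF q(2) U(1)] U(2)])
  moreover have "cross_mc ?q w = cross_mc ?p w"
  proof -
    have "cross_mc ?q w = cross3 (mc ?p w sixth_root) (mc ?p w (sixth_root * \<i>))"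
      using rotatedD[OF rot U, of 1] rotatedD[OF rot U, of \<i>] by (simp add: cross_mc_def)
    also have "\<dots> = cross_mc ?p w"
      unfolding cross_rotated_mc by (simp add: cmod_power2 power_divide)
    finally show ?thesis .
  qed
  moreover have "curl_mc ?q w = dy (\<lambda>w. mc ?p w sixth_root) w - dx (\<lambda>w. mc ?p w (sixth_root * \<i>)) w"
  proof -
    have "mc ?q v 1 = mc ?p v sixth_root" "mc ?q v \<i> = mc ?p v (sixth_root * \<i>)" if "v \<in> \<phi> ` U" for v
      using rotatedD[OF rot U(1) that, of 1] rotatedD[OF rot U(1) that, of \<i>] by simp_all
    then have "dy (\<lambda>w. mc ?q w 1) w = dy (\<lambda>w. mc ?p w sixth_root) w"
      "dx (\<lambda>w. mc ?q w \<i>) w = dx (\<lambda>w. mc ?p w (sixth_root * \<i>)) w"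
      by (auto intro: dx_cong_open[OF op U(2)] dy_cong_open[OF op U(2)])
    then show ?thesis by (simp add: curl_mc_def)
  qed
  moreover have "dy (\<lambda>w. mc ?p w sixth_root) w - dx (\<lambda>w. mc ?p w (sixth_root * \<i>)) w
      = (1/2) *\<^sub>R curl_mc ?p w + (sqrt 3 / 2) *\<^sub>R div_mc ?p w"
    unfolding dx_mc[OF op Cp U(2), of "sixth_root * \<i>"] dy_mc[OF op Cp U(2), of sixth_root]
    by (simp add: curl_mc_def div_mc_def algebra_simps)
  ultimately have "cross_mc ?p w + (sqrt 3 / 2) *\<^sub>R div_mc ?p w = 2 *\<^sub>R cross_mc ?p w"
    using curl_p by simp
  then have "(sqrt 3 / 2) *\<^sub>R div_mc ?p w = cross_mc ?p w" by (simp add: scaleR_2)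
  then have "(2 / sqrt 3) *\<^sub>R ((sqrt 3 / 2) *\<^sub>R div_mc ?p w) = (2 / sqrt 3) *\<^sub>R cross_mc ?p w" by (rule arg_cong)
  then show ?thesis by simp
qed

lemma acs_to_harmonic:
  assumes "simply_connected S" and \<psi>: "almost_complex_surface S A \<psi>"
  shows "\<exists>f. harmonic_map S A f \<and> associated A f \<psi> \<and>
           (\<forall>f'. harmonic_map S A f' \<and> associated A f' \<psi> \<longrightarrow> (\<exists>a\<in>S3. \<forall>s\<in>S. f' s = a \<odot> f s))"
proof -
  define p where "p = fst \<circ> \<psi>"
  have p: "smooth_map A p" "p ` S \<subseteq> S3" and q: "smooth_map A (snd \<circ> \<psi>)" "(snd \<circ> \<psi>) ` S \<subseteq> S3"
    and rot: "rotated sixth_root p (snd \<circ> \<psi>)"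
    using \<psi> unfolding acs_iff p_def by blast+
  note div = acs_div_mc[OF p q rot]
  \<comment> \<open>The inverse of \<open>assoc_rot\<close>. With k = 2 / sqrt 3 it satisfies 2 Re c
    + k Im c = 2 |c|^2 = 8/3, so the rotated form integrates, and k Re c - 2 Im c = 0, so the
    resulting map is harmonic.\<close>
  let ?c = "Complex 1 (1 / sqrt 3)"
  have c: "1 / assoc_rot = ?c" "1 / ?c = assoc_rot" "assoc_rot \<noteq> 0" "?c \<noteq> 0"
  proof -
    have "assoc_rot * ?c = 1" by (simp add: complex_eq_iff real_div_sqrt field_simps)
    then show "1 / assoc_rot = ?c" "1 / ?c = assoc_rot" "assoc_rot \<noteq> 0" "?c \<noteq> 0"
      by (auto simp: divide_simps mult.commute)
  qed
  have "dy (\<lambda>w. mc (rep p U \<phi>) w ?c) w - dx (\<lambda>w. mc (rep p U \<phi>) w (?c * \<i>)) w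
      = 2 *\<^sub>R cross3 (mc (rep p U \<phi>) w ?c) (mc (rep p U \<phi>) w (?c * \<i>))"
    if U: "(U, \<phi>) \<in> A" "w \<in> \<phi> ` U" for U \<phi> w
    unfolding curl_rotated_mc(1)[OF chart_open[OF U(1)] C_k_on_chart[OF p(1) U(1)] unit_chart[OF p(2) U(1)] U(2) div[OF U]]
      cross_rotated_mc by (simp add: cmod_power2 power_divide)
  then obtain f where f: "smooth_map A f" "f ` S \<subseteq> S3" "rotated ?c p f"
    using rotated_exists[OF p(1) assms(1)] by metis
  have "div_mc (rep f U \<phi>) w = 0" if U: "(U, \<phi>) \<in> A" "w \<in> \<phi> ` U" for U \<phi> w
  proof -
    let ?f = "rep f U \<phi>" and ?p = "rep p U \<phi>"
    have "mc ?f v 1 = mc ?p v ?c" "mc ?f v \<i> = mc ?p v (?c * \<i>)" if "v \<in> \<phi> ` U" for v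
      using rotatedD[OF f(3) U(1) that, of 1] rotatedD[OF f(3) U(1) that, of \<i>] by simp_all
    then have "dx (\<lambda>w. mc ?f w 1) w = dx (\<lambda>w. mc ?p w ?c) w"
      "dy (\<lambda>w. mc ?f w \<i>) w = dy (\<lambda>w. mc ?p w (?c * \<i>)) w"
      by (auto intro: dx_cong_open[OF chart_open[OF U(1)] U(2)] dy_cong_open[OF chart_open[OF U(1)] U(2)])
    then have "div_mc ?f w = dx (\<lambda>w. mc ?p w ?c) w + dy (\<lambda>w. mc ?p w (?c * \<i>)) w"
      by (simp add: div_mc_def)
    also have "\<dots> = 0"
      unfolding curl_rotated_mc(2)[OF chart_open[OF U(1)] C_k_on_chart[OF p(1) U(1)] unit_chart[OF p(2) U(1)] U(2) div[OF U]]
      by simp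
    finally show ?thesis .
  qed
  then have harm: "harmonic_map S A f" using f unfolding harmonic_map_iff by blast
  moreover have "rotated assoc_rot f p" using rotated_inverse[OF f(3) c(4)] by (simp only: c(2))
  then have "associated A f \<psi>"
    by (intro associated_if_rotated[OF assms(1) harm]) (use p in \<open>simp_all only: p_def\<close>)
  moreover have "\<exists>a\<in>S3. \<forall>s\<in>S. f' s = a \<odot> f s" if f': "harmonic_map S A f'" "associated A f' \<psi>" for f'
  proof (rule rotated_unique[OF p(1) f])
    show *: "smooth_map A f'" "f' ` S \<subseteq> S3" using f'(1) unfolding harmonic_map_iff by blast+
    have "rotated assoc_rot f' p"
      using rotated_if_associated[OF *(2) _ f'(2)] p(2) by (simp only: p_def)
    from rotated_inverse[OF this c(3)] show "rotated ?c p f'" by (simp only: c(1))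
  qed
  ultimately show ?thesis by blast
qed

text \<open>The rotation from \<open>f\<close> to \<open>p\<close> contributes its square, the
  passage from \<open>p\<close> to \<psi> a constant. The phases cancel: e^(i pi/3) times the square
  of (sqrt 3 / 2) e^(-i pi/6) is 3/4, so the total factor is 3/2.\<close>

lemma differentials_correspond:
  assumes f: "harmonic_map S A f" and \<psi>: "almost_complex_surface S A \<psi>" and assoc: "associated A f \<psi>"
    and U: "(U, \<phi>) \<in> A" "w \<in> \<phi> ` U"
  shows "acs_differential_coeff (rep \<psi> U \<phi>) w = 2 * sixth_root * (assoc_rot\<^sup>2 * hopf_coeff (rep f U \<phi>) w)"
proof -
  have f': "smooth_map A f" "f ` S \<subseteq> S3" using f unfolding harmonic_map_iff by blast+
  have p: "smooth_map A (fst \<circ> \<psi>)" "(fst \<circ> \<psi>) ` S \<subseteq> S3" and q: "(snd \<circ> \<psi>) ` S \<subseteq> S3"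
    and rot: "rotated sixth_root (fst \<circ> \<psi>) (snd \<circ> \<psi>)" and \<psi>': "smooth_map A \<psi>"
    using \<psi> smooth_map_components[of \<psi>] unfolding acs_iff by blast+
  have "acs_differential_coeff (rep \<psi> U \<phi>) w = 2 * sixth_root * hopf_coeff (fst \<circ> (rep \<psi> U \<phi>)) w"
  proof (rule acs_differential_coeff_hopf[OF chart_open[OF U(1)] C_k_on_chart[OF \<psi>' U(1)] _ _ U(2)])
    show "\<forall>w\<in>\<phi> ` U. norm (fst ((rep \<psi> U \<phi>) w)) = 1" "\<forall>w\<in>\<phi> ` U. norm (snd ((rep \<psi> U \<phi>) w)) = 1"
      using unit_chart[OF p(2) U(1)] unit_chart[OF q U(1)] by simp_all
    show "mc (snd \<circ> (rep \<psi> U \<phi>)) w v = mc (fst \<circ> (rep \<psi> U \<phi>)) w (sixth_root * v)" for v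
      using rotatedD[OF rot U] by (simp only: comp_assoc)
  qed
  also have "hopf_coeff (fst \<circ> (rep \<psi> U \<phi>)) w = assoc_rot\<^sup>2 * hopf_coeff (rep f U \<phi>) w"
    unfolding comp_assoc[symmetric]
    by (rule hopf_coeff_rotated[OF chart_open[OF U(1)] C_k_on_chart[OF f'(1) U(1)] unit_chart[OF f'(2) U(1)]
        C_k_on_chart[OF p(1) U(1)] unit_chart[OF p(2) U(1)] U(2) rotatedD[OF rotated_if_associated[OF f'(2) p(2) assoc] U]])
  finally show ?thesis .
qed

end

text \<open>The association sees \<open>f\<close> and \<psi> only through their forms, so left
  translations are the whole ambiguity. Non-conformality and non-vanishing are compared both
  globally, as not identically zero, and point by point.\<close>

theorem theorem5p3:
  fixes S :: "'a::t2_space set" and A :: "'a charts"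
  assumes "riemann_surface S A" and "simply_connected S"
  shows
    "(\<forall>f. harmonic_map S A f \<longrightarrow>
        (\<exists>\<psi>. almost_complex_surface S A \<psi> \<and> associated A f \<psi> \<and>
           (\<forall>\<psi>'. almost_complex_surface S A \<psi>' \<and> associated A f \<psi>' \<longrightarrow>
              (\<exists>a\<in>S3. \<exists>b\<in>S3. \<forall>s\<in>S. \<psi>' s = (a \<odot> fst (\<psi> s), b \<odot> snd (\<psi> s)))))) \<and>
     (\<forall>\<psi>. almost_complex_surface S A \<psi> \<longrightarrow>
        (\<exists>f. harmonic_map S A f \<and> associated A f \<psi> \<and>
           (\<forall>f'. harmonic_map S A f' \<and> associated A f' \<psi> \<longrightarrow>
              (\<exists>a\<in>S3. \<forall>s\<in>S. f' s = a \<odot> f s)))) \<and>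
     (\<forall>f \<psi>. harmonic_map S A f \<and> almost_complex_surface S A \<psi> \<and> associated A f \<psi> \<longrightarrow>
        (\<not> conformal_map A f \<longleftrightarrow> \<not> vanishing_differential A \<psi>) \<and>
        (\<forall>(U, \<phi>)\<in>A. \<forall>w\<in>\<phi> ` U.
           hopf_coeff (f \<circ> inv_into U \<phi>) w \<noteq> 0 \<longleftrightarrow>
           acs_differential_coeff (\<psi> \<circ> inv_into U \<phi>) w \<noteq> 0))"
proof -
  interpret riemann S A by standard (rule assms(1))
  have "hopf_coeff (rep f U \<phi>) w \<noteq> 0 \<longleftrightarrow> acs_differential_coeff (rep \<psi> U \<phi>) w \<noteq> 0"
    if "harmonic_map S A f \<and> almost_complex_surface S A \<psi> \<and> associated A f \<psi>" "(U, \<phi>) \<in> A" "w \<in> \<phi> ` U" for f \<psi> U \<phi> w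
  proof -
    define k where "k = 2 * sixth_root * assoc_rot\<^sup>2"
    have "k \<noteq> 0"
      unfolding k_def by (simp only: mult_eq_0_iff power_eq_0_iff) (simp add: complex_eq_iff)
    moreover have "acs_differential_coeff (rep \<psi> U \<phi>) w = k * hopf_coeff (rep f U \<phi>) w"
      using differentials_correspond[of f \<psi> U \<phi> w] that by (simp only: k_def mult.assoc)
    ultimately show ?thesis by simp
  qed
  note coeff = this
  show ?thesis
  proof (intro conjI allI impI)
    fix f \<psi> assume *: "harmonic_map S A f \<and> almost_complex_surface S A \<psi> \<and> associated A f \<psi>"
    show "\<not> conformal_map A f \<longleftrightarrow> \<not> vanishing_differential A \<psi>"
      using coeff[OF *] unfolding conformal_map_def vanishing_differential_def by fast
    show "\<forall>(U, \<phi>)\<in>A. \<forall>w\<in>\<phi> ` U. hopf_coeff (rep f U \<phi>) w \<noteq> 0 \<longleftrightarrow>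
        acs_differential_coeff (rep \<psi> U \<phi>) w \<noteq> 0"
      using coeff[OF *] by fast
  qed (use harmonic_to_acs[OF assms(2)] acs_to_harmonic[OF assms(2)] in blast)+
qed

end
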